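(* Let $f,g\colon\mathbb{R}^3\to\mathbb{R}$ be globally bounded and globally Lipschitz continuous (with Lipschitz constant $\lambda$), with $|f(x,y,z)|,|g(x,y,z)|<M$ for all $(x,y,z)$. Consider, for $\varepsilon>0$, the system \[ \dot x = f(x,y,z),\qquad \dot y = g(x,y,z),\qquad \varepsilon\dot z = x+|z|. \] Assume $f(0,0,0)=0$, $g(0,0,0)>0$, and $y\cdot f(0,y,0)<0$ for all $y\neq 0$. Let $w_a^*(t)=(x_a^*(t),y_a^*(t))$ be the solution of $\dot x=f_a(x,y):=f(x,y,x)$, $\dot y=g_a(x,y):=g(x,y,x)$ with $x(0)=y(0)=0$, and $w_r^*(t)=(x_r^*(t),y_r^*(t))$ the solution of $\dot x=f_r(x,y):=f(x,y,-x)$, $\dot y=g_r(x,y):=g(x,y,-x)$ with $x(0)=y(0)=0$. Let $T_a<0<T_r$ be such that $x_a^*(t)<0$ for $T_a<t<0$ and $x_r^*(t)<0$ for $0<t<T_r$. Assume there exist $\tau,\sigma$ with $T_a<\tau<0<\sigma<T_r$ and $x_a^*(\tau)=x_r^*(\sigma)=x^*$, $y_a^*(\tau)=y_r^*(\sigma)=y^*$, and that \[ A=f_a(x^*,y^* )g_r(x^*,y^* )-f_r(x^*,y^* )g_a(x^*,y^* )\neq 0 . \] Then for every sufficiently small $\varepsilon>0$ the system has a periodic solution, and its minimal period $T_{\min}(\varepsilon)$ satisfies $T_{\min}(\varepsilon)\to\sigma-\tau$ as $\varepsilon\to 0$. *)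

theory Defs
  imports "HOL-Analysis.Analysis"
begin

text \<open>Points of R^3 are triples (x,y,z) :: real \<times> real \<times> real; the product norm on
  this type is the Euclidean norm.\<close>

definition is_solution ::
  "(real \<times> real \<times> real \<Rightarrow> real) \<Rightarrow> (real \<times> real \<times> real \<Rightarrow> real) \<Rightarrow> real
     \<Rightarrow> (real \<Rightarrow> real \<times> real \<times> real) \<Rightarrow> bool" where
  "is_solution f g \<epsilon> w \<longleftrightarrow>
     (\<forall>t. (w has_vector_derivative
              (f (w t), g (w t), (fst (w t) + \<bar>snd (snd (w t))\<bar>) / \<epsilon>)) (at t))"

definition is_period :: "(real \<Rightarrow> 'a) \<Rightarrow> real \<Rightarrow> bool" where
  "is_period w T \<longleftrightarrow> T > 0 \<and> (\<forall>t. w (t + T) = w t)"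

definition is_min_period :: "(real \<Rightarrow> 'a) \<Rightarrow> real \<Rightarrow> bool" where
  "is_min_period w T \<longleftrightarrow> is_period w T \<and> (\<forall>T'. 0 < T' \<and> T' < T \<longrightarrow> \<not> is_period w T')"

end

(*
On the attracting sheet z = x < 0 the system follows the reduced flow with an error O(eps), and so
does the reversed system on the repelling sheet z = - x > 0, which the reflection
(t, y, z) -> (-t, -y, -z) turns into the attracting one. Both reduced flows are non-degenerate in
y near the origin, so the initial points near (xs, ys) are labelled by the abscissa p (resp. q) at
which the forward (resp. backward) reduced orbit meets y = 0; the transversality A <> 0 makes the
choice of the common initial point a regular 2 x 2 system. To close the orbit, both halves must end
at the same point of the plane z = 0, near the origin. Each half is continued through z = 0 by
its own linear fast equation, so that all quantities converge uniformly; on z = 0 the abscissas of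
the two ends are eps f(0, y, 0) and - eps f(0, y, 0) up to o(eps), and the sign condition on
y f(0, y, 0) places their coincidence near y = 0. The Poincare-Miranda theorem solves the
resulting six equations. The sign condition also shows that the two halves do not cross z = 0
before their ends, so they are orbits of the true system; the sign of z then identifies the
minimal period.
*)

theory Submission
  imports Defs
begin

section \<open>The Poincare-Miranda theorem\<close>

text \<open>The cycle is a canard: it follows the repelling sheet for a time of order one, so
  shooting forward from the fold would be exponentially sensitive. Both halves are therefore shot
  from a point with \<open>z = 0\<close> on the fast segment between the sheets, one forward and one
  backward in time; in these directions each half is contracted towards its sheet. As
  \<open>f\<close> and \<open>g\<close> are only Lipschitz, there is no variational equation and no
  implicit function theorem at hand: all equations are solved by sign changes on opposite faces of a
  box whose size is fixed before \<epsilon>. The arrival at \<open>z = 0\<close> may be tangential,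
  because \<epsilon> times the speed of \<open>z\<close> equals \<open>x\<close> there and
  \<open>x\<close> may vanish together with \<open>y\<close>. Hence the arrival time is not a
  continuous function of the start and becomes an unknown with its own equation. The linear
  continuation keeps every candidate orbit continuous in all unknowns; only the solution that is
  found has to be checked to stay on its side of \<open>z = 0\<close>.\<close>

lemma poincare_miranda:
  fixes F :: "'a::euclidean_space \<Rightarrow> 'a"
  assumes cont: "continuous_on (cbox a b) F"
    and ab: "\<And>i. i \<in> Basis \<Longrightarrow> a \<bullet> i \<le> b \<bullet> i"
    and lower: "\<And>x i. x \<in> cbox a b \<Longrightarrow> i \<in> Basis \<Longrightarrow> x \<bullet> i = a \<bullet> i \<Longrightarrow> F x \<bullet> i \<le> 0"
    and upper: "\<And>x i. x \<in> cbox a b \<Longrightarrow> i \<in> Basis \<Longrightarrow> x \<bullet> i = b \<bullet> i \<Longrightarrow> F x \<bullet> i \<ge> 0"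
  shows "\<exists>x\<in>cbox a b. F x = 0"
proof -
  \<comment> \<open>If the clamp is active in coordinate \<open>i\<close> at a fixed point, then
    \<open>x\<close> lies on a face and \<open>F x \<bullet> i\<close> has the strict sign that the
    face condition excludes. So the clamp is inactive and \<open>F x\<close> vanishes.\<close>
  define G where "G = (\<lambda>x. clamp a b (x - F x))"
  have ne: "cbox a b \<noteq> {}"
    using ab by (simp add: box_ne_empty)
  have "continuous_on UNIV (clamp a b)"
    by (rule clamp_continuous_on[of a b "\<lambda>x. x"]) (rule continuous_on_id)
  then have "continuous_on (cbox a b) G"
    unfolding G_def
    by (rule continuous_on_compose2) (auto intro!: continuous_intros cont)
  moreover have "G \<in> cbox a b \<rightarrow> cbox a b"
    using ab by (auto simp: G_def)
  ultimately obtain x where x: "x \<in> cbox a b" "G x = x"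
    by (rule brouwer[OF compact_cbox convex_box(1) ne])
  have "F x \<bullet> i = 0 \<bullet> i" if i: "i \<in> Basis" for i
  proof -
    have "G x \<bullet> i = (if (x - F x) \<bullet> i < a \<bullet> i then a \<bullet> i
            else if (x - F x) \<bullet> i \<le> b \<bullet> i then (x - F x) \<bullet> i else b \<bullet> i)"
      using i ab by (simp add: G_def clamp_def)
    then have "x \<bullet> i = (if (x - F x) \<bullet> i < a \<bullet> i then a \<bullet> i
            else if (x - F x) \<bullet> i \<le> b \<bullet> i then (x - F x) \<bullet> i else b \<bullet> i)"
      using x by simp
    then show ?thesis
      using lower[OF x(1) i] upper[OF x(1) i] ab[OF i] x(1) i
      unfolding inner_diff_left inner_zero_left mem_box by (smt (verit))
  qed
  then have "F x = 0"
    by (rule euclidean_eqI)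
  then show ?thesis using x by blast
qed

section \<open>Flows of Lipschitz vector fields\<close>

text \<open>The weight \<open>exp (- K * (t - a))\<close> absorbs the linear growth and is at most 1
  on the forcing. The forcing enters only through its antiderivative \<Psi>, so a forcing that is
  large on a short initial layer costs no more than its integral.\<close>

lemma gronwall_forced:
  fixes v d :: "real \<Rightarrow> 'a::real_inner"
  assumes ab: "a \<le> b" and K: "K \<ge> 0"
    and dv: "\<And>t. a \<le> t \<Longrightarrow> t \<le> b \<Longrightarrow> (v has_vector_derivative d t) (at t)"
    and d: "\<And>t. a \<le> t \<Longrightarrow> t \<le> b \<Longrightarrow> norm (d t) \<le> K * norm (v t) + \<psi> t"
    and \<Psi>: "\<And>t. a \<le> t \<Longrightarrow> t \<le> b \<Longrightarrow> (\<Psi> has_real_derivative \<psi> t) (at t)"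
    and \<psi>: "\<And>t. a \<le> t \<Longrightarrow> t \<le> b \<Longrightarrow> 0 \<le> \<psi> t"
  shows "norm (v b) \<le> exp (K * (b - a)) * (norm (v a) + \<Psi> b - \<Psi> a)"
proof (rule field_le_epsilon)
  fix e :: real assume e: "e > 0"
  \<comment> \<open>The norm is not differentiable at 0; \<open>n\<close> below is a smooth majorant
    that exceeds it by at most \<eta>. The size of \<eta> is such that the final exponential factor
    turns it into \<open>e\<close>.\<close>
  define \<eta> where "\<eta> = e / exp (K * (b - a))"
  have \<eta>: "\<eta> > 0" using e by (simp add: \<eta>_def)
  define n where "n = (\<lambda>t. sqrt (v t \<bullet> v t + \<eta>\<^sup>2))"
  have pos: "v t \<bullet> v t + \<eta>\<^sup>2 > 0" for t
    using \<eta> by (simp add: add_nonneg_pos)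
  then have npos: "n t > 0" for t by (simp add: n_def)
  have nge: "norm (v t) \<le> n t" for t
    by (simp add: n_def norm_eq_sqrt_inner)
  have nle: "n t \<le> norm (v t) + \<eta>" for t
    unfolding n_def
    by (rule real_le_lsqrt) (use \<eta> in \<open>auto simp: power2_sum dot_square_norm intro!: mult_nonneg_nonneg\<close>)
  have dn: "(n has_real_derivative (v t \<bullet> d t) / n t) (at t)" if t: "a \<le> t" "t \<le> b" for t
  proof -
    have "((\<lambda>t. v t \<bullet> v t) has_real_derivative 2 * (v t \<bullet> d t)) (at t)"
      using bounded_bilinear.has_vector_derivative[OF bounded_bilinear_inner dv[OF t] dv[OF t]]
      by (simp add: has_real_derivative_iff_has_vector_derivative inner_commute)
    then show ?thesis
      unfolding n_def using pos[of t]
      by (auto intro!: derivative_eq_intros simp: divide_simps)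
  qed
  define h where "h = (\<lambda>t. n t * exp (- K * (t - a)) - \<Psi> t)"
  have "h b \<le> h a"
  proof (rule DERIV_nonpos_imp_nonincreasing[OF ab])
    fix t assume t: "a \<le> t" "t \<le> b"
    let ?D = "((v t \<bullet> d t) / n t - K * n t) * exp (- K * (t - a)) - \<psi> t"
    have "(h has_real_derivative ?D) (at t)"
      unfolding h_def
      by (rule derivative_eq_intros dn[OF t] \<Psi>[OF t] refl)+ (simp add: algebra_simps)
    moreover have "?D \<le> 0"
    proof -
      have "v t \<bullet> d t \<le> n t * norm (d t)"
        by (meson norm_cauchy_schwarz order_trans mult_right_mono nge norm_ge_zero)
      then have "(v t \<bullet> d t) / n t \<le> norm (d t)"
        using npos[of t] by (simp add: divide_le_eq mult.commute)
      also have "\<dots> \<le> K * n t + \<psi> t"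
        using d[OF t] mult_left_mono[OF nge[of t] K] by linarith
      finally have "(v t \<bullet> d t) / n t - K * n t \<le> \<psi> t" by simp
      moreover have "exp (- K * (t - a)) \<le> 1"
        using K t by simp
      ultimately have "((v t \<bullet> d t) / n t - K * n t) * exp (- K * (t - a)) \<le> \<psi> t * 1"
        by (meson \<psi>[OF t] exp_ge_zero mult_mono mult_right_mono order_trans mult_left_mono)
      then show ?thesis by simp
    qed
    ultimately show "\<exists>y. (h has_real_derivative y) (at t) \<and> y \<le> 0" by blast
  qed
  then have 1: "n b * exp (- K * (b - a)) \<le> norm (v a) + \<eta> + \<Psi> b - \<Psi> a"
    using nle[of a] by (simp add: h_def)
  have "n b = exp (K * (b - a)) * (n b * exp (- K * (b - a)))"
    by (simp add: exp_minus mult.commute[of "n b"] flip: mult.assoc exp_add)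
  also have "\<dots> \<le> exp (K * (b - a)) * (norm (v a) + \<eta> + \<Psi> b - \<Psi> a)"
    using 1 by (intro mult_left_mono) auto
  also have "\<dots> = exp (K * (b - a)) * (norm (v a) + \<Psi> b - \<Psi> a) + e"
    by (simp add: \<eta>_def field_simps)
  finally show "norm (v b) \<le> exp (K * (b - a)) * (norm (v a) + \<Psi> b - \<Psi> a) + e"
    using nge[of b] by simp
qed

lemma gronwall:
  fixes v d :: "real \<Rightarrow> 'a::real_inner"
  assumes ab: "a \<le> b" and K: "K \<ge> 0"
    and dv: "\<And>t. a \<le> t \<Longrightarrow> t \<le> b \<Longrightarrow> (v has_vector_derivative d t) (at t)"
    and d: "\<And>t. a \<le> t \<Longrightarrow> t \<le> b \<Longrightarrow> norm (d t) \<le> K * norm (v t)"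
  shows "norm (v b) \<le> exp (K * (b - a)) * norm (v a)"
  using gronwall_forced[OF ab K dv, of "\<lambda>_. 0" "\<lambda>_. 0"] d by simp

text \<open>One of the two integrals runs over an empty or degenerate interval, so this is the
  oriented integral from 0 to \<open>t\<close> on the whole line.\<close>

definition antideriv :: "(real \<Rightarrow> 'a::euclidean_space) \<Rightarrow> real \<Rightarrow> 'a" where
  "antideriv h t = integral {0..t} h - integral {t..0} h"

lemma antideriv_0 [simp]: "antideriv h 0 = 0"
  by (simp add: antideriv_def)

lemma antideriv_deriv:
  fixes h :: "real \<Rightarrow> 'a::euclidean_space"
  assumes h: "continuous_on UNIV h"
  shows "(antideriv h has_vector_derivative h t) (at t)"
proof -
  \<comment> \<open>The interval from \<open>- N\<close> to \<open>N\<close> contains both 0 and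
    \<open>t\<close> in its interior, so one integral with fixed lower end represents
    \<open>antideriv h\<close> near \<open>t\<close> for either sign of \<open>t\<close>.\<close>
  define N where "N = \<bar>t\<bar> + 1"
  have N: "-N < t" "t < N" "N > 0" by (auto simp: N_def)
  have int: "h integrable_on {a..b}" for a b
    by (rule integrable_continuous_interval) (rule continuous_on_subset[OF h], simp)
  have eq: "antideriv h s = integral {-N..s} h - integral {-N..0} h" if s: "s \<in> {-N<..<N}" for s
  proof (cases "s \<ge> 0")
    case True
    have "integral {-N..0} h + integral {0..s} h = integral {-N..s} h"
      by (rule Henstock_Kurzweil_Integration.integral_combine) (use True s N int in auto)
    moreover have "antideriv h s = integral {0..s} h - 0"
      using True by (cases "s = 0") (simp_all add: antideriv_def)
    ultimately show ?thesis by (simp add: eq_diff_eq add.commute)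
  next
    case False
    have "integral {-N..s} h + integral {s..0} h = integral {-N..0} h"
      by (rule Henstock_Kurzweil_Integration.integral_combine) (use False s N int in auto)
    moreover have "antideriv h s = 0 - integral {s..0} h"
      using False by (simp add: antideriv_def)
    ultimately show ?thesis by (simp add: algebra_simps)
  qed
  have "((\<lambda>u. integral {-N..u} h) has_vector_derivative h t) (at t within {-N..N})"
    by (rule integral_has_vector_derivative) (use N in \<open>auto intro: continuous_on_subset[OF h]\<close>)
  then have "((\<lambda>u. integral {-N..u} h) has_vector_derivative h t) (at t within {-N<..<N})"
    by (rule has_vector_derivative_within_subset) auto
  then have "((\<lambda>u. integral {-N..u} h) has_vector_derivative h t) (at t)"
    using N has_vector_derivative_within_open[of t "{-N<..<N}"] by auto
  from has_vector_derivative_diff[OF this has_vector_derivative_const]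
  have 1: "((\<lambda>u. integral {-N..u} h - integral {-N..0} h) has_vector_derivative h t) (at t)"
    by simp
  show ?thesis
  proof (rule has_vector_derivative_transform_within_open[OF 1])
    show "t \<in> {-N<..<N}" using N by simp
  qed (auto simp only: eq open_greaterThanLessThan)
qed

text \<open>This is \<open>gronwall_forced\<close> with growth rate 0 and forcing
  \<open>C * exp (K * s)\<close>; negative times are reflected. The division by \<open>K\<close>
  gained here is the source of the contraction in the Picard iteration.\<close>

lemma norm_antideriv_le:
  fixes h :: "real \<Rightarrow> 'a::euclidean_space"
  assumes h: "continuous_on UNIV h" and K: "K > 0" and C: "C \<ge> 0"
    and bd: "\<And>s. norm (h s) \<le> C * exp (K * \<bar>s\<bar>)"
  shows "norm (antideriv h t) \<le> C / K * exp (K * \<bar>t\<bar>)"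
proof -
  define \<psi> where "\<psi> = (\<lambda>s. C * exp (K * s))"
  define \<Psi> where "\<Psi> = (\<lambda>s. C / K * exp (K * s))"
  have \<Psi>: "(\<Psi> has_real_derivative \<psi> s) (at s)" for s
    unfolding \<Psi>_def \<psi>_def using K by (auto intro!: derivative_eq_intros)
  have *: "norm (v \<bar>t\<bar>) \<le> C / K * exp (K * \<bar>t\<bar>)"
    if dv: "\<And>s. (v has_vector_derivative d s) (at s)" and v0: "v 0 = 0"
      and d: "\<And>s. norm (d s) \<le> C * exp (K * \<bar>s\<bar>)" for v d :: "real \<Rightarrow> 'a"
  proof -
    have "norm (v \<bar>t\<bar>) \<le> exp (0 * (\<bar>t\<bar> - 0)) * (norm (v 0) + \<Psi> \<bar>t\<bar> - \<Psi> 0)"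
    proof (rule gronwall_forced[where \<psi> = \<psi> and d = d])
      show "norm (d s) \<le> 0 * norm (v s) + \<psi> s" if "0 \<le> s" "s \<le> \<bar>t\<bar>" for s
        using d[of s] that by (simp add: \<psi>_def)
    qed (use dv \<Psi> C in \<open>auto simp: \<psi>_def\<close>)
    also have "\<dots> \<le> C / K * exp (K * \<bar>t\<bar>)"
      using v0 C K by (simp add: \<Psi>_def)
    finally show ?thesis .
  qed
  show ?thesis
  proof (cases "t \<ge> 0")
    case True
    then show ?thesis using *[of "antideriv h" h] antideriv_deriv[OF h] bd by simp
  next
    case False
    have "((\<lambda>s. antideriv h (- s)) has_vector_derivative - h (- s)) (at s)" for s
    proof -
      have "((antideriv h \<circ> uminus) has_vector_derivative (- 1) *\<^sub>R h (- s)) (at s)"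
        by (rule vector_diff_chain_at)
          (auto intro!: derivative_eq_intros antideriv_deriv[OF h])
      then show ?thesis by (simp add: o_def)
    qed
    then show ?thesis
      using *[of "\<lambda>s. antideriv h (- s)" "\<lambda>s. - h (- s)"] bd[of "- _"] False by simp
  qed
qed

text \<open>Picard iteration in the norm weighted by \<open>exp (- K \<bar>t\<bar>)\<close> is a contraction on the whole
  line, so no patching of local solutions is needed.\<close>

lemma lipschitz_ode_exists:
  fixes F :: "'a::euclidean_space \<Rightarrow> 'a"
  assumes lip: "L-lipschitz_on UNIV F"
  shows "\<exists>w. w 0 = x0 \<and> (\<forall>t. (w has_vector_derivative F (w t)) (at t))"
proof -
  have L: "L \<ge> 0" using lip by (rule lipschitz_on_nonneg)
  \<comment> \<open>Chosen to make the contraction constant \<open>L / K\<close> at most 1/2; the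
    summand 1 keeps \<open>K\<close> positive if \<open>L = 0\<close>.\<close>
  define K where "K = 2 * (L + 1)"
  have K: "K > 0" "L / K \<le> 1/2" using L by (auto simp: K_def divide_simps)
  have Fc: "continuous_on UNIV F"
    by (rule lipschitz_on_continuous_on[OF lip])
  \<comment> \<open>The weight is moved into the unknown: \<open>v\<close> is the deviation from
    \<open>x0\<close> divided by \<open>exp (K * \<bar>s\<bar>)\<close>, so the fixed point can be
    sought in the supremum norm of bounded continuous functions.\<close>
  define h where "h = (\<lambda>(v :: real \<Rightarrow>\<^sub>C 'a) s. F (x0 + exp (K * \<bar>s\<bar>) *\<^sub>R v s))"
  have hc: "continuous_on UNIV (h v)" for v
    unfolding h_def by (rule continuous_on_compose2[OF Fc]) (auto intro!: continuous_intros)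
  define \<Phi> where "\<Phi> = (\<lambda>v t. exp (- K * \<bar>t\<bar>) *\<^sub>R antideriv (h v) t)"
  have one: "1 \<le> exp (K * \<bar>s\<bar>)" for s using K by simp
  have scaled: "norm (exp (- K * \<bar>t\<bar>) *\<^sub>R antideriv k t) \<le> C / K"
    if "continuous_on UNIV k" "C \<ge> 0" "\<And>s. norm (k s) \<le> C * exp (K * \<bar>s\<bar>)"
    for k :: "real \<Rightarrow> 'a" and C t
  proof -
    have "exp (- K * \<bar>t\<bar>) * norm (antideriv k t) \<le> exp (- K * \<bar>t\<bar>) * (C / K * exp (K * \<bar>t\<bar>))"
      using norm_antideriv_le[OF that(1) K(1) that(2,3)] by (intro mult_left_mono) auto
    also have "\<dots> = C / K" by (simp add: exp_minus field_simps)
    finally show ?thesis by simp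
  qed
  have cont_anti: "continuous_on UNIV (antideriv k)"
    if "continuous_on UNIV k" for k :: "real \<Rightarrow> 'a"
    using antideriv_deriv[OF that]
    by (meson continuous_at_imp_continuous_on has_vector_derivative_continuous)
  have "\<Phi> v \<in> bcontfun" for v
  proof (rule bcontfun_normI)
    show "continuous_on UNIV (\<Phi> v)"
      unfolding \<Phi>_def by (intro continuous_intros cont_anti hc)
    have "norm (h v s) \<le> (norm (F x0) + L * norm v) * exp (K * \<bar>s\<bar>)" for s
    proof -
      have "norm (h v s) \<le> norm (F x0) + norm (h v s - F x0)"
        by (rule norm_triangle_sub)
      also have "norm (h v s - F x0) \<le> L * norm (exp (K * \<bar>s\<bar>) *\<^sub>R v s)"
        using lipschitz_onD[OF lip, of "x0 + exp (K * \<bar>s\<bar>) *\<^sub>R v s" x0]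
        by (simp add: h_def dist_norm)
      also have "\<dots> \<le> L * (exp (K * \<bar>s\<bar>) * norm v)"
        using L norm_bounded[of v s] by (intro mult_left_mono) auto
      also have "norm (F x0) \<le> norm (F x0) * exp (K * \<bar>s\<bar>)"
        using mult_left_mono[OF one, of "norm (F x0)"] by simp
      finally show ?thesis by (simp add: algebra_simps)
    qed
    then show "norm (\<Phi> v t) \<le> (norm (F x0) + L * norm v) / K" for t
      unfolding \<Phi>_def using L by (intro scaled hc) auto
  qed
  then have ap: "apply_bcontfun (Bcontfun (\<Phi> v)) = \<Phi> v" for v
    by (simp add: Bcontfun_inverse)
  have "\<exists>!v. Bcontfun (\<Phi> v) = v"
  proof (rule banach_fix_type[where c = "1/2"])
    show "\<forall>u v. dist (Bcontfun (\<Phi> u)) (Bcontfun (\<Phi> v)) \<le> 1/2 * dist u v"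
    proof (intro allI dist_bound)
      fix u v t
      let ?k = "\<lambda>s. h u s - h v s"
      have kc: "continuous_on UNIV ?k" by (intro continuous_intros hc)
      have "antideriv ?k t = antideriv (h u) t - antideriv (h v) t"
        unfolding antideriv_def
        by (simp add: Henstock_Kurzweil_Integration.integral_diff
            integrable_continuous_interval continuous_on_subset[OF hc])
      then have "\<Phi> u t - \<Phi> v t = exp (- K * \<bar>t\<bar>) *\<^sub>R antideriv ?k t"
        by (simp add: \<Phi>_def scaleR_diff_right)
      moreover have "norm (?k s) \<le> (L * dist u v) * exp (K * \<bar>s\<bar>)" for s
      proof -
        have "norm (?k s) \<le> L * norm (exp (K * \<bar>s\<bar>) *\<^sub>R (u s - v s))"
          using lipschitz_onD[OF lip, of "x0 + exp (K * \<bar>s\<bar>) *\<^sub>R u s" "x0 + exp (K * \<bar>s\<bar>) *\<^sub>R v s"]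
          by (simp add: h_def dist_norm scaleR_diff_right)
        also have "\<dots> = L * exp (K * \<bar>s\<bar>) * dist (u s) (v s)"
          by (simp add: dist_norm)
        also have "\<dots> \<le> L * exp (K * \<bar>s\<bar>) * dist u v"
          using L dist_bounded[of u s v] by (intro mult_left_mono) auto
        finally show ?thesis by (simp add: mult_ac)
      qed
      ultimately have "norm (\<Phi> u t - \<Phi> v t) \<le> (L * dist u v) / K"
        using scaled[OF kc, of "L * dist u v" t] L by simp
      also have "\<dots> \<le> 1/2 * dist u v"
        using mult_right_mono[OF K(2), of "dist u v"] by simp
      finally show "dist (Bcontfun (\<Phi> u) t) (Bcontfun (\<Phi> v) t) \<le> 1/2 * dist u v"
        by (simp add: ap dist_norm)
    qed
  qed auto
  then obtain v where v: "Bcontfun (\<Phi> v) = v" by blast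
  define w where "w = (\<lambda>t. x0 + antideriv (h v) t)"
  have "w t = x0 + exp (K * \<bar>t\<bar>) *\<^sub>R v t" for t
  proof -
    have "v t = \<Phi> v t" using ap[of v] v by simp
    then show ?thesis by (simp add: \<Phi>_def w_def flip: exp_add)
  qed
  then have "h v t = F (w t)" for t by (simp add: h_def)
  then have "(w has_vector_derivative F (w t)) (at t)" for t
    unfolding w_def using antideriv_deriv[OF hc, of v t]
    by (auto intro!: derivative_eq_intros)
  moreover have "w 0 = x0" by (simp add: w_def)
  ultimately show ?thesis by blast
qed

text \<open>A choice of a solution. It is used for globally Lipschitz fields only, where a solution
  exists for all times and is unique.\<close>

definition flow :: "('a::euclidean_space \<Rightarrow> 'a) \<Rightarrow> 'a \<Rightarrow> real \<Rightarrow> 'a" where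
  "flow F x = (SOME w. w 0 = x \<and> (\<forall>t. (w has_vector_derivative F (w t)) (at t)))"

lemma
  assumes "L-lipschitz_on UNIV F"
  shows flow_0: "flow F x 0 = x"
    and flow_deriv: "(flow F x has_vector_derivative F (flow F x t)) (at t)"
  using someI_ex[OF lipschitz_ode_exists[OF assms, of x]] by (auto simp: flow_def)

section \<open>Uniqueness and continuous dependence on the initial value\<close>

lemma has_vector_derivative_reflect:
  fixes u :: "real \<Rightarrow> 'a::real_normed_vector"
  assumes "(u has_vector_derivative d) (at (c - t))"
  shows "((\<lambda>t. u (c - t)) has_vector_derivative - d) (at t)"
proof -
  have "((u \<circ> (\<lambda>t. c - t)) has_vector_derivative (- 1) *\<^sub>R d) (at t)"
    by (rule vector_diff_chain_at) (use assms in \<open>auto intro!: derivative_eq_intros\<close>)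
  then show ?thesis by (simp add: o_def)
qed

lemma has_vector_derivative_shift:
  fixes u :: "real \<Rightarrow> 'a::real_normed_vector"
  assumes "(u has_vector_derivative d) (at (t + c))"
  shows "((\<lambda>t. u (t + c)) has_vector_derivative d) (at t)"
proof -
  have "((u \<circ> (\<lambda>t. t + c)) has_vector_derivative 1 *\<^sub>R d) (at t)"
    by (rule vector_diff_chain_at) (use assms in \<open>auto intro!: derivative_eq_intros\<close>)
  then show ?thesis by (simp add: o_def)
qed

text \<open>Gronwall's inequality for the difference of two solutions; the backward estimate is the
  forward one for the time-reversed curves.\<close>

lemma ode_dist_le:
  fixes F :: "'a::euclidean_space \<Rightarrow> 'a"
  assumes lip: "L-lipschitz_on UNIV F" and ab: "a \<le> b"
    and u: "\<And>t. a \<le> t \<Longrightarrow> t \<le> b \<Longrightarrow> (u has_vector_derivative F (u t)) (at t)"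
    and v: "\<And>t. a \<le> t \<Longrightarrow> t \<le> b \<Longrightarrow> (v has_vector_derivative F (v t)) (at t)"
  shows "norm (u b - v b) \<le> exp (L * (b - a)) * norm (u a - v a)"
    and "norm (u a - v a) \<le> exp (L * (b - a)) * norm (u b - v b)"
proof -
  have L: "L \<ge> 0" using lip by (rule lipschitz_on_nonneg)
  have lip': "norm (F x - F y) \<le> L * norm (x - y)" for x y
    using lipschitz_onD[OF lip, of x y] by (simp add: dist_norm)
  show "norm (u b - v b) \<le> exp (L * (b - a)) * norm (u a - v a)"
    by (rule gronwall[OF ab L, where v = "\<lambda>t. u t - v t"])
      (auto intro!: derivative_eq_intros u v lip')
  have "norm (u (b - (b - a)) - v (b - (b - a)))
        \<le> exp (L * ((b - a) - 0)) * norm (u (b - 0) - v (b - 0))"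
  proof (rule gronwall[OF _ L, where d = "\<lambda>t. - F (u (b - t)) - - F (v (b - t))"])
    fix t assume t: "0 \<le> t" "t \<le> b - a"
    show "((\<lambda>t. u (b - t) - v (b - t)) has_vector_derivative
        - F (u (b - t)) - - F (v (b - t))) (at t)"
      by (intro has_vector_derivative_diff has_vector_derivative_reflect u v) (use t in auto)
    show "norm (- F (u (b - t)) - - F (v (b - t))) \<le> L * norm (u (b - t) - v (b - t))"
      using lip'[of "u (b - t)" "v (b - t)"] by (simp add: norm_minus_commute)
  qed (use ab in auto)
  then show "norm (u a - v a) \<le> exp (L * (b - a)) * norm (u b - v b)" by simp
qed

lemma ode_unique:
  fixes F :: "'a::euclidean_space \<Rightarrow> 'a"
  assumes lip: "L-lipschitz_on UNIV F" and ab: "a \<le> b"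
    and u: "\<And>t. a \<le> t \<Longrightarrow> t \<le> b \<Longrightarrow> (u has_vector_derivative F (u t)) (at t)"
    and v: "\<And>t. a \<le> t \<Longrightarrow> t \<le> b \<Longrightarrow> (v has_vector_derivative F (v t)) (at t)"
  shows "u a = v a \<longleftrightarrow> u b = v b"
proof
  assume "u a = v a"
  then show "u b = v b" using ode_dist_le(1)[OF assms] by simp
next
  assume "u b = v b"
  then show "u a = v a" using ode_dist_le(2)[OF assms] by simp
qed

lemma ode_unique_global:
  fixes F :: "'a::euclidean_space \<Rightarrow> 'a"
  assumes lip: "L-lipschitz_on UNIV F"
    and u: "\<And>t. (u has_vector_derivative F (u t)) (at t)"
    and v: "\<And>t. (v has_vector_derivative F (v t)) (at t)"
    and eq: "u c = v c"
  shows "u t = v t"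
proof (cases "c \<le> t")
  case True
  then show ?thesis using ode_unique[OF lip True u v] eq by simp
next
  case False
  then have "t \<le> c" by simp
  from ode_unique[OF lip this u v] show ?thesis using eq by simp
qed

lemma flow_dist_le:
  assumes lip: "L-lipschitz_on UNIV F"
  shows "norm (flow F x t - flow F y t) \<le> exp (L * \<bar>t\<bar>) * norm (x - y)"
proof (cases "t \<ge> 0")
  case True
  then show ?thesis
    using ode_dist_le(1)[OF lip True flow_deriv[OF lip] flow_deriv[OF lip], of x y]
    by (simp add: flow_0[OF lip])
next
  case False
  then have "t \<le> 0" by simp
  from ode_dist_le(2)[OF lip this flow_deriv[OF lip] flow_deriv[OF lip], of x y]
  show ?thesis using False by (simp add: flow_0[OF lip])
qed

text \<open>Lipschitz dependence on the initial point handles the change of orbit at the moving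
  time, and continuity in time along the one orbit through \<open>x a\<close> handles the
  rest.\<close>

lemma continuous_on_flow:
  assumes lip: "L-lipschitz_on UNIV F"
    and x: "continuous_on S x" and t: "continuous_on S t"
  shows "continuous_on S (\<lambda>a. flow F (x a) (t a))"
  unfolding continuous_on_def
proof (intro ballI)
  fix a assume a: "a \<in> S"
  have L: "L \<ge> 0" using lip by (rule lipschitz_on_nonneg)
  have tx: "(x \<longlongrightarrow> x a) (at a within S)" and tt: "(t \<longlongrightarrow> t a) (at a within S)"
    using x t a by (auto simp: continuous_on_def)
  have "((\<lambda>b. exp (L * \<bar>t b\<bar>) * norm (x b - x a)) \<longlongrightarrow> exp (L * \<bar>t a\<bar>) * norm (x a - x a))
      (at a within S)"
    by (intro tendsto_intros tx tt)
  then have 0: "((\<lambda>b. exp (L * \<bar>t b\<bar>) * norm (x b - x a)) \<longlongrightarrow> 0) (at a within S)"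
    by simp
  have 1: "((\<lambda>b. flow F (x b) (t b) - flow F (x a) (t b)) \<longlongrightarrow> 0) (at a within S)"
    by (rule Lim_null_comparison[OF _ 0]) (simp add: flow_dist_le[OF lip])
  have "isCont (flow F (x a)) (t a)"
    using flow_deriv[OF lip] by (rule has_vector_derivative_continuous)
  then have "((\<lambda>b. flow F (x a) (t b)) \<longlongrightarrow> flow F (x a) (t a)) (at a within S)"
    using tt by (rule isCont_tendsto_compose)
  from tendsto_add[OF 1 this]
  show "((\<lambda>b. flow F (x b) (t b)) \<longlongrightarrow> flow F (x a) (t a)) (at a within S)" by simp
qed

section \<open>Scalar relaxation near the fold line\<close>

lemma DERIV_continuous_on_subinterval:
  fixes f :: "real \<Rightarrow> real"
  assumes d: "\<And>t. a \<le> t \<Longrightarrow> t \<le> b \<Longrightarrow> (f has_real_derivative f' t) (at t)"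
    and "a \<le> c" "d \<le> b"
  shows "continuous_on {c..d} f"
proof (rule continuous_at_imp_continuous_on, rule ballI)
  fix t assume "t \<in> {c..d}"
  then show "isCont f t" using assms(2,3) by (intro DERIV_isCont[OF d]) auto
qed

text \<open>The earliest time is attained by compactness. Strict positivity before it makes
  differential inequalities available on the whole stretch up to \<open>s\<close>.\<close>

lemma first_nonpos:
  fixes m :: "real \<Rightarrow> real"
  assumes cont: "continuous_on {a..b} m" and pos: "m a > 0" and t: "a \<le> t" "t \<le> b" "m t \<le> 0"
  obtains s where "a < s" "s \<le> t" "m s \<le> 0" "\<And>r. a \<le> r \<Longrightarrow> r < s \<Longrightarrow> m r > 0"
proof -
  have "closed ({a..t} \<inter> m -` {..0})"
    by (rule continuous_closed_preimage)
      (use t in \<open>auto intro: continuous_on_subset[OF cont]\<close>)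
  then have "compact ({a..t} \<inter> ({a..t} \<inter> m -` {..0}))"
    by (intro compact_Int_closed) auto
  moreover have "{a..t} \<inter> ({a..t} \<inter> m -` {..0}) \<noteq> {}"
    using t by auto
  ultimately obtain s where "s \<in> {a..t} \<inter> ({a..t} \<inter> m -` {..0})"
    and min: "\<forall>r\<in>{a..t} \<inter> ({a..t} \<inter> m -` {..0}). s \<le> r"
    using compact_attains_inf by metis
  then have s: "a \<le> s" "s \<le> t" "m s \<le> 0" by auto
  moreover have "a \<noteq> s" using s pos by auto
  ultimately show thesis
    using min by (intro that[of s]) (auto simp: not_le[symmetric])
qed

text \<open>The integrating factor for scalar linear equations; \<open>k = 1 / \<epsilon>\<close>
  removes the damping term of the fast equation.\<close>

lemma DERIV_exp_weight:
  fixes z :: "real \<Rightarrow> real"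
  assumes "(z has_real_derivative d) (at t)"
  shows "((\<lambda>r. exp (k * r) * z r) has_real_derivative exp (k * t) * (d + k * z t)) (at t)"
  by (rule derivative_eq_intros assms refl)+ (simp add: algebra_simps)

text \<open>For constant \<phi> equal to \<open>c\<close> the equation has the equilibrium
  \<open>- \<epsilon> * c\<close>. The deviation from it, multiplied by the integrating factor, is
  nondecreasing when \<phi> stays below \<open>c\<close>. The bound later yields both the size and
  the sign of the lag between \<open>z\<close> and \<open>x\<close>.\<close>

lemma relaxation_bound:
  fixes \<zeta> \<phi> :: "real \<Rightarrow> real"
  assumes ab: "a \<le> b" and \<epsilon>: "\<epsilon> > 0"
    and d\<zeta>: "\<And>t. a \<le> t \<Longrightarrow> t \<le> b \<Longrightarrow> (\<zeta> has_real_derivative (- \<zeta> t / \<epsilon> - \<phi> t)) (at t)"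
    and \<phi>: "\<And>t. a \<le> t \<Longrightarrow> t \<le> b \<Longrightarrow> \<phi> t \<le> c"
  shows "\<zeta> b + \<epsilon> * c \<ge> exp (- (b - a) / \<epsilon>) * (\<zeta> a + \<epsilon> * c)"
proof -
  define h where "h = (\<lambda>t. exp (1 / \<epsilon> * t) * (\<zeta> t + \<epsilon> * c))"
  have "h a \<le> h b"
  proof (rule DERIV_nonneg_imp_nondecreasing[OF ab])
    fix t assume t: "a \<le> t" "t \<le> b"
    have "((\<lambda>t. \<zeta> t + \<epsilon> * c) has_real_derivative (- \<zeta> t / \<epsilon> - \<phi> t)) (at t)"
      using DERIV_add[OF d\<zeta>[OF t] DERIV_const] by simp
    from DERIV_exp_weight[OF this, of "1 / \<epsilon>"]
    have "(h has_real_derivative exp (1 / \<epsilon> * t) * (c - \<phi> t)) (at t)"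
      unfolding h_def using \<epsilon> by (simp add: add_divide_distrib)
    moreover have "exp (1 / \<epsilon> * t) * (c - \<phi> t) \<ge> 0"
      using \<phi>[OF t] by simp
    ultimately show "\<exists>y. (h has_real_derivative y) (at t) \<and> y \<ge> 0" by blast
  qed
  then have "exp (- (b / \<epsilon>)) * (exp (a / \<epsilon>) * (\<zeta> a + \<epsilon> * c))
      \<le> exp (- (b / \<epsilon>)) * (exp (b / \<epsilon>) * (\<zeta> b + \<epsilon> * c))"
    by (intro mult_left_mono) (simp_all add: h_def)
  moreover have "exp (- (b / \<epsilon>)) * exp (a / \<epsilon>) = exp (- (b - a) / \<epsilon>)"
    by (simp add: diff_divide_distrib flip: exp_add)
  moreover have "exp (- (b / \<epsilon>)) * exp (b / \<epsilon>) = 1"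
    by (simp flip: exp_add)
  ultimately show ?thesis by (simp flip: mult.assoc)
qed

text \<open>The function \<open>x - 2 L \<epsilon> z\<close> cannot decay faster than exponentially while \<open>x\<close> and \<open>z\<close> are
  nonnegative.\<close>

lemma relaxation_positive:
  fixes x z x' :: "real \<Rightarrow> real"
  assumes \<epsilon>: "\<epsilon> > 0" and L: "L \<ge> 0" "6 * L * \<epsilon> \<le> 1"
    and dx: "\<And>t. a \<le> t \<Longrightarrow> t \<le> b \<Longrightarrow> (x has_real_derivative x' t) (at t)"
    and dz: "\<And>t. a \<le> t \<Longrightarrow> t \<le> b \<Longrightarrow> (z has_real_derivative (x t - z t) / \<epsilon>) (at t)"
    and x': "\<And>t. a \<le> t \<Longrightarrow> t \<le> b \<Longrightarrow> x' t \<ge> - L * (\<bar>x t\<bar> + \<bar>z t\<bar>)"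
    and start: "x a > z a" "z a > 0" and t: "a \<le> t" "t \<le> b"
  shows "x t > 0 \<and> z t > 0"
proof (rule ccontr)
  assume neg: "\<not> (x t > 0 \<and> z t > 0)"
  define m where "m = (\<lambda>t. min (x t) (z t))"
  have "continuous_on {a..b} m"
    unfolding m_def
    by (intro continuous_intros DERIV_continuous_on_subinterval[OF dx]
        DERIV_continuous_on_subinterval[OF dz]) auto
  moreover have "m a > 0" "m t \<le> 0"
    using start neg by (auto simp: m_def)
  ultimately obtain s where s: "a < s" "s \<le> t" "m s \<le> 0"
    and pos: "\<And>r. a \<le> r \<Longrightarrow> r < s \<Longrightarrow> m r > 0"
    using first_nonpos[of a b m t] t by metis
  have x0: "continuous_on {a..s} x" and z0: "continuous_on {a..s} z"
    using s t
    by (auto intro: DERIV_continuous_on_subinterval[OF dx] DERIV_continuous_on_subinterval[OF dz])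
  have posx: "x r > 0" "z r > 0" if "a \<le> r" "r < s" for r
    using pos[OF that] by (auto simp: m_def)
  \<comment> \<open>The weighted \<open>z\<close> increases as long as \<open>x > 0\<close>, so
    \<open>z\<close> is not the component that fails at \<open>s\<close>; it remains to exclude a
    zero of \<open>x\<close>.\<close>
  define h where "h = (\<lambda>r. exp (1 / \<epsilon> * r) * z r)"
  have "h s > h a"
  proof (rule DERIV_pos_imp_increasing_open[OF s(1)])
    fix r assume r: "a < r" "r < s"
    have "(h has_real_derivative exp (1 / \<epsilon> * r) * (x r / \<epsilon>)) (at r)"
      using DERIV_exp_weight[OF dz, of r "1 / \<epsilon>"] r s t
      by (simp add: h_def diff_divide_distrib)
    moreover have "exp (1 / \<epsilon> * r) * (x r / \<epsilon>) > 0"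
      using posx[of r] r \<epsilon> by simp
    ultimately show "\<exists>y. (h has_real_derivative y) (at r) \<and> y > 0" by blast
  next
    show "continuous_on {a..s} h"
      unfolding h_def by (intro continuous_intros z0)
  qed
  moreover have "h a > 0" using start by (simp add: h_def)
  ultimately have "h s > 0" by linarith
  then have zs: "z s > 0" by (simp add: h_def zero_less_mult_iff)
  \<comment> \<open>Subtracting a multiple of \<open>z\<close> turns the harmful term
    \<open>- L * z\<close> in the bound for \<open>x'\<close> into \<open>+ L * z\<close>: the
    derivative of \<open>r\<close> plus \<open>3 * L * r\<close> is at least
    \<open>L * z * (1 - 6 * L * \<epsilon>)\<close>. This is where the hypothesis on
    \<open>6 * L * \<epsilon>\<close> comes from.\<close>
  define r where "r = (\<lambda>t. x t - 2 * L * \<epsilon> * z t)"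
  have rpos: "r a > 0"
  proof -
    have "2 * L * \<epsilon> * z a \<le> 1 * z a"
      using L start \<epsilon> by (intro mult_right_mono) auto
    then have "2 * L * \<epsilon> * z a < x a" using start(1) by linarith
    then show ?thesis by (simp add: r_def)
  qed
  have xs: "x s \<ge> 0"
  proof (rule ccontr)
    assume "\<not> x s \<ge> 0"
    then have "\<exists>q\<ge>a. q \<le> s \<and> x q = x s / 2"
      using posx(1)[of a] s(1) x0 by (intro IVT2') auto
    then obtain q where "a \<le> q" "q \<le> s" "x q = x s / 2" by blast
    then show False using posx(1)[of q] \<open>\<not> x s \<ge> 0\<close> by (cases "q = s") auto
  qed
  define k where "k = (\<lambda>u. exp (3 * L * u) * r u)"
  have "k a \<le> k s"
  proof (rule DERIV_nonneg_imp_nondecreasing[where f = k and a = a and b = s])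
    fix u assume u: "a \<le> u" "u \<le> s"
    have xz: "x u \<ge> 0" "z u \<ge> 0"
      using posx[of u] xs zs u by (cases "u = s"; simp)+
    let ?D = "exp (3 * L * u) * (x' u - 2 * L * \<epsilon> * ((x u - z u) / \<epsilon>) + 3 * L * r u)"
    have "(r has_real_derivative x' u - 2 * L * \<epsilon> * ((x u - z u) / \<epsilon>)) (at u)"
      unfolding r_def using u s t by (intro DERIV_diff DERIV_cmult dx dz) auto
    from DERIV_exp_weight[OF this]
    have "(k has_real_derivative ?D) (at u)" unfolding k_def .
    moreover have "?D \<ge> 0"
    proof -
      have "x' u \<ge> - L * (x u + z u)" using x'[of u] u s t xz by simp
      moreover have "6 * L * \<epsilon> * (L * z u) \<le> 1 * (L * z u)"
        using L xz by (intro mult_right_mono) auto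
      ultimately have "x' u - 2 * L * (x u - z u) + 3 * L * r u \<ge> 0"
        by (simp add: r_def algebra_simps)
      then show ?thesis using \<epsilon> by simp
    qed
    ultimately show "\<exists>y. (k has_real_derivative y) (at u) \<and> y \<ge> 0" by blast
  qed (use s in simp)
  moreover have "k a > 0" using rpos by (simp add: k_def)
  ultimately have "k s > 0" by linarith
  then have "r s > 0" by (simp add: k_def zero_less_mult_iff)
  moreover have "2 * L * \<epsilon> * z s \<ge> 0" using L \<epsilon> zs by simp
  ultimately have "x s > 0" by (simp add: r_def)
  then show False using zs s(3) by (simp add: m_def)
qed

text \<open>Between the last time with \<open>z \<le> 0\<close> and \<open>s\<close> the function
  \<open>z\<close> has a net increase, so the mean value theorem gives a moment at which
  \<open>x - z > 0\<close>. Such a moment is the starting condition of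
  \<open>relaxation_positive\<close>.\<close>

lemma relaxation_rise:
  fixes x z :: "real \<Rightarrow> real"
  assumes \<epsilon>: "\<epsilon> > 0" and s: "a \<le> s" "z a \<le> 0" "z s > 0"
    and dz: "\<And>t. a \<le> t \<Longrightarrow> t \<le> s \<Longrightarrow> (z has_real_derivative (x t - z t) / \<epsilon>) (at t)"
  shows "\<exists>r. a < r \<and> r < s \<and> z r > 0 \<and> x r > z r"
proof -
  have cont: "continuous_on {a..s} z"
    by (rule DERIV_continuous_on_subinterval[OF dz]) auto
  define m where "m = (\<lambda>t. z (s - t))"
  have "continuous_on {0..s-a} m"
    unfolding m_def by (rule continuous_on_compose2[OF cont]) (auto intro!: continuous_intros)
  then obtain q where q: "0 < q" "q \<le> s - a" "m q \<le> 0" "\<And>r. 0 \<le> r \<Longrightarrow> r < q \<Longrightarrow> m r > 0"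
    using first_nonpos[of 0 "s - a" m "s - a"] s by (auto simp: m_def)
  define u where "u = s - q"
  have u: "u < s" "a \<le> u" "z u \<le> 0" using q by (auto simp: u_def m_def)
  have zpos: "z r > 0" if "u < r" "r \<le> s" for r
    using q(4)[of "s - r"] that by (simp add: u_def m_def)
  obtain r where r: "u < r" "r < s" "z s - z u = (s - u) * ((x r - z r) / \<epsilon>)"
    using MVT2[of u s z "\<lambda>t. (x t - z t) / \<epsilon>"] u dz by auto
  have "0 < (s - u) * ((x r - z r) / \<epsilon>)"
    using r(3) u s by linarith
  then have "x r > z r"
    using u(1) \<epsilon> by (simp add: zero_less_mult_iff zero_less_divide_iff)
  then show ?thesis using zpos[of r] r u by (intro exI[of _ r]) auto
qed

text \<open>The last stretch of a half, ending on \<open>z = 0\<close>. The equation for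
  \<open>z\<close> is the linear continuation, which is the true one only where
  \<open>z \<le> 0\<close>; the lemmas of the locale serve to recover this sign. The bounds
  \<open>before\<close> and \<open>after\<close> express the sign of \<open>f\<close> on the fold
  line up to the Lipschitz error in \<open>x\<close> and \<open>z\<close>.\<close>

locale fold_passage =
  fixes x y z x' :: "real \<Rightarrow> real" and a b \<epsilon> L :: real
  assumes \<epsilon>: "\<epsilon> > 0" and L: "L \<ge> 0" "6 * L * \<epsilon> \<le> 1"
    and ab: "a < b"
    and dx: "\<And>t. a \<le> t \<Longrightarrow> t \<le> b \<Longrightarrow> (x has_real_derivative x' t) (at t)"
    and dz: "\<And>t. a \<le> t \<Longrightarrow> t \<le> b \<Longrightarrow> (z has_real_derivative (x t - z t) / \<epsilon>) (at t)"
    and y: "\<And>s t. a \<le> s \<Longrightarrow> s \<le> t \<Longrightarrow> t \<le> b \<Longrightarrow> y s \<le> y t"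
    and before: "\<And>t. a \<le> t \<Longrightarrow> t \<le> b \<Longrightarrow> y t \<le> 0 \<Longrightarrow> x' t \<ge> - L * (\<bar>x t\<bar> + \<bar>z t\<bar>)"
    and after: "\<And>t. a \<le> t \<Longrightarrow> t \<le> b \<Longrightarrow> y t \<ge> 0 \<Longrightarrow> x' t \<le> L * (\<bar>x t\<bar> + \<bar>z t\<bar>)"
    and za: "z a \<le> 0" and zb: "z b = 0"
begin

text \<open>A positive value of \<open>z\<close> would be preceded by a moment with
  \<open>x > z > 0\<close>. As \<open>y \<le> 0\<close> until the end,
  \<open>relaxation_positive\<close> would then keep \<open>z\<close> positive up to
  \<open>b\<close>, against \<open>zb\<close>.\<close>

lemma nonpos_if_end_before:
  assumes "y b \<le> 0" and s: "a \<le> s" "s \<le> b"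
  shows "z s \<le> 0"
proof (rule ccontr)
  assume "\<not> z s \<le> 0"
  then have "\<exists>r. a < r \<and> r < s \<and> z r > 0 \<and> x r > z r"
    using s by (intro relaxation_rise[OF \<epsilon> s(1) za _ dz]) auto
  then obtain r where r: "a < r" "r < s" "z r > 0" "x r > z r" by blast
  have "y t \<le> 0" if "r \<le> t" "t \<le> b" for t using y[of t b] assms(1) that r by simp
  then have "z b > 0"
    using relaxation_positive[OF \<epsilon> L, of r b x x' z b] dx dz before r s by simp
  then show False using zb by simp
qed

text \<open>By the previous lemma \<open>z\<close> reaches 0 from nonpositive values. If
  \<open>x b < 0\<close>, then \<open>z\<close> would be decreasing at \<open>b\<close>; if
  \<open>x b = 0\<close>, then \<open>x\<close> would be negative just before \<open>b\<close>, and
  the weighted \<open>z\<close> would decrease to 0. Both require positive values of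
  \<open>z\<close>.\<close>

lemma end_x_pos:
  assumes yb: "y b < 0" and pos: "x b = 0 \<Longrightarrow> x' b > 0"
  shows "x b > 0"
proof (rule ccontr)
  assume "\<not> x b > 0"
  then consider "x b < 0" | "x b = 0" by linarith
  then show False
  proof cases
    case 1
    then have "(x b - z b) / \<epsilon> < 0" using \<epsilon> zb by (simp add: divide_neg_pos)
    then obtain d where d: "d > 0" "\<And>h. 0 < h \<Longrightarrow> h < d \<Longrightarrow> z b < z (b - h)"
      using DERIV_neg_dec_left[OF dz[of b]] ab by auto
    define h where "h = min (d / 2) (b - a)"
    have h: "0 < h" "h < d" "a \<le> b - h" using d(1) ab by (auto simp: h_def)
    then show False using d(2)[OF h(1,2)] nonpos_if_end_before[of "b - h"] yb zb by simp
  next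
    case 2
    obtain d where d: "d > 0" "\<And>h. 0 < h \<Longrightarrow> h < d \<Longrightarrow> x (b - h) < x b"
      using DERIV_pos_inc_left[OF dx[of b]] ab pos[OF 2] by auto
    define h where "h = min (d / 2) (b - a)"
    have h: "0 < h" "h < d" "a \<le> b - h" using d(1) ab by (auto simp: h_def)
    have neg: "x t < 0" if "b - h < t" "t < b" for t
      using d(2)[of "b - t"] that h 2 by simp
    define k where "k = (\<lambda>r. exp (1 / \<epsilon> * r) * z r)"
    have "k (b - h) > k b"
    proof (rule DERIV_neg_imp_decreasing_open[where f = k and a = "b - h" and b = b])
      fix t assume t: "b - h < t" "t < b"
      have "(k has_real_derivative exp (1 / \<epsilon> * t) * (x t / \<epsilon>)) (at t)"
        using DERIV_exp_weight[OF dz, of t "1 / \<epsilon>"] t h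
        by (simp add: k_def diff_divide_distrib)
      moreover have "exp (1 / \<epsilon> * t) * (x t / \<epsilon>) < 0"
        using neg[OF t] \<epsilon> by (simp add: divide_neg_pos mult_pos_neg)
      ultimately show "\<exists>y. (k has_real_derivative y) (at t) \<and> y < 0" by blast
    next
      have "continuous_on {b - h..b} z"
        by (rule DERIV_continuous_on_subinterval[OF dz]) (use h in auto)
      then show "continuous_on {b - h..b} k"
        unfolding k_def by (intro continuous_intros)
    qed (use h in simp)
    moreover have "z (b - h) \<le> 0" using nonpos_if_end_before[of "b - h"] yb h by simp
    ultimately show False using zb by (simp add: k_def zero_less_mult_iff)
  qed
qed

lemma nonpos_if_end_x_pos:
  assumes xb: "x b > 0" and s: "a \<le> s" "s \<le> b"
  shows "z s \<le> 0"
proof (rule ccontr)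
  assume zs: "\<not> z s \<le> 0"
  then have "s < b" using zb s by (cases "s = b") auto
  have "\<exists>r. a < r \<and> r < s \<and> z r > 0 \<and> x r > z r"
    using s zs by (intro relaxation_rise[OF \<epsilon> s(1) za _ dz]) auto
  then obtain r where r: "a < r" "r < s" "z r > 0" "x r > z r" by blast
  have "(x b - z b) / \<epsilon> > 0" using xb zb \<epsilon> by simp
  then obtain d where d: "d > 0" "\<And>h. 0 < h \<Longrightarrow> h < d \<Longrightarrow> z (b - h) < z b"
    using DERIV_pos_inc_left[OF dz[of b]] ab by auto
  define u where "u = b - min (d / 2) ((b - s) / 2)"
  have u: "s < u" "u < b" "z u < 0"
    using d(2)[of "b - u"] d(1) \<open>s < b\<close> zb by (auto simp: u_def min_def field_simps)
  have "\<exists>q. s < q \<and> q < u \<and> - z q > 0 \<and> - x q > - z q"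
  proof (rule relaxation_rise[where z = "\<lambda>t. - z t" and x = "\<lambda>t. - x t" and a = s and s = u, OF \<epsilon>])
    show "((\<lambda>t. - z t) has_real_derivative (- x t - - z t) / \<epsilon>) (at t)" if "s \<le> t" "t \<le> u" for t
      using DERIV_minus[OF dz[of t]] that s u by (simp add: minus_divide_left)
  qed (use u zs in auto)
  then obtain q where q: "s < q" "q < u" "- z q > 0" "- x q > - z q" by blast
  show False
  proof (cases "y q \<ge> 0")
    case True
    have "- x b > 0 \<and> - z b > 0"
    proof (rule relaxation_positive[where z = "\<lambda>t. - z t" and x = "\<lambda>t. - x t" and a = q and b = b
            and x' = "\<lambda>t. - x' t", OF \<epsilon> L])
      fix t assume t: "q \<le> t" "t \<le> b"
      show "((\<lambda>t. - x t) has_real_derivative - x' t) (at t)"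
        using DERIV_minus[OF dx[of t]] t s q by simp
      show "((\<lambda>t. - z t) has_real_derivative (- x t - - z t) / \<epsilon>) (at t)"
        using DERIV_minus[OF dz[of t]] t s q by (simp add: minus_divide_left)
      have "y t \<ge> 0" using y[of q t] True t s q by simp
      then show "- x' t \<ge> - L * (\<bar>- x t\<bar> + \<bar>- z t\<bar>)"
        using after[of t] t s q by simp
    qed (use q u in auto)
    then show False using xb by simp
  next
    case False
    have "y t \<le> 0" if "r \<le> t" "t \<le> q" for t using y[of t q] False that r q u by simp
    then have "z q > 0"
      using relaxation_positive[OF \<epsilon> L, of r q x x' z q] dx dz before r q u by simp
    then show False using q by simp
  qed
qed

end

section \<open>Passage along one sheet\<close>

lemma norm_Pair_abs_le: "norm (a, b) \<le> \<bar>a\<bar> + \<bar>b\<bar>" for a b :: real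
  using norm_Pair_le[of a b] by simp

lemma abs_fst_le_norm: "\<bar>fst v\<bar> \<le> norm v" for v :: "real \<times> 'b::real_normed_vector"
  by (metis norm_fst_le prod.collapse real_norm_def)

lemma abs_snd_le_norm: "\<bar>snd v\<bar> \<le> norm v" for v :: "'b::real_normed_vector \<times> real"
  by (metis norm_snd_le prod.collapse real_norm_def)

lemma exp_minus_le: "exp (- x) \<le> 1 / x" if "x > 0" for x :: real
proof -
  have "x \<le> exp x" using exp_ge_add_one_self[of x] by linarith
  then show ?thesis using that by (simp add: exp_minus divide_simps)
qed

text \<open>The mean value theorem in a form that allows either order of \<open>a\<close> and
  \<open>b\<close>, since times near the fold have no fixed sign.\<close>

lemma deriv_linear_bound:
  fixes u u' :: "real \<Rightarrow> real"
  assumes du: "\<And>t. (u has_real_derivative u' t) (at t)"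
    and B: "\<And>t. min a b \<le> t \<Longrightarrow> t \<le> max a b \<Longrightarrow> \<bar>u' t - c\<bar> \<le> B"
  shows "\<bar>u b - u a - c * (b - a)\<bar> \<le> B * \<bar>b - a\<bar>"
proof -
  have *: "\<bar>u b - u a - c * (b - a)\<bar> \<le> B * \<bar>b - a\<bar>"
    if ab: "a < b" and B: "\<And>t. a \<le> t \<Longrightarrow> t \<le> b \<Longrightarrow> \<bar>u' t - c\<bar> \<le> B" for a b
  proof -
    obtain t where t: "a < t" "t < b" "u b - u a = (b - a) * u' t"
      using MVT2[OF ab, of u u'] du by auto
    then have "u b - u a - c * (b - a) = (u' t - c) * (b - a)"
      by (simp add: algebra_simps)
    then show ?thesis using B[of t] t(1,2) ab by (simp add: abs_mult mult_right_mono)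
  qed
  consider "a < b" | "a = b" | "b < a" by linarith
  then show ?thesis
  proof cases
    case 3
    then have "\<bar>u a - u b - c * (a - b)\<bar> \<le> B * \<bar>a - b\<bar>"
      using B by (intro *) auto
    moreover have "u a - u b - c * (a - b) = - (u b - u a - c * (b - a))"
      by (simp add: algebra_simps)
    ultimately show ?thesis by (simp add: abs_minus_commute)
  qed (use * B in auto)
qed

lemma has_vector_derivative_fst:
  "(w has_vector_derivative d) (at t) \<Longrightarrow> ((\<lambda>t. fst (w t)) has_vector_derivative fst d) (at t)"
  by (rule bounded_linear.has_vector_derivative[OF bounded_linear_fst])

lemma has_vector_derivative_snd:
  "(w has_vector_derivative d) (at t) \<Longrightarrow> ((\<lambda>t. snd (w t)) has_vector_derivative snd d) (at t)"
  by (rule bounded_linear.has_vector_derivative[OF bounded_linear_snd])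

lemma lipschitz_triple:
  fixes f :: "real \<times> real \<times> real \<Rightarrow> real"
  assumes "L-lipschitz_on UNIV f"
  shows "\<bar>f (x, y, z) - f (x', y', z')\<bar> \<le> L * (\<bar>x - x'\<bar> + \<bar>y - y'\<bar> + \<bar>z - z'\<bar>)"
proof -
  have "\<bar>f (x, y, z) - f (x', y', z')\<bar> \<le> L * norm ((x, y, z) - (x', y', z'))"
    using lipschitz_onD[OF assms, of "(x, y, z)" "(x', y', z')"]
    by (simp add: dist_norm real_norm_def)
  also have "norm ((x, y, z) - (x', y', z')) \<le> \<bar>x - x'\<bar> + norm (y - y', z - z')"
    using norm_Pair_le[of "x - x'" "(y - y', z - z')"] by simp
  also have "norm (y - y', z - z') \<le> \<bar>y - y'\<bar> + \<bar>z - z'\<bar>"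
    by (rule norm_Pair_abs_le)
  finally show ?thesis
    using lipschitz_on_nonneg[OF assms] by (simp add: mult_left_mono add.assoc)
qed

lemma lipschitz_triple_field:
  fixes f g h :: "'a::metric_space \<Rightarrow> real"
  assumes f: "L-lipschitz_on UNIV f" and g: "L-lipschitz_on UNIV g" and h: "K-lipschitz_on UNIV h"
  shows "(2 * L + K)-lipschitz_on UNIV (\<lambda>w. (f w, g w, h w))"
proof (rule lipschitz_onI)
  fix v w
  have "dist (f v, g v, h v) (f w, g w, h w) \<le> \<bar>f v - f w\<bar> + norm (g v - g w, h v - h w)"
    unfolding dist_norm using norm_Pair_le by (metis diff_Pair real_norm_def)
  also have "\<dots> \<le> \<bar>f v - f w\<bar> + (\<bar>g v - g w\<bar> + \<bar>h v - h w\<bar>)"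
    using norm_Pair_abs_le by (intro add_left_mono)
  also have "\<dots> \<le> (2 * L + K) * dist v w"
    using lipschitz_onD[OF f, of v w] lipschitz_onD[OF g, of v w] lipschitz_onD[OF h, of v w]
    by (simp add: dist_real_def algebra_simps)
  finally show "dist (f v, g v, h v) (f w, g w, h w) \<le> (2 * L + K) * dist v w" .
qed (use lipschitz_on_nonneg[OF f] lipschitz_on_nonneg[OF h] in simp)

text \<open>The function \<open>k\<close> is \<open>uminus\<close> for the continued fast equation
  and \<open>abs\<close> for the true one.\<close>

lemma lipschitz_fast_component:
  fixes k :: "real \<Rightarrow> real"
  assumes \<epsilon>: "\<epsilon> > 0" and k: "\<And>a b. \<bar>k a - k b\<bar> \<le> \<bar>a - b\<bar>"
  shows "(2 / \<epsilon>)-lipschitz_on UNIV (\<lambda>w :: real \<times> real \<times> real. (fst w + k (snd (snd w))) / \<epsilon>)"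
proof (rule lipschitz_onI)
  fix v w :: "real \<times> real \<times> real"
  have "\<bar>snd (snd (v - w))\<bar> \<le> norm (v - w)"
    using abs_snd_le_norm[of "snd (v - w)"] norm_snd_le[of "snd (v - w)" "fst (v - w)"]
    unfolding prod.collapse by linarith
  then have "\<bar>fst v - fst w\<bar> \<le> norm (v - w)" "\<bar>k (snd (snd v)) - k (snd (snd w))\<bar> \<le> norm (v - w)"
    using abs_fst_le_norm[of "v - w"] k[of "snd (snd v)" "snd (snd w)"] by simp_all
  then have "\<bar>(fst v - fst w) + (k (snd (snd v)) - k (snd (snd w)))\<bar> / \<epsilon> \<le> (2 * norm (v - w)) / \<epsilon>"
    using \<epsilon> by (intro divide_right_mono) linarith+
  moreover have "\<bar>(fst v + k (snd (snd v))) / \<epsilon> - (fst w + k (snd (snd w))) / \<epsilon>\<bar>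
      = \<bar>(fst v - fst w) + (k (snd (snd v)) - k (snd (snd w)))\<bar> / \<epsilon>"
    using \<epsilon> by (simp add: diff_divide_distrib[symmetric] algebra_simps)
  ultimately show "dist ((fst v + k (snd (snd v))) / \<epsilon>) ((fst w + k (snd (snd w))) / \<epsilon>)
      \<le> 2 / \<epsilon> * dist v w"
    by (simp add: dist_norm)
qed (use \<epsilon> in simp)

text \<open>The passage from \<open>z = 0\<close> along the attracting sheet \<open>z = x < 0\<close> to the neighbourhood of
  the origin. The equation for \<open>z\<close> is replaced by \<open>\<epsilon> z' = x - z\<close> on both sides of \<open>z = 0\<close>.
  An orbit is labelled by \<open>p\<close>, \<open>s\<close>: its initial point \<open>(x, y)\<close> lies at time \<open>\<tau> + s\<close> on the
  reduced orbit through \<open>(p, 0)\<close>. The repelling sheet is treated by the same locale, after the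
  reflection \<open>(t, y, z) \<mapsto> (- t, - y, - z)\<close>.\<close>

locale slow_passage =
  fixes f g :: "real \<times> real \<times> real \<Rightarrow> real" and M L Ta \<tau> :: real and xa ya :: "real \<Rightarrow> real"
  assumes bounded: "\<And>p. \<bar>f p\<bar> < M" "\<And>p. \<bar>g p\<bar> < M"
    and lipf: "L-lipschitz_on UNIV f" and lipg: "L-lipschitz_on UNIV g"
    and f0: "f (0, 0, 0) = 0" and g0: "g (0, 0, 0) > 0"
    and fy: "\<And>y. y \<noteq> 0 \<Longrightarrow> y * f (0, y, 0) < 0"
    and xa: "\<And>t. (xa has_real_derivative f (xa t, ya t, xa t)) (at t)"
    and ya: "\<And>t. (ya has_real_derivative g (xa t, ya t, xa t)) (at t)"
    and init: "xa 0 = 0" "ya 0 = 0"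
    and Ta: "Ta < \<tau>" and \<tau>: "\<tau> < 0"
    and xa_neg: "\<And>t. Ta < t \<Longrightarrow> t < 0 \<Longrightarrow> xa t < 0"
begin

lemma M_pos: "M > 0" using bounded(1)[of 0] by linarith

lemma L_nonneg: "L \<ge> 0" using lipf by (rule lipschitz_on_nonneg)

section \<open>Reduced orbits and continued orbits of one half\<close>

definition reduced_field :: "real \<times> real \<Rightarrow> real \<times> real" where
  "reduced_field v = (f (fst v, snd v, fst v), g (fst v, snd v, fst v))"

definition full_field :: "real \<Rightarrow> real \<times> real \<times> real \<Rightarrow> real \<times> real \<times> real" where
  "full_field \<epsilon> w = (f w, g w, (fst w - snd (snd w)) / \<epsilon>)"

lemma lipschitz_reduced: "(6 * L)-lipschitz_on UNIV reduced_field"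
proof (rule lipschitz_onI)
  fix v w :: "real \<times> real"
  let ?d = "norm (v - w)"
  have d: "\<bar>fst v - fst w\<bar> \<le> ?d" "\<bar>snd v - snd w\<bar> \<le> ?d"
    using abs_fst_le_norm[of "v - w"] abs_snd_le_norm[of "v - w"] by simp_all
  have s: "L * (\<bar>fst v - fst w\<bar> + \<bar>snd v - snd w\<bar> + \<bar>fst v - fst w\<bar>) \<le> L * (3 * ?d)"
    using d L_nonneg by (intro mult_left_mono) linarith+
  have "dist (reduced_field v) (reduced_field w)
      \<le> \<bar>f (fst v, snd v, fst v) - f (fst w, snd w, fst w)\<bar>
        + \<bar>g (fst v, snd v, fst v) - g (fst w, snd w, fst w)\<bar>"
    unfolding reduced_field_def dist_norm by (simp add: norm_Pair_abs_le)
  also have "\<dots> \<le> 6 * L * ?d"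
    using lipschitz_triple[OF lipf, of "fst v" "snd v" "fst v" "fst w" "snd w" "fst w"]
      lipschitz_triple[OF lipg, of "fst v" "snd v" "fst v" "fst w" "snd w" "fst w"] s by linarith
  finally show "dist (reduced_field v) (reduced_field w) \<le> 6 * L * dist v w"
    by (simp add: dist_norm)
qed (use L_nonneg in simp)

lemma lipschitz_full: "(2 * L + 2 / \<epsilon>)-lipschitz_on UNIV (full_field \<epsilon>)" if "\<epsilon> > 0"
  using lipschitz_triple_field[OF lipf lipg lipschitz_fast_component[of \<epsilon> uminus, OF that]]
  by (simp add: full_field_def[abs_def])

definition R :: "real \<Rightarrow> real \<Rightarrow> real \<times> real" where
  "R p = flow reduced_field (p, 0)"

definition W :: "real \<Rightarrow> real \<Rightarrow> real \<Rightarrow> real \<Rightarrow> real \<times> real \<times> real" where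
  "W \<epsilon> p s = flow (full_field \<epsilon>) (fst (R p (\<tau> + s)), snd (R p (\<tau> + s)), 0)"

abbreviation X where "X \<epsilon> p s \<theta> \<equiv> fst (W \<epsilon> p s \<theta>)"
abbreviation Y where "Y \<epsilon> p s \<theta> \<equiv> fst (snd (W \<epsilon> p s \<theta>))"
abbreviation Z where "Z \<epsilon> p s \<theta> \<equiv> snd (snd (W \<epsilon> p s \<theta>))"

lemma W_collapse: "(X \<epsilon> p s \<theta>, Y \<epsilon> p s \<theta>, Z \<epsilon> p s \<theta>) = W \<epsilon> p s \<theta>"
  by simp

lemma R_0: "R p 0 = (p, 0)"
  unfolding R_def by (rule flow_0[OF lipschitz_reduced])

lemma R_deriv: "(R p has_vector_derivative reduced_field (R p t)) (at t)"
  unfolding R_def by (rule flow_deriv[OF lipschitz_reduced])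

lemma R_fst_deriv:
  "((\<lambda>t. fst (R p t)) has_real_derivative f (fst (R p t), snd (R p t), fst (R p t))) (at t)"
  using has_vector_derivative_fst[OF R_deriv[of p t]]
  by (simp add: has_real_derivative_iff_has_vector_derivative reduced_field_def)

lemma R_snd_deriv:
  "((\<lambda>t. snd (R p t)) has_real_derivative g (fst (R p t), snd (R p t), fst (R p t))) (at t)"
  using has_vector_derivative_snd[OF R_deriv[of p t]]
  by (simp add: has_real_derivative_iff_has_vector_derivative reduced_field_def)

lemma W_0: "W \<epsilon> p s 0 = (fst (R p (\<tau> + s)), snd (R p (\<tau> + s)), 0)" if "\<epsilon> > 0"
  unfolding W_def by (rule flow_0[OF lipschitz_full[OF that]])

lemma W_deriv: "(W \<epsilon> p s has_vector_derivative full_field \<epsilon> (W \<epsilon> p s \<theta>)) (at \<theta>)" if "\<epsilon> > 0"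
  unfolding W_def by (rule flow_deriv[OF lipschitz_full[OF that]])

lemma X_deriv: "((\<lambda>\<theta>. X \<epsilon> p s \<theta>) has_real_derivative f (W \<epsilon> p s \<theta>)) (at \<theta>)" if "\<epsilon> > 0"
  using has_vector_derivative_fst[OF W_deriv[OF that, of p s \<theta>]]
  by (simp add: has_real_derivative_iff_has_vector_derivative full_field_def)

lemma Y_deriv: "((\<lambda>\<theta>. Y \<epsilon> p s \<theta>) has_real_derivative g (W \<epsilon> p s \<theta>)) (at \<theta>)" if "\<epsilon> > 0"
  using has_vector_derivative_fst[OF has_vector_derivative_snd[OF W_deriv[OF that, of p s \<theta>]]]
  by (simp add: has_real_derivative_iff_has_vector_derivative full_field_def)

lemma Z_deriv:
  "((\<lambda>\<theta>. Z \<epsilon> p s \<theta>) has_real_derivative (X \<epsilon> p s \<theta> - Z \<epsilon> p s \<theta>) / \<epsilon>) (at \<theta>)" if "\<epsilon> > 0"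
  using has_vector_derivative_snd[OF has_vector_derivative_snd[OF W_deriv[OF that, of p s \<theta>]]]
  by (simp add: has_real_derivative_iff_has_vector_derivative full_field_def)

lemma W_continuous:
  assumes "\<epsilon> > 0" "continuous_on S p" "continuous_on S s" "continuous_on S \<theta>"
  shows "continuous_on S (\<lambda>a. W \<epsilon> (p a) (s a) (\<theta> a))"
  unfolding W_def R_def
  by (intro continuous_on_flow[OF lipschitz_full[OF assms(1)]] continuous_intros
      continuous_on_flow[OF lipschitz_reduced] assms)

lemma R_continuous:
  assumes "continuous_on S p" "continuous_on S s"
  shows "continuous_on S (\<lambda>a. R (p a) (s a))"
  unfolding R_def by (intro continuous_on_flow[OF lipschitz_reduced] continuous_intros assms)

lemma R_zero: "R 0 t = (xa t, ya t)"
proof (rule ode_unique_global[OF lipschitz_reduced, where c = 0 and u = "R 0"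
      and v = "\<lambda>t. (xa t, ya t)"])
  show "((\<lambda>t. (xa t, ya t)) has_vector_derivative reduced_field (xa t, ya t)) (at t)" for t
    unfolding reduced_field_def
    using has_vector_derivative_Pair[OF xa[of t, unfolded has_real_derivative_iff_has_vector_derivative]
        ya[of t, unfolded has_real_derivative_iff_has_vector_derivative]] by simp
qed (auto simp: R_deriv R_0 init)

lemma R_dist: "norm (R p t - (xa t, ya t)) \<le> exp (6 * L * \<bar>t\<bar>) * \<bar>p\<bar>"
  using flow_dist_le[OF lipschitz_reduced, of "(p, 0)" t "(0, 0)"] R_zero[of t]
  by (simp add: R_def norm_Pair)

lemma R_near: "\<bar>fst (R p t) - p\<bar> \<le> M * \<bar>t\<bar>" "\<bar>snd (R p t)\<bar> \<le> M * \<bar>t\<bar>"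
proof -
  show "\<bar>fst (R p t) - p\<bar> \<le> M * \<bar>t\<bar>"
    using deriv_linear_bound[OF R_fst_deriv[of p], of 0 t 0 M] bounded(1)
    by (simp add: R_0 less_imp_le)
  show "\<bar>snd (R p t)\<bar> \<le> M * \<bar>t\<bar>"
    using deriv_linear_bound[OF R_snd_deriv[of p], of 0 t 0 M] bounded(2)
    by (simp add: R_0 less_imp_le)
qed

section \<open>Distance of a half from its sheet and from its reduced orbit\<close>

definition T0 :: real where "T0 = 3 - \<tau>"
text \<open>\<open>C0\<close> bounds the lag between \<open>z\<close> and \<open>x\<close> at the
  start, \<open>C1 * \<epsilon>\<close> the distance to the reduced orbit up to time
  \<open>T0\<close>, and \<open>C2 * \<epsilon>\<close> the lag after time
  \<open>- \<tau> / 8\<close>, when the initial layer has decayed. \<open>T0\<close> leaves room for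
  end times \<open>t - \<tau> - s\<close> with \<open>\<bar>t\<bar> \<le> 2\<close> and
  \<open>\<bar>s\<bar> \<le> 1\<close>.\<close>

definition C0 :: real where "C0 = 1 + M * (1 - \<tau>)"
definition C1 :: real where "C1 = exp (6 * L * T0) * (2 * L * (C0 + M * T0))"
definition C2 :: real where "C2 = 8 * C0 / (- \<tau>) + M"

lemma const_nonneg: "T0 > 0" "C0 > 0" "C1 \<ge> 0" "C2 > 0"
proof -
  show "T0 > 0" "C0 > 0" using M_pos \<tau> by (simp_all add: T0_def C0_def add_pos_pos)
  then show "C1 \<ge> 0" using M_pos L_nonneg by (simp add: C1_def)
  have "8 * C0 / (- \<tau>) > 0" using \<open>C0 > 0\<close> \<tau> by (intro divide_pos_pos) auto
  then show "C2 > 0" using M_pos unfolding C2_def by linarith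
qed

lemma lag_deriv:
  assumes "\<epsilon> > 0"
  shows "((\<lambda>\<theta>. Z \<epsilon> p s \<theta> - X \<epsilon> p s \<theta>) has_real_derivative
     - (Z \<epsilon> p s \<theta> - X \<epsilon> p s \<theta>) / \<epsilon> - f (W \<epsilon> p s \<theta>)) (at \<theta>)"
  using DERIV_diff[OF Z_deriv[OF assms, of p s \<theta>] X_deriv[OF assms, of p s \<theta>]]
  by (simp add: minus_divide_left)

text \<open>The lag relaxes at rate \<open>1 / \<epsilon>\<close> and is driven by
  \<open>x'\<close>, which is bounded by \<open>M\<close>; \<open>relaxation_bound\<close> is
  applied to the lag and to its negative. The initial lag is the abscissa of the start point up to
  sign, because \<open>z = 0\<close> there.\<close>

lemma lag_bound_exp:
  assumes \<epsilon>: "\<epsilon> > 0" and p: "\<bar>p\<bar> \<le> 1" and s: "\<bar>s\<bar> \<le> 1" and \<theta>: "\<theta> \<ge> 0"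
  shows "\<bar>Z \<epsilon> p s \<theta> - X \<epsilon> p s \<theta>\<bar> \<le> C0 * exp (- \<theta> / \<epsilon>) + M * \<epsilon>"
proof -
  let ?\<zeta> = "\<lambda>\<theta>. Z \<epsilon> p s \<theta> - X \<epsilon> p s \<theta>"
  have "\<bar>\<tau> + s\<bar> \<le> 1 - \<tau>" using s \<tau> by linarith
  then have "M * \<bar>\<tau> + s\<bar> \<le> M * (1 - \<tau>)" using M_pos by simp
  then have z0: "\<bar>?\<zeta> 0\<bar> \<le> C0"
    using R_near(1)[of p "\<tau> + s"] p by (simp add: W_0[OF \<epsilon>] C0_def)
  have "?\<zeta> \<theta> + \<epsilon> * M \<ge> exp (- (\<theta> - 0) / \<epsilon>) * (?\<zeta> 0 + \<epsilon> * M)"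
    by (rule relaxation_bound[OF \<theta> \<epsilon> lag_deriv[OF \<epsilon>]]) (use bounded(1) in \<open>simp add: abs_less_iff less_imp_le\<close>)
  moreover have "- ?\<zeta> \<theta> + \<epsilon> * M \<ge> exp (- (\<theta> - 0) / \<epsilon>) * (- ?\<zeta> 0 + \<epsilon> * M)"
  proof (rule relaxation_bound[OF \<theta> \<epsilon>, where \<phi> = "\<lambda>\<theta>. - f (W \<epsilon> p s \<theta>)"])
    show "((\<lambda>\<theta>. - ?\<zeta> \<theta>) has_real_derivative - (- ?\<zeta> \<theta>) / \<epsilon> - - f (W \<epsilon> p s \<theta>)) (at \<theta>)" for \<theta>
      by (rule DERIV_cong[OF DERIV_minus[OF lag_deriv[OF \<epsilon>]]]) (simp add: diff_divide_distrib)
    show "- f (W \<epsilon> p s \<theta>) \<le> M" for \<theta>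
      using bounded(1)[of "W \<epsilon> p s \<theta>"] by linarith
  qed
  moreover have "exp (- (\<theta> - 0) / \<epsilon>) * c \<ge> - (C0 * exp (- \<theta> / \<epsilon>))" if "c \<ge> - C0" for c
    using mult_left_mono[OF that, of "exp (- \<theta> / \<epsilon>)"] by (simp add: mult.commute)
  moreover have "\<epsilon> * M > 0" using \<epsilon> M_pos by simp
  then have "?\<zeta> 0 + \<epsilon> * M \<ge> - C0" "- ?\<zeta> 0 + \<epsilon> * M \<ge> - C0"
    using z0 by linarith+
  ultimately have "?\<zeta> \<theta> + \<epsilon> * M \<ge> - (C0 * exp (- \<theta> / \<epsilon>))" "- ?\<zeta> \<theta> + \<epsilon> * M \<ge> - (C0 * exp (- \<theta> / \<epsilon>))"
    by (meson order_trans)+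
  then show ?thesis by (simp add: abs_le_iff mult.commute)
qed

lemma lag_bound:
  assumes \<epsilon>: "\<epsilon> > 0" and p: "\<bar>p\<bar> \<le> 1" and s: "\<bar>s\<bar> \<le> 1" and \<theta>: "\<theta> \<ge> - \<tau> / 8"
  shows "\<bar>Z \<epsilon> p s \<theta> - X \<epsilon> p s \<theta>\<bar> \<le> C2 * \<epsilon>"
proof -
  have \<theta>0: "\<theta> > 0" using \<theta> \<tau> by simp
  have "exp (- (\<theta> / \<epsilon>)) \<le> 1 / (\<theta> / \<epsilon>)"
    using \<theta>0 \<epsilon> by (intro exp_minus_le) simp
  also have "\<dots> = \<epsilon> / \<theta>" by simp
  also have "\<dots> \<le> \<epsilon> / (- \<tau> / 8)"
    using \<theta> \<tau> \<epsilon> \<theta>0 by (intro divide_left_mono mult_pos_pos) auto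
  finally have "C0 * exp (- \<theta> / \<epsilon>) \<le> C0 * (\<epsilon> / (- \<tau> / 8))"
    using const_nonneg by (intro mult_left_mono) auto
  then show ?thesis
    using lag_bound_exp[OF \<epsilon> p s, of \<theta>] \<theta>0 by (simp add: C2_def algebra_simps)
qed

text \<open>The difference from the reduced orbit is driven by the lag. The lag is of order one at
  the start, but its integral is of order \<epsilon>, which is why the Gronwall inequality with
  integrated forcing is needed. The rate \<open>6 * L\<close> counts two components of the field
  with three arguments each.\<close>

lemma reduced_approx:
  assumes \<epsilon>: "\<epsilon> > 0" and p: "\<bar>p\<bar> \<le> 1" and s: "\<bar>s\<bar> \<le> 1" and \<theta>: "0 \<le> \<theta>" "\<theta> \<le> T0"
  shows "norm ((X \<epsilon> p s \<theta>, Y \<epsilon> p s \<theta>) - R p (\<tau> + s + \<theta>)) \<le> C1 * \<epsilon>"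
proof -
  define v where "v = (\<lambda>\<theta>. (X \<epsilon> p s \<theta>, Y \<epsilon> p s \<theta>) - R p (\<tau> + s + \<theta>))"
  define d where "d = (\<lambda>\<theta>. (f (W \<epsilon> p s \<theta>), g (W \<epsilon> p s \<theta>)) - reduced_field (R p (\<tau> + s + \<theta>)))"
  define \<psi> where "\<psi> = (\<lambda>\<theta>. 2 * L * (C0 * exp (- \<theta> / \<epsilon>) + M * \<epsilon>))"
  define \<Psi> where "\<Psi> = (\<lambda>\<theta>. 2 * L * (- \<epsilon> * C0 * exp (- \<theta> / \<epsilon>) + M * \<epsilon> * \<theta>))"
  have "norm (v \<theta>) \<le> exp (6 * L * (\<theta> - 0)) * (norm (v 0) + \<Psi> \<theta> - \<Psi> 0)"
  proof (rule gronwall_forced[where d = d and \<psi> = \<psi>])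
    fix t :: real assume t: "0 \<le> t" "t \<le> \<theta>"
    have "((\<lambda>\<theta>. R p (\<theta> + (\<tau> + s))) has_vector_derivative reduced_field (R p (t + (\<tau> + s)))) (at t)"
      by (rule has_vector_derivative_shift[OF R_deriv])
    moreover have "((\<lambda>\<theta>. (X \<epsilon> p s \<theta>, Y \<epsilon> p s \<theta>)) has_vector_derivative
        (f (W \<epsilon> p s t), g (W \<epsilon> p s t))) (at t)"
      using X_deriv[OF \<epsilon>, of p s t] Y_deriv[OF \<epsilon>, of p s t]
      unfolding has_real_derivative_iff_has_vector_derivative
      by (rule has_vector_derivative_Pair)
    ultimately show "(v has_vector_derivative d t) (at t)"
      unfolding v_def d_def by (simp add: add.commute has_vector_derivative_diff)
    show "(\<Psi> has_real_derivative \<psi> t) (at t)"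
      unfolding \<Psi>_def \<psi>_def using \<epsilon>
      by (auto intro!: derivative_eq_intros simp: algebra_simps)
    show "\<psi> t \<ge> 0"
      unfolding \<psi>_def using L_nonneg const_nonneg M_pos \<epsilon> by simp
    define x where "x = fst (R p (\<tau> + s + t))"
    define y where "y = snd (R p (\<tau> + s + t))"
    have vt: "v t = (X \<epsilon> p s t - x, Y \<epsilon> p s t - y)"
      by (simp add: v_def x_def y_def prod_eq_iff)
    have dx: "\<bar>X \<epsilon> p s t - x\<bar> \<le> norm (v t)" "\<bar>Y \<epsilon> p s t - y\<bar> \<le> norm (v t)"
      using abs_fst_le_norm[of "v t"] abs_snd_le_norm[of "v t"] by (simp_all add: vt)
    have zx: "\<bar>Z \<epsilon> p s t - x\<bar> \<le> norm (v t) + (C0 * exp (- t / \<epsilon>) + M * \<epsilon>)"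
      using lag_bound_exp[OF \<epsilon> p s, of t] dx t by linarith
    have "L * (\<bar>X \<epsilon> p s t - x\<bar> + \<bar>Y \<epsilon> p s t - y\<bar> + \<bar>Z \<epsilon> p s t - x\<bar>)
        \<le> L * (3 * norm (v t) + (C0 * exp (- t / \<epsilon>) + M * \<epsilon>))"
      using dx zx L_nonneg by (intro mult_left_mono) linarith+
    then have "\<bar>f (W \<epsilon> p s t) - f (x, y, x)\<bar> \<le> L * (3 * norm (v t) + (C0 * exp (- t / \<epsilon>) + M * \<epsilon>))"
      "\<bar>g (W \<epsilon> p s t) - g (x, y, x)\<bar> \<le> L * (3 * norm (v t) + (C0 * exp (- t / \<epsilon>) + M * \<epsilon>))"
      using lipschitz_triple[OF lipf, of "X \<epsilon> p s t" "Y \<epsilon> p s t" "Z \<epsilon> p s t" x y x]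
        lipschitz_triple[OF lipg, of "X \<epsilon> p s t" "Y \<epsilon> p s t" "Z \<epsilon> p s t" x y x]
      unfolding W_collapse by linarith+
    moreover have "norm (d t) \<le> \<bar>f (W \<epsilon> p s t) - f (x, y, x)\<bar> + \<bar>g (W \<epsilon> p s t) - g (x, y, x)\<bar>"
      unfolding d_def reduced_field_def x_def y_def diff_Pair by (rule norm_Pair_abs_le)
    ultimately show "norm (d t) \<le> 6 * L * norm (v t) + \<psi> t"
      by (simp add: \<psi>_def algebra_simps)
  qed (use \<theta> L_nonneg in auto)
  also have "v 0 = 0" by (simp add: v_def W_0[OF \<epsilon>])
  also have "exp (6 * L * (\<theta> - 0)) * (norm (0 :: real \<times> real) + \<Psi> \<theta> - \<Psi> 0)
      \<le> exp (6 * L * T0) * (2 * L * (C0 + M * T0) * \<epsilon>)"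
  proof (rule mult_mono)
    have "\<epsilon> * C0 * exp (- \<theta> / \<epsilon>) \<ge> 0" using \<epsilon> const_nonneg by simp
    moreover have "M * \<epsilon> * \<theta> \<le> M * \<epsilon> * T0" using \<epsilon> M_pos \<theta> by simp
    ultimately have "- \<epsilon> * C0 * exp (- \<theta> / \<epsilon>) + M * \<epsilon> * \<theta> + \<epsilon> * C0 \<le> M * \<epsilon> * T0 + \<epsilon> * C0"
      by linarith
    then have "2 * L * (- \<epsilon> * C0 * exp (- \<theta> / \<epsilon>) + M * \<epsilon> * \<theta> + \<epsilon> * C0)
        \<le> 2 * L * (M * \<epsilon> * T0 + \<epsilon> * C0)"
      using L_nonneg by (intro mult_left_mono) auto
    then show "norm (0 :: real \<times> real) + \<Psi> \<theta> - \<Psi> 0 \<le> 2 * L * (C0 + M * T0) * \<epsilon>"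
      by (simp add: \<Psi>_def algebra_simps)
    have "exp (- \<theta> / \<epsilon>) \<le> 1" using \<theta> \<epsilon> by simp
    then have "\<epsilon> * C0 * exp (- \<theta> / \<epsilon>) \<le> \<epsilon> * C0 * 1"
      using \<epsilon> const_nonneg by (intro mult_left_mono) auto
    moreover have "M * \<epsilon> * \<theta> \<ge> 0" using M_pos \<epsilon> \<theta> by simp
    ultimately have "0 \<le> 2 * L * (- \<epsilon> * C0 * exp (- \<theta> / \<epsilon>) + M * \<epsilon> * \<theta> + \<epsilon> * C0)"
      using L_nonneg by (intro mult_nonneg_nonneg) auto
    then show "0 \<le> norm (0 :: real \<times> real) + \<Psi> \<theta> - \<Psi> 0"
      by (simp add: \<Psi>_def algebra_simps)
  qed (use \<theta> L_nonneg in \<open>auto intro: mult_left_mono\<close>)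
  finally show ?thesis by (simp add: v_def C1_def algebra_simps)
qed

lemma reduced_approx_comp:
  assumes "\<epsilon> > 0" "\<bar>p\<bar> \<le> 1" "\<bar>s\<bar> \<le> 1" "0 \<le> \<theta>" "\<theta> \<le> T0"
  shows "\<bar>X \<epsilon> p s \<theta> - fst (R p (\<tau> + s + \<theta>))\<bar> \<le> C1 * \<epsilon>"
    "\<bar>Y \<epsilon> p s \<theta> - snd (R p (\<tau> + s + \<theta>))\<bar> \<le> C1 * \<epsilon>"
  using reduced_approx[OF assms]
    abs_fst_le_norm[of "(X \<epsilon> p s \<theta>, Y \<epsilon> p s \<theta>) - R p (\<tau> + s + \<theta>)"]
    abs_snd_le_norm[of "(X \<epsilon> p s \<theta>, Y \<epsilon> p s \<theta>) - R p (\<tau> + s + \<theta>)"] by simp_all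

text \<open>Only the orbit with label 0 is expanded, by differentiability in time. The label
  \<open>p\<close> enters through a Lipschitz bound because the reduced flow need not be
  differentiable in it. So the factor of \<open>\<bar>p\<bar>\<close> is merely bounded while the
  factor of \<open>\<bar>s\<bar>\<close> is arbitrarily small.\<close>

lemma start_expansion:
  "\<exists>C>0. \<forall>e>0. \<exists>d>0. \<forall>p s. \<bar>s\<bar> \<le> d \<longrightarrow>
     \<bar>fst (R p (\<tau> + s)) - xa \<tau> - s * f (xa \<tau>, ya \<tau>, xa \<tau>)\<bar> \<le> C * \<bar>p\<bar> + e * \<bar>s\<bar> \<and>
     \<bar>snd (R p (\<tau> + s)) - ya \<tau> - s * g (xa \<tau>, ya \<tau>, xa \<tau>)\<bar> \<le> C * \<bar>p\<bar> + e * \<bar>s\<bar>"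
proof -
  define C where "C = exp (6 * L * (1 - \<tau>))"
  have C: "C > 0" by (simp add: C_def)
  show ?thesis
  proof (rule exI[of _ C], rule conjI[OF C], intro allI impI)
    fix e :: real assume e: "e > 0"
    have tri: "\<bar>a - b\<bar> \<le> q \<Longrightarrow> \<bar>b - c - k\<bar> \<le> r \<Longrightarrow> \<bar>a - c - k\<bar> \<le> q + r" for a b c k q r :: real
      by linarith
    have expand: "\<exists>d>0. \<forall>s. \<bar>s\<bar> \<le> d \<longrightarrow> \<bar>u (\<tau> + s) - u \<tau> - s * u'\<bar> \<le> e * \<bar>s\<bar>"
      if "(u has_real_derivative u') (at \<tau>)" for u u'
    proof -
      have "(\<lambda>h. (u (\<tau> + h) - u \<tau>) / h) \<midarrow>0\<rightarrow> u'"
        using that by (simp add: DERIV_def)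
      from LIM_D[OF this e] obtain d where d0: "d > 0"
        "\<forall>h. h \<noteq> 0 \<and> norm (h - 0) < d \<longrightarrow> norm ((u (\<tau> + h) - u \<tau>) / h - u') < e"
        by blast
      have d: "\<bar>(u (\<tau> + h) - u \<tau>) / h - u'\<bar> < e" if "h \<noteq> 0" "\<bar>h\<bar> < d" for h
        using d0(2)[rule_format, of h] that by simp
      have "\<bar>u (\<tau> + s) - u \<tau> - s * u'\<bar> \<le> e * \<bar>s\<bar>" if "\<bar>s\<bar> \<le> d / 2" for s
      proof (cases "s = 0")
        case False
        have "u (\<tau> + s) - u \<tau> - s * u' = ((u (\<tau> + s) - u \<tau>) / s - u') * s"
          using False by (simp add: field_simps)
        then have "\<bar>u (\<tau> + s) - u \<tau> - s * u'\<bar> = \<bar>(u (\<tau> + s) - u \<tau>) / s - u'\<bar> * \<bar>s\<bar>"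
          by (simp add: abs_mult)
        also have "\<dots> \<le> e * \<bar>s\<bar>"
          using d[of s] False that d0(1) by (intro mult_right_mono) auto
        finally show ?thesis .
      qed simp
      then show ?thesis using d0(1) by (intro exI[of _ "d / 2"]) auto
    qed
    have "\<exists>d>0. \<forall>s. \<bar>s\<bar> \<le> d \<longrightarrow> \<bar>xa (\<tau> + s) - xa \<tau> - s * f (xa \<tau>, ya \<tau>, xa \<tau>)\<bar> \<le> e * \<bar>s\<bar>"
      by (rule expand[OF xa])
    then obtain d1 where d1: "d1 > 0"
      "\<forall>s. \<bar>s\<bar> \<le> d1 \<longrightarrow> \<bar>xa (\<tau> + s) - xa \<tau> - s * f (xa \<tau>, ya \<tau>, xa \<tau>)\<bar> \<le> e * \<bar>s\<bar>"
      by (elim exE conjE)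
    have "\<exists>d>0. \<forall>s. \<bar>s\<bar> \<le> d \<longrightarrow> \<bar>ya (\<tau> + s) - ya \<tau> - s * g (xa \<tau>, ya \<tau>, xa \<tau>)\<bar> \<le> e * \<bar>s\<bar>"
      by (rule expand[OF ya])
    then obtain d2 where d2: "d2 > 0"
      "\<forall>s. \<bar>s\<bar> \<le> d2 \<longrightarrow> \<bar>ya (\<tau> + s) - ya \<tau> - s * g (xa \<tau>, ya \<tau>, xa \<tau>)\<bar> \<le> e * \<bar>s\<bar>"
      by (elim exE conjE)
    define d where "d = min 1 (min d1 d2)"
    show "\<exists>d>0. \<forall>p s. \<bar>s\<bar> \<le> d \<longrightarrow>
       \<bar>fst (R p (\<tau> + s)) - xa \<tau> - s * f (xa \<tau>, ya \<tau>, xa \<tau>)\<bar> \<le> C * \<bar>p\<bar> + e * \<bar>s\<bar> \<and>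
       \<bar>snd (R p (\<tau> + s)) - ya \<tau> - s * g (xa \<tau>, ya \<tau>, xa \<tau>)\<bar> \<le> C * \<bar>p\<bar> + e * \<bar>s\<bar>"
    proof (rule exI[of _ d], rule conjI, goal_cases)
      case 1
      show "d > 0" using d1 d2 by (simp add: d_def)
    next
      case 2
      show ?case
      proof (intro allI impI)
        fix p s :: real assume s: "\<bar>s\<bar> \<le> d"
        have "\<bar>s\<bar> \<le> 1" using s by (simp add: d_def)
        then have "\<bar>\<tau> + s\<bar> \<le> 1 - \<tau>" using \<tau> by linarith
        then have "exp (6 * L * \<bar>\<tau> + s\<bar>) \<le> C"
          using L_nonneg by (simp add: C_def mult_left_mono)
        then have "norm (R p (\<tau> + s) - (xa (\<tau> + s), ya (\<tau> + s))) \<le> C * \<bar>p\<bar>"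
          by (intro order_trans[OF R_dist] mult_right_mono) auto
        then have "\<bar>fst (R p (\<tau> + s)) - xa (\<tau> + s)\<bar> \<le> C * \<bar>p\<bar>"
          "\<bar>snd (R p (\<tau> + s)) - ya (\<tau> + s)\<bar> \<le> C * \<bar>p\<bar>"
          using abs_fst_le_norm[of "R p (\<tau> + s) - (xa (\<tau> + s), ya (\<tau> + s))"]
            abs_snd_le_norm[of "R p (\<tau> + s) - (xa (\<tau> + s), ya (\<tau> + s))"] by simp_all
        then show "\<bar>fst (R p (\<tau> + s)) - xa \<tau> - s * f (xa \<tau>, ya \<tau>, xa \<tau>)\<bar> \<le> C * \<bar>p\<bar> + e * \<bar>s\<bar> \<and>
          \<bar>snd (R p (\<tau> + s)) - ya \<tau> - s * g (xa \<tau>, ya \<tau>, xa \<tau>)\<bar> \<le> C * \<bar>p\<bar> + e * \<bar>s\<bar>"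
          using tri[OF _ d1(2)[rule_format, of s]] tri[OF _ d2(2)[rule_format, of s]] s
          by (simp add: d_def)
      qed
    qed
  qed
qed

text \<open>Compactness turns the pointwise sign condition into a margin away from
  \<open>y = 0\<close>. The margin shrinks with the distance \<open>a\<close>, which forces
  \<epsilon> to be chosen after the size of the box.\<close>

lemma fold_sign_margin:
  assumes b: "0 < a" "a \<le> b"
  shows "\<exists>m>0. m \<le> M \<and> (\<forall>y. a \<le> y \<and> y \<le> b \<longrightarrow> f (0, y, 0) \<le> - m)
     \<and> (\<forall>y. - b \<le> y \<and> y \<le> - a \<longrightarrow> f (0, y, 0) \<ge> m)"
proof -
  let ?S = "{a..b} \<union> {-b..-a}"
  have "continuous_on UNIV f" by (rule lipschitz_on_continuous_on[OF lipf])
  then have "continuous_on ?S (\<lambda>y. f (0, y, 0))"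
    by (rule continuous_on_compose2) (auto intro!: continuous_intros)
  then have "continuous_on ?S (\<lambda>y. \<bar>f (0, y, 0)\<bar>)"
    by (rule continuous_on_rabs)
  then have "\<exists>y0\<in>?S. \<forall>y\<in>?S. \<bar>f (0, y0, 0)\<bar> \<le> \<bar>f (0, y, 0)\<bar>"
    using b by (intro continuous_attains_inf) (auto intro: compact_Un)
  then obtain y0 where y0: "y0 \<in> ?S" "\<And>y. y \<in> ?S \<Longrightarrow> \<bar>f (0, y0, 0)\<bar> \<le> \<bar>f (0, y, 0)\<bar>"
    by blast
  define m where "m = \<bar>f (0, y0, 0)\<bar>"
  have "y0 \<noteq> 0" using y0(1) b by auto
  then have "m > 0" using fy[of y0] by (auto simp: m_def)
  moreover have "m \<le> M" using bounded(1) by (simp add: m_def less_imp_le)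
  moreover have "f (0, y, 0) \<le> - m" if "a \<le> y" "y \<le> b" for y
    using y0(2)[of y] fy[of y] that b by (auto simp: m_def mult_less_0_iff)
  moreover have "f (0, y, 0) \<ge> m" if "- b \<le> y" "y \<le> - a" for y
    using y0(2)[of y] fy[of y] that b by (auto simp: m_def mult_less_0_iff)
  ultimately show ?thesis by blast
qed

text \<open>Up to \<open>o(\<epsilon>)\<close>, the lag \<open>x - z\<close> is \<open>\<epsilon>\<close> times the value of \<open>x'\<close>, whose sign is known near
  the fold line.\<close>

lemma lag_sign:
  assumes sg: "sg = 1 \<or> sg = (-1 :: real)" and m: "0 < m" "m \<le> M"
    and \<epsilon>: "\<epsilon> > 0" and p: "\<bar>p\<bar> \<le> 1" and s: "\<bar>s\<bar> \<le> 1"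
    and T: "T - k \<ge> - \<tau> / 8" and k: "k > 0" "3 * L * M * k \<le> m / 4"
    and small: "3 * L * C2 * \<epsilon> \<le> m / 4" "(C2 + M) * (\<epsilon> / k) \<le> m / 4"
    and sign: "sg * f (0, Y \<epsilon> p s T, 0) \<le> - m"
  shows "sg * ((X \<epsilon> p s T - Z \<epsilon> p s T) / \<epsilon>) \<le> 2 * L * \<bar>Z \<epsilon> p s T\<bar>"
proof -
  let ?X = "X \<epsilon> p s" and ?Y = "Y \<epsilon> p s" and ?Z = "Z \<epsilon> p s"
  \<comment> \<open>Half of the margin \<open>m\<close> is spent on the drift during the window of
    length \<open>k\<close> and on the lag. At this stage \<open>Z\<close> at time \<open>T\<close>
    is not known to vanish and need not be small against \<open>m\<close>, so it remains in the
    bound.\<close>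
  define c where "c = - m / 2 + 2 * L * \<bar>?Z T\<bar>"
  have sg1: "\<bar>sg\<bar> = 1" using sg by auto
  have lag: "\<bar>?Z t - ?X t\<bar> \<le> C2 * \<epsilon>" if "T - k \<le> t" for t
    by (rule lag_bound[OF \<epsilon> p s]) (use that T in linarith)
  have fle: "sg * f (W \<epsilon> p s t) \<le> c" if t: "T - k \<le> t" "t \<le> T" for t
  proof -
    have "\<bar>?X T - ?X t - 0 * (T - t)\<bar> \<le> M * \<bar>T - t\<bar>" "\<bar>?Y T - ?Y t - 0 * (T - t)\<bar> \<le> M * \<bar>T - t\<bar>"
      by (rule deriv_linear_bound[OF X_deriv[OF \<epsilon>]] deriv_linear_bound[OF Y_deriv[OF \<epsilon>]],
          use bounded in \<open>simp add: less_imp_le\<close>)+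
    moreover have "M * \<bar>T - t\<bar> \<le> M * k" using t M_pos by simp
    ultimately have XY: "\<bar>?X T - ?X t\<bar> \<le> M * k" "\<bar>?Y T - ?Y t\<bar> \<le> M * k" by linarith+
    have "\<bar>?X t\<bar> + \<bar>?Y t - ?Y T\<bar> + \<bar>?Z t\<bar> \<le> 2 * \<bar>?Z T\<bar> + 3 * C2 * \<epsilon> + 3 * M * k"
      using XY lag[of t] lag[of T] t k by linarith
    then have "L * (\<bar>?X t\<bar> + \<bar>?Y t - ?Y T\<bar> + \<bar>?Z t\<bar>) \<le> L * (2 * \<bar>?Z T\<bar> + 3 * C2 * \<epsilon> + 3 * M * k)"
      using L_nonneg by (intro mult_left_mono) auto
    also have "\<dots> \<le> 2 * L * \<bar>?Z T\<bar> + m / 2"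
      using small(1) k(2) by (simp add: algebra_simps)
    finally have "\<bar>f (W \<epsilon> p s t) - f (0, ?Y T, 0)\<bar> \<le> 2 * L * \<bar>?Z T\<bar> + m / 2"
      using lipschitz_triple[OF lipf, of "?X t" "?Y t" "?Z t" 0 "?Y T" 0] unfolding W_collapse by simp
    moreover have "sg * f (W \<epsilon> p s t) \<le> sg * f (0, ?Y T, 0) + \<bar>f (W \<epsilon> p s t) - f (0, ?Y T, 0)\<bar>"
      using sg by auto
    ultimately show ?thesis using sign by (simp add: c_def)
  qed
  have "sg * (?Z T - ?X T) + \<epsilon> * c \<ge> exp (- (T - (T - k)) / \<epsilon>) * (sg * (?Z (T - k) - ?X (T - k)) + \<epsilon> * c)"
  proof (rule relaxation_bound[OF _ \<epsilon> _ fle])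
    show "((\<lambda>t. sg * (?Z t - ?X t)) has_real_derivative
        - (sg * (?Z t - ?X t)) / \<epsilon> - sg * f (W \<epsilon> p s t)) (at t)" for t
      by (rule DERIV_cong[OF DERIV_cmult[OF lag_deriv[OF \<epsilon>]]]) (simp add: algebra_simps)
  qed (use k in auto)
  \<comment> \<open>The transient from the beginning of the window costs another quarter of the
    margin; a negative remainder \<open>- m / 4\<close> is left over.\<close>
  moreover have "exp (- (T - (T - k)) / \<epsilon>) * (sg * (?Z (T - k) - ?X (T - k)) + \<epsilon> * c) \<ge> - (\<epsilon> * (m / 4))"
  proof -
    have "\<bar>sg * (?Z (T - k) - ?X (T - k))\<bar> \<le> C2 * \<epsilon>"
      using lag[of "T - k"] sg1 by (simp add: abs_mult)
    moreover have "2 * L * \<bar>?Z T\<bar> \<ge> 0" using L_nonneg by simp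
    then have "c \<ge> - M" using m unfolding c_def by linarith
    then have "\<epsilon> * c \<ge> \<epsilon> * (- M)" using \<epsilon> by (intro mult_left_mono) auto
    ultimately have "sg * (?Z (T - k) - ?X (T - k)) + \<epsilon> * c \<ge> - (\<epsilon> * (C2 + M))"
      by (simp add: algebra_simps abs_le_iff)
    then have "exp (- (k / \<epsilon>)) * (sg * (?Z (T - k) - ?X (T - k)) + \<epsilon> * c)
        \<ge> exp (- (k / \<epsilon>)) * (- (\<epsilon> * (C2 + M)))"
      by (intro mult_left_mono) auto
    moreover have "exp (- (k / \<epsilon>)) * (\<epsilon> * (C2 + M)) \<le> (\<epsilon> / k) * (\<epsilon> * (C2 + M))"
      using exp_minus_le[of "k / \<epsilon>"] k \<epsilon> const_nonneg M_pos by (intro mult_right_mono) auto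
    moreover have "(\<epsilon> / k) * (\<epsilon> * (C2 + M)) = \<epsilon> * ((C2 + M) * (\<epsilon> / k))" by simp
    moreover have "\<epsilon> * ((C2 + M) * (\<epsilon> / k)) \<le> \<epsilon> * (m / 4)"
      using small(2) \<epsilon> by (intro mult_left_mono) auto
    moreover have "- (T - (T - k)) / \<epsilon> = - (k / \<epsilon>)" by simp
    ultimately show ?thesis by (simp only:)
  qed
  ultimately have "sg * (?X T - ?Z T) \<le> \<epsilon> * (c + m / 4)"
    by (simp add: algebra_simps)
  then have "sg * (?X T - ?Z T) / \<epsilon> \<le> c + m / 4"
    using \<epsilon> by (simp add: divide_le_eq mult.commute)
  then show ?thesis using m by (simp add: c_def)
qed

section \<open>The end of a half near the origin\<close>

abbreviation G0 where "G0 \<equiv> g (0, 0, 0)"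

text \<open>Within distance of order \<delta> from the origin \<open>f\<close> is itself of order
  \<delta>, because it vanishes there, and \<open>g\<close> differs from \<open>G0\<close> by the
  same order. Over a time of order \<delta> both errors become quadratic, hence negligible against a
  box of size \<delta>.\<close>

lemma end_reduced:
  assumes t: "\<bar>t\<bar> \<le> 2 * \<delta>" and p: "\<bar>p\<bar> \<le> \<delta>"
  shows "\<bar>fst (R p t) - p\<bar> \<le> 2 * L * (2 + 6 * M) * \<delta> * \<delta>"
    "\<bar>snd (R p t) - G0 * t\<bar> \<le> 2 * L * (2 + 6 * M) * \<delta> * \<delta>"
proof -
  have \<delta>: "\<delta> \<ge> 0" using p by linarith
  have bd: "L * (\<bar>fst (R p r)\<bar> + \<bar>snd (R p r)\<bar> + \<bar>fst (R p r)\<bar>) \<le> L * (2 + 6 * M) * \<delta>"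
    if r: "\<bar>r\<bar> \<le> 2 * \<delta>" for r
  proof -
    have "M * \<bar>r\<bar> \<le> M * (2 * \<delta>)" using r M_pos by simp
    then have "\<bar>fst (R p r)\<bar> + \<bar>snd (R p r)\<bar> + \<bar>fst (R p r)\<bar> \<le> (2 + 6 * M) * \<delta>"
      using R_near[of p r] p by (simp add: algebra_simps)
    then show ?thesis using L_nonneg by (simp add: mult.assoc mult_left_mono)
  qed
  have "\<bar>fst (R p t) - fst (R p 0) - 0 * (t - 0)\<bar> \<le> (L * (2 + 6 * M) * \<delta>) * \<bar>t - 0\<bar>"
  proof (rule deriv_linear_bound[OF R_fst_deriv])
    fix r assume "min 0 t \<le> r" "r \<le> max 0 t"
    then have "\<bar>r\<bar> \<le> 2 * \<delta>" using t by (auto simp: min_def max_def split: if_splits)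
    then show "\<bar>f (fst (R p r), snd (R p r), fst (R p r)) - 0\<bar> \<le> L * (2 + 6 * M) * \<delta>"
      using bd[of r] lipschitz_triple[OF lipf, of "fst (R p r)" "snd (R p r)" "fst (R p r)" 0 0 0]
      by (simp add: f0)
  qed
  moreover have "\<bar>snd (R p t) - snd (R p 0) - G0 * (t - 0)\<bar> \<le> (L * (2 + 6 * M) * \<delta>) * \<bar>t - 0\<bar>"
  proof (rule deriv_linear_bound[OF R_snd_deriv])
    fix r assume "min 0 t \<le> r" "r \<le> max 0 t"
    then have "\<bar>r\<bar> \<le> 2 * \<delta>" using t by (auto simp: min_def max_def split: if_splits)
    then show "\<bar>g (fst (R p r), snd (R p r), fst (R p r)) - G0\<bar> \<le> L * (2 + 6 * M) * \<delta>"
      using bd[of r] lipschitz_triple[OF lipg, of "fst (R p r)" "snd (R p r)" "fst (R p r)" 0 0 0]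
      by simp
  qed
  moreover have "(L * (2 + 6 * M) * \<delta>) * \<bar>t - 0\<bar> \<le> (L * (2 + 6 * M) * \<delta>) * (2 * \<delta>)"
    using t \<delta> L_nonneg M_pos by (intro mult_left_mono) auto
  ultimately show "\<bar>fst (R p t) - p\<bar> \<le> 2 * L * (2 + 6 * M) * \<delta> * \<delta>"
    "\<bar>snd (R p t) - G0 * t\<bar> \<le> 2 * L * (2 + 6 * M) * \<delta> * \<delta>"
    by (simp_all add: R_0 mult_ac)
qed

text \<open>Collects what the faces of the matching box require. The label \<open>p\<close> controls
  \<open>Z\<close>, and the time \<open>t\<close> after the reduced crossing of \<open>y = 0\<close>
  controls \<open>Y\<close>. The lag has a known sign once \<open>\<bar>t\<bar>\<close> reaches
  \<open>3 / 4 * \<delta>\<close>, up to a multiple of \<open>\<bar>Z\<bar>\<close> that disappears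
  on \<open>z = 0\<close>.\<close>

definition end_near :: "real \<Rightarrow> real \<Rightarrow> real \<Rightarrow> real \<Rightarrow> real \<Rightarrow> bool" where
  "end_near \<delta> \<epsilon> p s t \<longleftrightarrow>
       \<bar>Z \<epsilon> p s (t - \<tau> - s) - p\<bar> \<le> \<delta> / 2 \<and>
       \<bar>Y \<epsilon> p s (t - \<tau> - s) - G0 * t\<bar> \<le> G0 * \<delta> / 8 \<and>
       (3 / 4 * \<delta> \<le> t \<longrightarrow> (X \<epsilon> p s (t - \<tau> - s) - Z \<epsilon> p s (t - \<tau> - s)) / \<epsilon>
            \<le> 2 * L * \<bar>Z \<epsilon> p s (t - \<tau> - s)\<bar>) \<and>
       (t \<le> - 3 / 4 * \<delta> \<longrightarrow> (X \<epsilon> p s (t - \<tau> - s) - Z \<epsilon> p s (t - \<tau> - s)) / \<epsilon>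
            \<ge> - 2 * L * \<bar>Z \<epsilon> p s (t - \<tau> - s)\<bar>)"

text \<open>The order of choices matters: \<delta> must be small for the quadratic errors of the
  reduced flow, and \<epsilon> must be small relative to the sign margin, which depends on
  \<delta>.\<close>

lemma end_estimates:
  assumes K: "K > 0"
  shows "\<exists>\<delta>0>0. \<forall>\<delta>. 0 < \<delta> \<and> \<delta> \<le> \<delta>0 \<longrightarrow> (\<exists>\<epsilon>0>0. \<forall>\<epsilon> p s t.
     0 < \<epsilon> \<and> \<epsilon> < \<epsilon>0 \<and> \<bar>p\<bar> \<le> \<delta> \<and> \<bar>s\<bar> \<le> K * \<delta> \<and> \<bar>t\<bar> \<le> 2 * \<delta> \<longrightarrow>
       end_near \<delta> \<epsilon> p s t)"
proof -
  define C where "C = 2 * L * (2 + 6 * M)"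
  have C: "C \<ge> 0" using L_nonneg M_pos by (simp add: C_def)
  \<comment> \<open>The first four entries keep labels and times in the range of the approximation
    lemmas; the last two make \<open>C * \<delta> * \<delta>\<close> at most
    \<open>\<delta> / 8\<close> and \<open>G0 * \<delta> / 16\<close>.\<close>
  define \<delta>0 where "\<delta>0 = Min {1, 1 / K, - \<tau> / (2 * K), - \<tau> / 8, 1 / (8 * (C + 1)), G0 / (16 * (C + 1))}"
  have \<delta>0: "\<delta>0 > 0"
    unfolding \<delta>0_def by (subst Min_gr_iff) (use K \<tau> C g0 in \<open>auto simp: divide_neg_pos\<close>)
  have \<delta>b: "\<delta>0 \<le> 1" "\<delta>0 \<le> 1 / K" "\<delta>0 \<le> - \<tau> / (2 * K)" "\<delta>0 \<le> - \<tau> / 8"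
      "\<delta>0 \<le> 1 / (8 * (C + 1))" "\<delta>0 \<le> G0 / (16 * (C + 1))"
    unfolding \<delta>0_def by (rule Min_le; simp)+
  show ?thesis
  proof (rule exI[of _ \<delta>0], rule conjI[OF \<delta>0], intro allI impI)
    fix \<delta> assume "0 < \<delta> \<and> \<delta> \<le> \<delta>0"
    then have \<delta>: "\<delta> > 0" "\<delta> \<le> 1" "\<delta> \<le> 1 / K" "\<delta> \<le> - \<tau> / (2 * K)" "\<delta> \<le> - \<tau> / 8"
      "\<delta> \<le> 1 / (8 * (C + 1))" "\<delta> \<le> G0 / (16 * (C + 1))"
      using \<delta>b by linarith+
    have K1: "K * \<delta> \<le> 1" "K * \<delta> \<le> - \<tau> / 2"
      using \<delta>(3,4) K by (auto simp: field_simps)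
    have "8 * (C + 1) * \<delta> \<le> 1" "16 * (C + 1) * \<delta> \<le> G0"
      using \<delta>(6,7) C by (auto simp: pos_le_divide_eq mult.commute)
    then have "8 * C * \<delta> \<le> 1" "16 * C * \<delta> \<le> G0" using \<delta>(1) by (auto simp: algebra_simps)
    then have "8 * C * \<delta> * \<delta> \<le> 1 * \<delta>" "16 * C * \<delta> * \<delta> \<le> G0 * \<delta>"
      using \<delta>(1) by (metis less_eq_real_def mult_right_mono)+
    then have C\<delta>: "C * \<delta> * \<delta> \<le> \<delta> / 8" "C * \<delta> * \<delta> \<le> G0 * \<delta> / 16" by simp_all
    \<comment> \<open>For \<open>3 / 4 * \<delta> \<le> \<bar>t\<bar> \<le> 2 * \<delta>\<close> a
      value within \<open>G0 * \<delta> / 8\<close> of \<open>G0 * t\<close> has modulus between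
      these two bounds.\<close>
    have "0 < G0 * \<delta> / 2" "G0 * \<delta> / 2 \<le> 3 * G0 * \<delta>" using g0 \<delta> by auto
    then obtain m where m: "m > 0" "m \<le> M"
      and mpos: "\<And>y. G0 * \<delta> / 2 \<le> y \<Longrightarrow> y \<le> 3 * G0 * \<delta> \<Longrightarrow> f (0, y, 0) \<le> - m"
      and mneg: "\<And>y. - (3 * G0 * \<delta>) \<le> y \<Longrightarrow> y \<le> - (G0 * \<delta> / 2) \<Longrightarrow> f (0, y, 0) \<ge> m"
      using fold_sign_margin by metis
    \<comment> \<open>The first entry lets the window before the end begin after the initial layer;
      the second limits the loss by drift during the window to \<open>m / 4\<close>.\<close>
    define k where "k = min (- \<tau> / 8) (m / (12 * (L + 1) * M))"
    have k: "k > 0" "k \<le> - \<tau> / 8" using \<tau> m M_pos L_nonneg by (auto simp: k_def)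
    have "3 * L * M * k \<le> 3 * (L + 1) * M * k" using k M_pos L_nonneg by (intro mult_right_mono) auto
    also have "\<dots> \<le> 3 * (L + 1) * M * (m / (12 * (L + 1) * M))"
      using M_pos L_nonneg by (intro mult_left_mono) (auto simp: k_def)
    also have "\<dots> = 3 * ((L + 1) * M) * (m / (12 * ((L + 1) * M)))" by (simp only: mult.assoc)
    also have "\<dots> = m / 4" using M_pos L_nonneg by simp
    finally have k3: "3 * L * M * k \<le> m / 4" .
    define \<epsilon>0 where "\<epsilon>0 = Min {\<delta> / (8 * (C1 + 1)), \<delta> / (8 * C2), G0 * \<delta> / (16 * (C1 + 1)),
        m / (12 * (L + 1) * C2), m * k / (4 * (C2 + M))}"
    have \<epsilon>0: "\<epsilon>0 > 0"
      unfolding \<epsilon>0_def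
      by (subst Min_gr_iff) (use \<delta>(1) const_nonneg g0 m k L_nonneg M_pos in auto)
    have \<epsilon>b: "\<epsilon>0 \<le> \<delta> / (8 * (C1 + 1))" "\<epsilon>0 \<le> \<delta> / (8 * C2)" "\<epsilon>0 \<le> G0 * \<delta> / (16 * (C1 + 1))"
        "\<epsilon>0 \<le> m / (12 * (L + 1) * C2)" "\<epsilon>0 \<le> m * k / (4 * (C2 + M))"
      unfolding \<epsilon>0_def by (rule Min_le; simp)+
    show "\<exists>\<epsilon>0>0. \<forall>\<epsilon> p s t.
     0 < \<epsilon> \<and> \<epsilon> < \<epsilon>0 \<and> \<bar>p\<bar> \<le> \<delta> \<and> \<bar>s\<bar> \<le> K * \<delta> \<and> \<bar>t\<bar> \<le> 2 * \<delta> \<longrightarrow>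
       end_near \<delta> \<epsilon> p s t"
    proof (rule exI[of _ \<epsilon>0], rule conjI[OF \<epsilon>0], intro allI impI)
      fix \<epsilon> p s t
      assume asm: "0 < \<epsilon> \<and> \<epsilon> < \<epsilon>0 \<and> \<bar>p\<bar> \<le> \<delta> \<and> \<bar>s\<bar> \<le> K * \<delta> \<and> \<bar>t\<bar> \<le> 2 * \<delta>"
      define T where "T = t - \<tau> - s"
      have \<epsilon>: "\<epsilon> > 0" "\<epsilon> \<le> \<delta> / (8 * (C1 + 1))" "\<epsilon> \<le> \<delta> / (8 * C2)" "\<epsilon> \<le> G0 * \<delta> / (16 * (C1 + 1))"
        "\<epsilon> \<le> m / (12 * (L + 1) * C2)" "\<epsilon> \<le> m * k / (4 * (C2 + M))"
        using asm \<epsilon>b by linarith+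
      have ps: "\<bar>p\<bar> \<le> \<delta>" "\<bar>p\<bar> \<le> 1" "\<bar>s\<bar> \<le> 1" "\<bar>t\<bar> \<le> 2 * \<delta>"
        using asm \<delta> K1 by auto
      have T: "T \<ge> - \<tau> / 4" "T \<le> T0" "\<tau> + s + T = t"
        using asm K1 \<delta> \<tau> by (auto simp: T_def T0_def abs_le_iff)
      have e1: "C1 * \<epsilon> \<le> \<delta> / 8" "C1 * \<epsilon> \<le> G0 * \<delta> / 16"
      proof -
        have "8 * (C1 + 1) * \<epsilon> \<le> \<delta>" "16 * (C1 + 1) * \<epsilon> \<le> G0 * \<delta>"
          using \<epsilon>(2,4) const_nonneg by (auto simp: pos_le_divide_eq mult.commute)
        then show "C1 * \<epsilon> \<le> \<delta> / 8" "C1 * \<epsilon> \<le> G0 * \<delta> / 16"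
          using \<epsilon>(1) by (auto simp: algebra_simps)
      qed
      have e3: "C2 * \<epsilon> \<le> \<delta> / 8"
        using \<epsilon>(3) const_nonneg by (auto simp: pos_le_divide_eq mult.commute)
      have e4: "3 * L * C2 * \<epsilon> \<le> m / 4"
      proof -
        have "12 * (L + 1) * C2 * \<epsilon> \<le> m"
          using \<epsilon>(5) const_nonneg L_nonneg by (auto simp: pos_le_divide_eq mult.commute)
        moreover have "12 * L * C2 * \<epsilon> \<le> 12 * (L + 1) * C2 * \<epsilon>"
          using \<epsilon>(1) const_nonneg L_nonneg by (intro mult_right_mono) auto
        ultimately show ?thesis by linarith
      qed
      have e5: "(C2 + M) * (\<epsilon> / k) \<le> m / 4"
      proof -
        have "4 * (C2 + M) * \<epsilon> \<le> m * k"
          using \<epsilon>(6) const_nonneg M_pos by (auto simp: pos_le_divide_eq mult.commute)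
        then show ?thesis using k(1) by (simp add: field_simps)
      qed
      have XY: "\<bar>X \<epsilon> p s T - fst (R p t)\<bar> \<le> C1 * \<epsilon>" "\<bar>Y \<epsilon> p s T - snd (R p t)\<bar> \<le> C1 * \<epsilon>"
        using reduced_approx_comp[OF \<epsilon>(1) ps(2,3), of T] T \<tau> by auto
      have ZX: "\<bar>Z \<epsilon> p s T - X \<epsilon> p s T\<bar> \<le> C2 * \<epsilon>"
        by (rule lag_bound[OF \<epsilon>(1) ps(2,3)]) (use T \<tau> in linarith)
      have red: "\<bar>fst (R p t) - p\<bar> \<le> C * \<delta> * \<delta>" "\<bar>snd (R p t) - G0 * t\<bar> \<le> C * \<delta> * \<delta>"
        using end_reduced[OF ps(4,1)] by (simp_all add: C_def)
      have Zp: "\<bar>Z \<epsilon> p s T - p\<bar> \<le> \<delta> / 2"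
        using XY(1) ZX red(1) C\<delta>(1) e1(1) e3 by linarith
      have Yt: "\<bar>Y \<epsilon> p s T - G0 * t\<bar> \<le> G0 * \<delta> / 8"
        using XY(2) red(2) C\<delta>(2) e1(2) by linarith
      have Tk: "T - k \<ge> - \<tau> / 8" using T k by linarith
      have pos: "(X \<epsilon> p s T - Z \<epsilon> p s T) / \<epsilon> \<le> 2 * L * \<bar>Z \<epsilon> p s T\<bar>" if t: "3 / 4 * \<delta> \<le> t"
      proof -
        have "G0 * (3 / 4 * \<delta>) \<le> G0 * t" "G0 * t \<le> G0 * (2 * \<delta>)"
          by (rule mult_left_mono; use t ps g0 in linarith)+
        then have "f (0, Y \<epsilon> p s T, 0) \<le> - m"
          using Yt mult_pos_pos[OF g0 \<delta>(1)] unfolding abs_le_iff by (intro mpos) linarith+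
        then show ?thesis
          using lag_sign[of 1, OF _ m \<epsilon>(1) ps(2,3) Tk k(1) k3 e4 e5] by simp
      qed
      have neg: "(X \<epsilon> p s T - Z \<epsilon> p s T) / \<epsilon> \<ge> - 2 * L * \<bar>Z \<epsilon> p s T\<bar>" if t: "t \<le> - 3 / 4 * \<delta>"
      proof -
        have "G0 * t \<le> G0 * (- 3 / 4 * \<delta>)" "G0 * (- 2 * \<delta>) \<le> G0 * t"
          by (rule mult_left_mono; use t ps g0 in linarith)+
        then have "f (0, Y \<epsilon> p s T, 0) \<ge> m"
          using Yt mult_pos_pos[OF g0 \<delta>(1)] unfolding abs_le_iff by (intro mneg) linarith+
        then have "- 1 * ((X \<epsilon> p s T - Z \<epsilon> p s T) / \<epsilon>) \<le> 2 * L * \<bar>Z \<epsilon> p s T\<bar>"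
          by (intro lag_sign[OF _ m \<epsilon>(1) ps(2,3) Tk k(1) k3 e4 e5]) simp_all
        then show ?thesis by linarith
      qed
      show "end_near \<delta> \<epsilon> p s t"
        using Zp Yt pos neg unfolding T_def end_near_def by blast
    qed
  qed
qed

text \<open>Up to time \<open>T - k\<close> the abscissa follows \<open>xa\<close>, which has a
  negative maximum on a compact interval, so the weighted \<open>z\<close> decreases strictly from
  0. In the remaining window \<open>g > 0\<close>, hence \<open>y\<close> increases and
  \<open>fold_passage\<close> applies. The last two conclusions are shaped for two halves with
  opposite end ordinates: the one ending with \<open>Y < 0\<close> provides \<open>X > 0\<close>,
  which serves as the premise for the other.\<close>

lemma end_signs:
  assumes \<kappa>: "\<kappa> > 0"
  shows "\<exists>\<delta>0>0. \<exists>\<epsilon>0>0. \<forall>\<epsilon> p s T. 0 < \<epsilon> \<and> \<epsilon> < \<epsilon>0 \<and> \<bar>p\<bar> \<le> \<delta>0 \<and> \<bar>s\<bar> \<le> \<delta>0 \<and>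
      \<bar>T + \<tau> + s\<bar> \<le> \<delta>0 \<and> Z \<epsilon> p s T = 0 \<longrightarrow>
        (\<forall>\<theta>. 0 < \<theta> \<and> \<theta> \<le> T - \<kappa> \<longrightarrow> Z \<epsilon> p s \<theta> < 0) \<and>
        (Y \<epsilon> p s T \<le> 0 \<or> X \<epsilon> p s T > 0 \<longrightarrow> (\<forall>\<theta>. 0 \<le> \<theta> \<and> \<theta> \<le> T \<longrightarrow> Z \<epsilon> p s \<theta> \<le> 0)) \<and>
        (Y \<epsilon> p s T < 0 \<longrightarrow> X \<epsilon> p s T > 0)"
proof -
  define k where "k = Min {\<kappa>, - \<tau> / 8, G0 / (24 * (L + 1) * M)}"
  have "k > 0" unfolding k_def by (subst Min_gr_iff) (use \<kappa> \<tau> g0 L_nonneg M_pos in auto)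
  moreover have "k \<le> \<kappa>" "k \<le> - \<tau> / 8" "k \<le> G0 / (24 * (L + 1) * M)"
    unfolding k_def by (rule Min_le; simp)+
  ultimately have k: "k > 0" "k \<le> \<kappa>" "k \<le> - \<tau> / 8" "k \<le> G0 / (24 * (L + 1) * M)" .
  have k3: "3 * L * M * k \<le> G0 / 8"
  proof -
    have "24 * (L + 1) * M * k \<le> G0"
      using k(4) L_nonneg M_pos by (auto simp: pos_le_divide_eq mult.commute)
    moreover have "24 * L * M * k \<le> 24 * (L + 1) * M * k"
      using k L_nonneg M_pos by (intro mult_right_mono) auto
    ultimately show ?thesis by linarith
  qed
  \<comment> \<open>All reduced times \<open>\<tau> + s + \<theta>\<close> with
    \<open>0 \<le> \<theta> \<le> T - k\<close> lie here, since
    \<open>\<bar>s\<bar> \<le> (\<tau> - Ta) / 2\<close> and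
    \<open>T + \<tau> + s \<le> k / 2\<close> by the choice of \<open>\<delta>0\<close>.\<close>
  let ?S = "{(Ta + \<tau>) / 2 .. - k / 2}"
  have "continuous_on ?S xa"
    using xa by (auto intro!: continuous_at_imp_continuous_on DERIV_isCont)
  moreover have "?S \<noteq> {}" using Ta k \<tau> by auto
  ultimately have "\<exists>r0\<in>?S. \<forall>r\<in>?S. xa r \<le> xa r0"
    by (intro continuous_attains_sup compact_Icc)
  then obtain r0 where r0: "r0 \<in> ?S" "\<And>r. r \<in> ?S \<Longrightarrow> xa r \<le> xa r0" by blast
  define m where "m = - xa r0"
  have m: "m > 0" using xa_neg[of r0] r0(1) Ta k \<tau> by (auto simp: m_def)
  define E where "E = exp (6 * L * T0)"
  have E: "E > 0" by (simp add: E_def)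
  define \<delta>0 where "\<delta>0 = Min {1, - \<tau> / 8, k / 2, (\<tau> - Ta) / 2, m / (4 * E), G0 / (8 * (L + 1) * (2 + 3 * M))}"
  have \<delta>0: "\<delta>0 > 0"
    unfolding \<delta>0_def by (subst Min_gr_iff) (use \<tau> k Ta m E g0 L_nonneg M_pos in auto)
  have \<delta>b: "\<delta>0 \<le> 1" "\<delta>0 \<le> - \<tau> / 8" "\<delta>0 \<le> k / 2" "\<delta>0 \<le> (\<tau> - Ta) / 2" "\<delta>0 \<le> m / (4 * E)"
     "\<delta>0 \<le> G0 / (8 * (L + 1) * (2 + 3 * M))"
    unfolding \<delta>0_def by (rule Min_le; simp)+
  have \<delta>6: "L * (2 + 3 * M) * \<delta>0 \<le> G0 / 8"
  proof -
    have "8 * (L + 1) * (2 + 3 * M) * \<delta>0 \<le> G0"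
      using \<delta>b(6) L_nonneg M_pos by (auto simp: pos_le_divide_eq mult.commute)
    moreover have "8 * L * (2 + 3 * M) * \<delta>0 \<le> 8 * (L + 1) * (2 + 3 * M) * \<delta>0"
      using \<delta>0 L_nonneg M_pos by (intro mult_right_mono) auto
    ultimately show ?thesis by linarith
  qed
  have \<delta>5: "E * \<delta>0 \<le> m / 4" using \<delta>b(5) E by (simp add: field_simps)
  define \<epsilon>0 where "\<epsilon>0 = Min {m / (4 * (C1 + 1)), 1 / (6 * (L + 1)), G0 / (8 * (L + 1) * (3 * C1 + C2))}"
  have \<epsilon>0: "\<epsilon>0 > 0"
    unfolding \<epsilon>0_def by (subst Min_gr_iff) (use m const_nonneg g0 L_nonneg in auto)
  have \<epsilon>b: "\<epsilon>0 \<le> m / (4 * (C1 + 1))" "\<epsilon>0 \<le> 1 / (6 * (L + 1))"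
      "\<epsilon>0 \<le> G0 / (8 * (L + 1) * (3 * C1 + C2))"
    unfolding \<epsilon>0_def by (rule Min_le; simp)+
  show ?thesis
  proof (rule exI[of _ \<delta>0], rule conjI[OF \<delta>0], rule exI[of _ \<epsilon>0], rule conjI[OF \<epsilon>0], intro allI impI)
    fix \<epsilon> p s T
    assume asm: "0 < \<epsilon> \<and> \<epsilon> < \<epsilon>0 \<and> \<bar>p\<bar> \<le> \<delta>0 \<and> \<bar>s\<bar> \<le> \<delta>0 \<and> \<bar>T + \<tau> + s\<bar> \<le> \<delta>0 \<and> Z \<epsilon> p s T = 0"
    then have \<epsilon>: "\<epsilon> > 0" "\<epsilon> \<le> m / (4 * (C1 + 1))" "\<epsilon> \<le> 1 / (6 * (L + 1))"
      "\<epsilon> \<le> G0 / (8 * (L + 1) * (3 * C1 + C2))"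
      using \<epsilon>b by linarith+
    have ps: "\<bar>p\<bar> \<le> 1" "\<bar>s\<bar> \<le> 1" "\<bar>p\<bar> \<le> \<delta>0" "\<bar>s\<bar> \<le> \<delta>0" "\<bar>T + \<tau> + s\<bar> \<le> \<delta>0"
      and ZT: "Z \<epsilon> p s T = 0"
      using asm \<delta>b by auto
    have T: "T \<ge> - \<tau> / 2" "T \<le> T0"
      using ps \<delta>b \<tau> by (auto simp: T0_def abs_le_iff)
    have e1: "C1 * \<epsilon> \<le> m / 4"
    proof -
      have "4 * (C1 + 1) * \<epsilon> \<le> m"
        using \<epsilon>(2) const_nonneg by (auto simp: pos_le_divide_eq mult.commute)
      then show ?thesis using \<epsilon>(1) by (simp add: algebra_simps)
    qed
    have e2: "6 * L * \<epsilon> \<le> 1"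
    proof -
      have "6 * (L + 1) * \<epsilon> \<le> 1"
        using \<epsilon>(3) L_nonneg by (auto simp: pos_le_divide_eq mult.commute)
      then show ?thesis using \<epsilon>(1) by (simp add: algebra_simps)
    qed
    have e3: "L * (3 * C1 + C2) * \<epsilon> \<le> G0 / 8"
    proof -
      have "8 * (L + 1) * (3 * C1 + C2) * \<epsilon> \<le> G0"
        using \<epsilon>(4) L_nonneg const_nonneg by (auto simp: pos_le_divide_eq mult.commute)
      moreover have "8 * L * (3 * C1 + C2) * \<epsilon> \<le> 8 * (L + 1) * (3 * C1 + C2) * \<epsilon>"
        using \<epsilon> L_nonneg const_nonneg by (intro mult_right_mono) auto
      ultimately show ?thesis by linarith
    qed
    have Xneg: "X \<epsilon> p s \<theta> < 0" if \<theta>: "0 \<le> \<theta>" "\<theta> \<le> T - k" for \<theta>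
    proof -
      define r where "r = \<tau> + s + \<theta>"
      have r: "r \<in> ?S" "\<bar>r\<bar> \<le> T0"
        using \<theta> ps \<delta>b T \<tau> k by (auto simp: r_def T0_def abs_le_iff)
      have "exp (6 * L * \<bar>r\<bar>) * \<bar>p\<bar> \<le> E * \<delta>0"
        using r(2) L_nonneg ps E by (intro mult_mono) (auto simp: E_def mult_left_mono)
      then have "\<bar>fst (R p r) - xa r\<bar> \<le> m / 4"
        using R_dist[of p r] abs_fst_le_norm[of "R p r - (xa r, ya r)"] \<delta>5 by simp
      moreover have "\<bar>X \<epsilon> p s \<theta> - fst (R p r)\<bar> \<le> m / 4"
        using reduced_approx_comp(1)[OF \<epsilon>(1) ps(1,2) \<theta>(1)] \<theta> T k e1 by (simp add: r_def)
      moreover have "xa r \<le> - m" using r0(2)[OF r(1)] by (simp add: m_def)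
      ultimately show ?thesis using m by linarith
    qed
    have Zneg: "Z \<epsilon> p s \<theta> < 0" if \<theta>: "0 < \<theta>" "\<theta> \<le> T - k" for \<theta>
    proof -
      define h where "h = (\<lambda>\<theta>. exp (1 / \<epsilon> * \<theta>) * Z \<epsilon> p s \<theta>)"
      have "h \<theta> < h 0"
      proof (rule DERIV_neg_imp_decreasing[where f = h and a = 0 and b = \<theta>, OF \<theta>(1)])
        fix u assume u: "0 \<le> u" "u \<le> \<theta>"
        have "(h has_real_derivative exp (1 / \<epsilon> * u) * (X \<epsilon> p s u / \<epsilon>)) (at u)"
          using DERIV_exp_weight[OF Z_deriv[OF \<epsilon>(1)], of "1 / \<epsilon>" p s u]
          by (simp add: h_def diff_divide_distrib)
        moreover have "exp (1 / \<epsilon> * u) * (X \<epsilon> p s u / \<epsilon>) < 0"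
          using Xneg[of u] u \<theta> \<epsilon>(1) by (simp add: divide_neg_pos mult_pos_neg)
        ultimately show "\<exists>y. (h has_real_derivative y) (at u) \<and> y < 0" by blast
      qed
      then show ?thesis by (simp add: h_def W_0[OF \<epsilon>(1)] mult_less_0_iff)
    qed
    have Ygrow: "g (W \<epsilon> p s \<theta>) > 0" if \<theta>: "T - k \<le> \<theta>" "\<theta> \<le> T" for \<theta>
    proof -
      define r where "r = \<tau> + s + \<theta>"
      have r: "\<bar>r\<bar> \<le> k + \<delta>0" using \<theta> ps by (auto simp: r_def abs_le_iff)
      have \<theta>0: "\<theta> \<ge> - \<tau> / 8" "0 \<le> \<theta>" "\<theta> \<le> T0" using \<theta> T k \<tau> by linarith+
      have Mr: "M * \<bar>r\<bar> \<le> M * (k + \<delta>0)" using r M_pos by simp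
      have approx: "\<bar>X \<epsilon> p s \<theta> - fst (R p r)\<bar> \<le> C1 * \<epsilon>" "\<bar>Y \<epsilon> p s \<theta> - snd (R p r)\<bar> \<le> C1 * \<epsilon>"
        using reduced_approx_comp[OF \<epsilon>(1) ps(1,2) \<theta>0(2,3)] by (simp_all add: r_def)
      have "\<bar>X \<epsilon> p s \<theta>\<bar> \<le> \<delta>0 + M * (k + \<delta>0) + C1 * \<epsilon>"
        using approx(1) R_near(1)[of p r] ps(3) Mr by linarith
      moreover have "\<bar>Y \<epsilon> p s \<theta>\<bar> \<le> M * (k + \<delta>0) + C1 * \<epsilon>"
        using approx(2) R_near(2)[of p r] Mr by linarith
      moreover have "\<bar>Z \<epsilon> p s \<theta>\<bar> \<le> \<bar>X \<epsilon> p s \<theta>\<bar> + C2 * \<epsilon>"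
        using lag_bound[OF \<epsilon>(1) ps(1,2) \<theta>0(1)] by linarith
      ultimately have "\<bar>X \<epsilon> p s \<theta>\<bar> + \<bar>Y \<epsilon> p s \<theta>\<bar> + \<bar>Z \<epsilon> p s \<theta>\<bar>
          \<le> 2 * \<delta>0 + 3 * (M * (k + \<delta>0)) + (3 * (C1 * \<epsilon>) + C2 * \<epsilon>)"
        by linarith
      then have "L * (\<bar>X \<epsilon> p s \<theta>\<bar> + \<bar>Y \<epsilon> p s \<theta>\<bar> + \<bar>Z \<epsilon> p s \<theta>\<bar>)
          \<le> L * (2 * \<delta>0 + 3 * (M * (k + \<delta>0)) + (3 * (C1 * \<epsilon>) + C2 * \<epsilon>))"
        using L_nonneg by (intro mult_left_mono)
      also have "\<dots> \<le> 3 * (G0 / 8)"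
        using e3 \<delta>6 k3 by (simp add: algebra_simps)
      finally have "\<bar>g (W \<epsilon> p s \<theta>) - G0\<bar> \<le> 3 * (G0 / 8)"
        using lipschitz_triple[OF lipg, of "X \<epsilon> p s \<theta>" "Y \<epsilon> p s \<theta>" "Z \<epsilon> p s \<theta>" 0 0 0]
        unfolding W_collapse by simp
      then show ?thesis using g0 by linarith
    qed
    have Tk: "T - k > 0" using T k \<tau> by linarith
    \<comment> \<open>Along the orbit \<open>f\<close> differs from its value on the fold line by a
      multiple of \<open>\<bar>X\<bar> + \<bar>Z\<bar>\<close>; with the sign of that value this
      gives the hypotheses \<open>before\<close> and \<open>after\<close>.\<close>
    have lip0: "\<bar>f (W \<epsilon> p s \<theta>) - f (0, Y \<epsilon> p s \<theta>, 0)\<bar> \<le> L * (\<bar>X \<epsilon> p s \<theta>\<bar> + \<bar>Z \<epsilon> p s \<theta>\<bar>)" for \<theta>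
      using lipschitz_triple[OF lipf, of "X \<epsilon> p s \<theta>" "Y \<epsilon> p s \<theta>" "Z \<epsilon> p s \<theta>" 0 "Y \<epsilon> p s \<theta>" 0]
      unfolding W_collapse by simp
    have f_sign: "y \<le> 0 \<Longrightarrow> f (0, y, 0) \<ge> 0" "y \<ge> 0 \<Longrightarrow> f (0, y, 0) \<le> 0" for y
      using fy[of y] f0 by (cases "y = 0"; simp add: mult_less_0_iff)+
    interpret fold_passage "X \<epsilon> p s" "Y \<epsilon> p s" "Z \<epsilon> p s" "\<lambda>\<theta>. f (W \<epsilon> p s \<theta>)" "T - k" T \<epsilon> L
    proof
      show "Y \<epsilon> p s u \<le> Y \<epsilon> p s v" if "T - k \<le> u" "u \<le> v" "v \<le> T" for u v
      proof (rule DERIV_nonneg_imp_nondecreasing[where f = "Y \<epsilon> p s", OF that(2)])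
        fix w assume w: "u \<le> w" "w \<le> v"
        have "g (W \<epsilon> p s w) \<ge> 0" using Ygrow[of w] w that by simp
        then show "\<exists>d. (Y \<epsilon> p s has_real_derivative d) (at w) \<and> d \<ge> 0"
          using Y_deriv[OF \<epsilon>(1)] by blast
      qed
      show "f (W \<epsilon> p s t) \<ge> - L * (\<bar>X \<epsilon> p s t\<bar> + \<bar>Z \<epsilon> p s t\<bar>)" if "Y \<epsilon> p s t \<le> 0" for t
        using lip0[of t] f_sign(1)[OF that] by (simp add: abs_le_iff)
      show "f (W \<epsilon> p s t) \<le> L * (\<bar>X \<epsilon> p s t\<bar> + \<bar>Z \<epsilon> p s t\<bar>)" if "Y \<epsilon> p s t \<ge> 0" for t
        using lip0[of t] f_sign(2)[OF that] by (simp add: abs_le_iff)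
      show "Z \<epsilon> p s (T - k) \<le> 0" using Zneg[of "T - k"] Tk by simp
      show "T - k < T" using k by simp
      show "(X \<epsilon> p s has_real_derivative f (W \<epsilon> p s t)) (at t)" for t
        by (rule X_deriv[OF \<epsilon>(1)])
      show "(Z \<epsilon> p s has_real_derivative (X \<epsilon> p s t - Z \<epsilon> p s t) / \<epsilon>) (at t)" for t
        by (rule Z_deriv[OF \<epsilon>(1)])
      show "Z \<epsilon> p s T = 0" by (rule ZT)
    qed (fact \<epsilon>(1) L_nonneg e2)+
    have early: "Z \<epsilon> p s \<theta> \<le> 0" if "0 \<le> \<theta>" "\<theta> \<le> T - k" for \<theta>
      using Zneg[of \<theta>] that by (cases "\<theta> = 0") (auto simp: W_0[OF \<epsilon>(1)])
    have 1: "Z \<epsilon> p s \<theta> < 0" if "0 < \<theta>" "\<theta> \<le> T - \<kappa>" for \<theta>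
      using Zneg[of \<theta>] that k by simp
    have 2: "Z \<epsilon> p s \<theta> \<le> 0" if "Y \<epsilon> p s T \<le> 0 \<or> X \<epsilon> p s T > 0" "0 \<le> \<theta>" "\<theta> \<le> T" for \<theta>
    proof (cases "\<theta> \<le> T - k")
      case False
      then have "T - k \<le> \<theta>" by simp
      then show ?thesis
        using that nonpos_if_end_before[of \<theta>] nonpos_if_end_x_pos[of \<theta>] by (elim disjE) simp_all
    qed (use that early in simp)
    have 3: "X \<epsilon> p s T > 0" if "Y \<epsilon> p s T < 0"
    proof (rule end_x_pos[OF that])
      assume X0: "X \<epsilon> p s T = 0"
      have "f (0, Y \<epsilon> p s T, 0) > 0" using fy[of "Y \<epsilon> p s T"] that by (simp add: mult_less_0_iff)
      then show "f (W \<epsilon> p s T) > 0" using W_collapse[of \<epsilon> p s T] X0 ZT by simp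
    qed
    show "(\<forall>\<theta>. 0 < \<theta> \<and> \<theta> \<le> T - \<kappa> \<longrightarrow> Z \<epsilon> p s \<theta> < 0) \<and>
        (Y \<epsilon> p s T \<le> 0 \<or> X \<epsilon> p s T > 0 \<longrightarrow> (\<forall>\<theta>. 0 \<le> \<theta> \<and> \<theta> \<le> T \<longrightarrow> Z \<epsilon> p s \<theta> \<le> 0)) \<and>
        (Y \<epsilon> p s T < 0 \<longrightarrow> X \<epsilon> p s T > 0)"
      by (intro conjI allI impI; (elim conjE)?) (fact 1 2 3)+
  qed
qed

end

section \<open>Closing the orbit\<close>

text \<open>Coordinate form on a symmetric box. The face conditions share one set of bounds, so
  estimates valid on the whole box can be derived once for all twelve faces.\<close>

lemma poincare_miranda_6:
  fixes F1 F2 F3 F4 F5 F6 :: "real \<times> real \<times> real \<times> real \<times> real \<times> real \<Rightarrow> real"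
  assumes pos: "0 \<le> a1" "0 \<le> a2" "0 \<le> a3" "0 \<le> a4" "0 \<le> a5" "0 \<le> a6"
    and cont: "continuous_on UNIV F1" "continuous_on UNIV F2" "continuous_on UNIV F3"
      "continuous_on UNIV F4" "continuous_on UNIV F5" "continuous_on UNIV F6"
    and faces: "\<And>x1 x2 x3 x4 x5 x6. \<bar>x1\<bar> \<le> a1 \<Longrightarrow> \<bar>x2\<bar> \<le> a2 \<Longrightarrow> \<bar>x3\<bar> \<le> a3 \<Longrightarrow> \<bar>x4\<bar> \<le> a4 \<Longrightarrow>
        \<bar>x5\<bar> \<le> a5 \<Longrightarrow> \<bar>x6\<bar> \<le> a6 \<Longrightarrow>
        (x1 = a1 \<longrightarrow> F1 (x1, x2, x3, x4, x5, x6) \<ge> 0) \<and> (x1 = - a1 \<longrightarrow> F1 (x1, x2, x3, x4, x5, x6) \<le> 0) \<and>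
        (x2 = a2 \<longrightarrow> F2 (x1, x2, x3, x4, x5, x6) \<ge> 0) \<and> (x2 = - a2 \<longrightarrow> F2 (x1, x2, x3, x4, x5, x6) \<le> 0) \<and>
        (x3 = a3 \<longrightarrow> F3 (x1, x2, x3, x4, x5, x6) \<ge> 0) \<and> (x3 = - a3 \<longrightarrow> F3 (x1, x2, x3, x4, x5, x6) \<le> 0) \<and>
        (x4 = a4 \<longrightarrow> F4 (x1, x2, x3, x4, x5, x6) \<ge> 0) \<and> (x4 = - a4 \<longrightarrow> F4 (x1, x2, x3, x4, x5, x6) \<le> 0) \<and>
        (x5 = a5 \<longrightarrow> F5 (x1, x2, x3, x4, x5, x6) \<ge> 0) \<and> (x5 = - a5 \<longrightarrow> F5 (x1, x2, x3, x4, x5, x6) \<le> 0) \<and>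
        (x6 = a6 \<longrightarrow> F6 (x1, x2, x3, x4, x5, x6) \<ge> 0) \<and> (x6 = - a6 \<longrightarrow> F6 (x1, x2, x3, x4, x5, x6) \<le> 0)"
  shows "\<exists>x1 x2 x3 x4 x5 x6. \<bar>x1\<bar> \<le> a1 \<and> \<bar>x2\<bar> \<le> a2 \<and> \<bar>x3\<bar> \<le> a3 \<and> \<bar>x4\<bar> \<le> a4 \<and>
        \<bar>x5\<bar> \<le> a5 \<and> \<bar>x6\<bar> \<le> a6 \<and>
        F1 (x1, x2, x3, x4, x5, x6) = 0 \<and> F2 (x1, x2, x3, x4, x5, x6) = 0 \<and>
        F3 (x1, x2, x3, x4, x5, x6) = 0 \<and> F4 (x1, x2, x3, x4, x5, x6) = 0 \<and>
        F5 (x1, x2, x3, x4, x5, x6) = 0 \<and> F6 (x1, x2, x3, x4, x5, x6) = 0"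
proof -
  let ?a = "(a1, a2, a3, a4, a5, a6)"
  define F where "F = (\<lambda>x. (F1 x, F2 x, F3 x, F4 x, F5 x, F6 x))"
  have basis: "i \<in> Basis \<longleftrightarrow> i \<in> {(1,0,0,0,0,0), (0,1,0,0,0,0), (0,0,1,0,0,0), (0,0,0,1,0,0),
      (0,0,0,0,1,0), (0,0,0,0,0,1)}" for i :: "real \<times> real \<times> real \<times> real \<times> real \<times> real"
    by (auto simp: Basis_prod_def zero_prod_def)
  have box: "(x1, x2, x3, x4, x5, x6) \<in> cbox (- ?a) ?a \<longleftrightarrow> \<bar>x1\<bar> \<le> a1 \<and> \<bar>x2\<bar> \<le> a2 \<and> \<bar>x3\<bar> \<le> a3
      \<and> \<bar>x4\<bar> \<le> a4 \<and> \<bar>x5\<bar> \<le> a5 \<and> \<bar>x6\<bar> \<le> a6" for x1 x2 x3 x4 x5 x6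
    by (auto simp: cbox_Pair_eq abs_le_iff)
  have "\<exists>x\<in>cbox (- ?a) ?a. F x = 0"
  proof (rule poincare_miranda)
    show "continuous_on (cbox (- ?a) ?a) F"
      by (rule continuous_on_subset[of UNIV]) (simp_all add: F_def continuous_on_Pair cont)
    show "- ?a \<bullet> i \<le> ?a \<bullet> i" if "i \<in> Basis" for i
      using that pos unfolding basis by auto
  next
    fix x i :: "real \<times> real \<times> real \<times> real \<times> real \<times> real"
    obtain x1 x2 x3 x4 x5 x6 where x: "x = (x1, x2, x3, x4, x5, x6)" by (metis surj_pair)
    assume xb: "x \<in> cbox (- ?a) ?a" and i: "i \<in> Basis"
    note fc = faces[of x1 x2 x3 x4 x5 x6]
    show "F x \<bullet> i \<le> 0" if "x \<bullet> i = - ?a \<bullet> i"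
      using fc xb i that unfolding basis x box F_def
      by (elim insertE emptyE) simp_all
    show "F x \<bullet> i \<ge> 0" if "x \<bullet> i = ?a \<bullet> i"
      using fc xb i that unfolding basis x box F_def
      by (elim insertE emptyE) simp_all
  qed
  then obtain x where "x \<in> cbox (- ?a) ?a" "F x = 0" by blast
  moreover obtain x1 x2 x3 x4 x5 x6 where "x = (x1, x2, x3, x4, x5, x6)" by (metis surj_pair)
  ultimately show ?thesis
    unfolding F_def zero_prod_def Pair_inject using box by blast
qed

text \<open>The true right-hand side; it agrees with the continued field of the attracting half
  exactly where \<open>z \<le> 0\<close>.\<close>

definition cycle_field ::
  "(real \<times> real \<times> real \<Rightarrow> real) \<Rightarrow> (real \<times> real \<times> real \<Rightarrow> real) \<Rightarrow> real
     \<Rightarrow> real \<times> real \<times> real \<Rightarrow> real \<times> real \<times> real" where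
  "cycle_field f g \<epsilon> w = (f w, g w, (fst w + \<bar>snd (snd w)\<bar>) / \<epsilon>)"

lemma lipschitz_cycle_field:
  assumes "L-lipschitz_on UNIV f" "L-lipschitz_on UNIV g" "\<epsilon> > 0"
  shows "(2 * L + 2 / \<epsilon>)-lipschitz_on UNIV (cycle_field f g \<epsilon>)"
  using lipschitz_triple_field[OF assms(1,2) lipschitz_fast_component[of \<epsilon> abs, OF assms(3)]]
  by (simp add: cycle_field_def[abs_def] abs_triangle_ineq3)

text \<open>A smaller period \<open>P\<close> makes \<open>z\<close> vanish at time
  \<open>P\<close>, which confines \<open>P\<close> to distance less than \<kappa> from
  \<open>T\<close>. The shift by \<open>P\<close> then carries the time \<open>2 * \<kappa>\<close>,
  where \<open>z < 0\<close>, into the stretch where \<open>z > 0\<close>.\<close>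

lemma min_period_by_sign:
  fixes w :: "real \<Rightarrow> 'a" and z :: "'a \<Rightarrow> real"
  assumes \<kappa>: "\<kappa> > 0" "3 * \<kappa> \<le> T" "3 * \<kappa> \<le> T'"
    and per: "\<And>t. w (t + (T + T')) = w t"
    and z0: "z (w 0) = 0"
    and neg: "\<And>t. 0 < t \<Longrightarrow> t \<le> T - \<kappa> \<Longrightarrow> z (w t) < 0"
    and pos: "\<And>t. 0 < t \<Longrightarrow> t \<le> T' - \<kappa> \<Longrightarrow> z (w (- t)) > 0"
  shows "is_min_period w (T + T')"
  unfolding is_min_period_def
proof (intro conjI allI impI notI)
  show "is_period w (T + T')" using \<kappa> per by (simp add: is_period_def)
next
  fix P assume P: "0 < P \<and> P < T + T'" and perP: "is_period w P"
  have wP: "w (t + P) = w t" for t using perP by (simp add: is_period_def)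
  have "z (w P) = 0" using wP[of 0] z0 by simp
  then have "P > T - \<kappa>" using neg[of P] P by force
  have "z (w (- (T + T' - P))) = 0"
    using per[of "- (T + T' - P)"] \<open>z (w P) = 0\<close> by simp
  then have "T + T' - P > T' - \<kappa>" using pos[of "T + T' - P"] P by force
  have "z (w (2 * \<kappa>)) < 0" using neg[of "2 * \<kappa>"] \<kappa> by simp
  moreover have "w (2 * \<kappa>) = w (- (T + T' - P - 2 * \<kappa>))"
    using wP[of "2 * \<kappa>"] per[of "- (T + T' - P - 2 * \<kappa>)"] by (simp add: algebra_simps)
  moreover have "z (w (- (T + T' - P - 2 * \<kappa>))) > 0"
    using pos[of "T + T' - P - 2 * \<kappa>"] \<open>P > T - \<kappa>\<close> \<open>T + T' - P > T' - \<kappa>\<close> \<kappa> by simp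
  ultimately show False by simp
qed

text \<open>Time is reversed in the second instance, so \<sigma> and \<open>Tb\<close> are negative
  here: they stand for the negatives of the times on the repelling sheet. The reversal of
  \<open>y\<close> accounts for the minus sign in \<open>meet\<close>.\<close>

locale singular_cycle =
  a: slow_passage f g M L Ta \<tau> xa ya +
  b: slow_passage "\<lambda>(x, y, z). - f (x, - y, - z)" "\<lambda>(x, y, z). g (x, - y, - z)" M L Tb \<sigma> xb yb
  for f g M L Ta \<tau> xa ya Tb \<sigma> xb yb +
  assumes meet: "xb \<sigma> = xa \<tau>" "yb \<sigma> = - ya \<tau>"
    and transversal: "f (xa \<tau>, ya \<tau>, xa \<tau>) * g (xa \<tau>, ya \<tau>, - xa \<tau>)
        - f (xa \<tau>, ya \<tau>, - xa \<tau>) * g (xa \<tau>, ya \<tau>, xa \<tau>) \<noteq> 0"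
begin

text \<open>Six equations for the labels \<open>p\<close>, \<open>s\<close> and \<open>q\<close>, \<open>r\<close> of the two halves and for the times
  \<open>t = u + v\<close>, \<open>t' = v - u\<close> of their ends: the start points and the end points agree and lie on
  \<open>z = 0\<close>. On \<open>z = 0\<close> the equality of the \<open>x\<close>-coordinates of the ends is the equality of the lags
  \<open>x - z\<close>, which have opposite signs off \<open>y = 0\<close>; the multiple of \<open>u\<close> subtracted from their
  difference vanishes on \<open>z = 0\<close> and makes the sign uniform on the faces of the box.\<close>

lemma matching:
  assumes \<mu>: "\<mu> > 0"
  shows "\<exists>\<epsilon>0>0. \<forall>\<epsilon>. 0 < \<epsilon> \<and> \<epsilon> < \<epsilon>0 \<longrightarrow> (\<exists>p q s r t t'. \<bar>p\<bar> \<le> \<mu> \<and> \<bar>q\<bar> \<le> \<mu> \<and> \<bar>s\<bar> \<le> \<mu> \<and> \<bar>r\<bar> \<le> \<mu> \<and>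
      \<bar>t\<bar> \<le> \<mu> \<and> \<bar>t'\<bar> \<le> \<mu> \<and>
      fst (a.R p (\<tau> + s)) = fst (b.R q (\<sigma> + r)) \<and> snd (a.R p (\<tau> + s)) = - snd (b.R q (\<sigma> + r)) \<and>
      a.Z \<epsilon> p s (t - \<tau> - s) = 0 \<and> b.Z \<epsilon> q r (t' - \<sigma> - r) = 0 \<and>
      a.X \<epsilon> p s (t - \<tau> - s) = b.X \<epsilon> q r (t' - \<sigma> - r) \<and>
      a.Y \<epsilon> p s (t - \<tau> - s) = - b.Y \<epsilon> q r (t' - \<sigma> - r))"
proof -
  define fa ga fr gr where "fa = f (xa \<tau>, ya \<tau>, xa \<tau>)" and "ga = g (xa \<tau>, ya \<tau>, xa \<tau>)"
    and "fr = f (xa \<tau>, ya \<tau>, - xa \<tau>)" and "gr = g (xa \<tau>, ya \<tau>, - xa \<tau>)"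
  define A where "A = fa * gr - fr * ga"
  have A: "A \<noteq> 0" using transversal by (simp add: A_def fa_def ga_def fr_def gr_def)
  define B where "B = \<bar>fa\<bar> + \<bar>ga\<bar> + \<bar>fr\<bar> + \<bar>gr\<bar>"
  have B: "B \<ge> 0" by (simp add: B_def)
  obtain Ca where Ca: "Ca > 0" and Ca': "\<And>e. e > 0 \<Longrightarrow> \<exists>d>0. \<forall>p s. \<bar>s\<bar> \<le> d \<longrightarrow>
     \<bar>fst (a.R p (\<tau> + s)) - xa \<tau> - s * fa\<bar> \<le> Ca * \<bar>p\<bar> + e * \<bar>s\<bar> \<and>
     \<bar>snd (a.R p (\<tau> + s)) - ya \<tau> - s * ga\<bar> \<le> Ca * \<bar>p\<bar> + e * \<bar>s\<bar>"
    using a.start_expansion unfolding fa_def ga_def by (elim exE conjE) simp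
  obtain Cb where Cb: "Cb > 0" and Cb': "\<And>e. e > 0 \<Longrightarrow> \<exists>d>0. \<forall>p s. \<bar>s\<bar> \<le> d \<longrightarrow>
     \<bar>fst (b.R p (\<sigma> + s)) - xa \<tau> + s * fr\<bar> \<le> Cb * \<bar>p\<bar> + e * \<bar>s\<bar> \<and>
     \<bar>snd (b.R p (\<sigma> + s)) + ya \<tau> - s * gr\<bar> \<le> Cb * \<bar>p\<bar> + e * \<bar>s\<bar>"
    using b.start_expansion unfolding fr_def gr_def meet by (elim exE conjE) simp
  define C where "C = Ca + Cb"
  have C: "C > 0" using Ca Cb by (simp add: C_def)
  \<comment> \<open>The start equations are linear in \<open>(s, r)\<close> up to errors, with
    determinant \<open>A\<close>; Cramer's rule multiplies the errors by at most \<open>B\<close>.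
    The choice of \<open>e\<close> and of \<open>K\<close> below lets the errors from
    \<open>s\<close>, \<open>r\<close> and those from \<open>p\<close>, \<open>q\<close> each use up
    half of \<open>K * \<delta> * \<bar>A\<bar>\<close>.\<close>
  define e where "e = \<bar>A\<bar> / (4 * (B + 1))"
  have e: "e > 0" using A B by (simp add: e_def)
  have eB: "B * (2 * e) \<le> \<bar>A\<bar> / 2"
  proof -
    have "4 * (B + 1) * e = \<bar>A\<bar>" using B by (simp add: e_def)
    then show ?thesis using e by (simp add: algebra_simps)
  qed
  define K where "K = 4 * B * C / \<bar>A\<bar> + 1"
  have K: "K > 0" using B C A by (auto simp: K_def intro!: add_nonneg_pos)
  have KB: "B * (2 * C) \<le> K * \<bar>A\<bar> / 2"
    using A by (simp add: K_def field_simps)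
  obtain da where da: "da > 0" "\<And>p s. \<bar>s\<bar> \<le> da \<Longrightarrow>
     \<bar>fst (a.R p (\<tau> + s)) - xa \<tau> - s * fa\<bar> \<le> Ca * \<bar>p\<bar> + e * \<bar>s\<bar> \<and>
     \<bar>snd (a.R p (\<tau> + s)) - ya \<tau> - s * ga\<bar> \<le> Ca * \<bar>p\<bar> + e * \<bar>s\<bar>"
    using Ca'[OF e] by (elim exE conjE) simp
  obtain db where db: "db > 0" "\<And>p s. \<bar>s\<bar> \<le> db \<Longrightarrow>
     \<bar>fst (b.R p (\<sigma> + s)) - xa \<tau> + s * fr\<bar> \<le> Cb * \<bar>p\<bar> + e * \<bar>s\<bar> \<and>
     \<bar>snd (b.R p (\<sigma> + s)) + ya \<tau> - s * gr\<bar> \<le> Cb * \<bar>p\<bar> + e * \<bar>s\<bar>"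
    using Cb'[OF e] by (elim exE conjE) simp
  let ?small = "\<lambda>\<delta> p s t. \<bar>p\<bar> \<le> \<delta> \<and> \<bar>s\<bar> \<le> K * \<delta> \<and> \<bar>t\<bar> \<le> 2 * \<delta>"
  obtain \<delta>a where \<delta>a: "\<delta>a > 0" "\<forall>\<delta>. 0 < \<delta> \<and> \<delta> \<le> \<delta>a \<longrightarrow> (\<exists>\<epsilon>0>0. \<forall>\<epsilon> p s t.
      0 < \<epsilon> \<and> \<epsilon> < \<epsilon>0 \<and> ?small \<delta> p s t \<longrightarrow> a.end_near \<delta> \<epsilon> p s t)"
    using a.end_estimates[OF K] by (elim exE conjE) (rule that)
  obtain \<delta>b where \<delta>b: "\<delta>b > 0" "\<forall>\<delta>. 0 < \<delta> \<and> \<delta> \<le> \<delta>b \<longrightarrow> (\<exists>\<epsilon>0>0. \<forall>\<epsilon> p s t.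
      0 < \<epsilon> \<and> \<epsilon> < \<epsilon>0 \<and> ?small \<delta> p s t \<longrightarrow> b.end_near \<delta> \<epsilon> p s t)"
    using b.end_estimates[OF K] by (elim exE conjE) (rule that)
  define \<delta> where "\<delta> = Min {\<delta>a, \<delta>b, da / K, db / K, \<mu> / 2, \<mu> / K}"
  have \<delta>: "\<delta> > 0"
    unfolding \<delta>_def by (subst Min_gr_iff) (use \<delta>a(1) \<delta>b(1) da(1) db(1) K \<mu> in auto)
  have \<delta>le: "\<delta> \<le> \<delta>a" "\<delta> \<le> \<delta>b" "\<delta> \<le> da / K" "\<delta> \<le> db / K" "\<delta> \<le> \<mu> / 2" "\<delta> \<le> \<mu> / K"
    unfolding \<delta>_def by (rule Min_le; simp)+
  have K\<delta>: "K * \<delta> \<le> da" "K * \<delta> \<le> db" "K * \<delta> \<le> \<mu>"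
    using \<delta>le(3,4,6) K by (simp_all add: pos_le_divide_eq mult.commute)
  obtain \<epsilon>a where \<epsilon>a: "\<epsilon>a > 0" "\<forall>\<epsilon> p s t. 0 < \<epsilon> \<and> \<epsilon> < \<epsilon>a \<and> ?small \<delta> p s t \<longrightarrow> a.end_near \<delta> \<epsilon> p s t"
    using \<delta>a(2)[rule_format, OF conjI[OF \<delta> \<delta>le(1)]] by (elim exE conjE) (rule that)
  obtain \<epsilon>b where \<epsilon>b: "\<epsilon>b > 0" "\<forall>\<epsilon> p s t. 0 < \<epsilon> \<and> \<epsilon> < \<epsilon>b \<and> ?small \<delta> p s t \<longrightarrow> b.end_near \<delta> \<epsilon> p s t"
    using \<delta>b(2)[rule_format, OF conjI[OF \<delta> \<delta>le(2)]] by (elim exE conjE) (rule that)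
  have start_sign: "\<bar>e1\<bar> \<le> 2 * C * \<delta> + 2 * e * (K * \<delta>) \<Longrightarrow> \<bar>e2\<bar> \<le> 2 * C * \<delta> + 2 * e * (K * \<delta>) \<Longrightarrow>
      \<bar>c1\<bar> + \<bar>c2\<bar> \<le> B \<Longrightarrow> \<bar>A * (e1 * c1 - e2 * c2)\<bar> \<le> (K * \<delta>) * A\<^sup>2" for e1 e2 c1 c2
  proof -
    let ?E = "2 * C * \<delta> + 2 * e * (K * \<delta>)"
    assume e12: "\<bar>e1\<bar> \<le> ?E" "\<bar>e2\<bar> \<le> ?E" and c: "\<bar>c1\<bar> + \<bar>c2\<bar> \<le> B"
    have E: "?E \<ge> 0" using C \<delta> e K by simp
    have "\<bar>e1 * c1 - e2 * c2\<bar> \<le> \<bar>e1\<bar> * \<bar>c1\<bar> + \<bar>e2\<bar> * \<bar>c2\<bar>"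
      by (metis abs_mult abs_triangle_ineq4)
    also have "\<dots> \<le> ?E * \<bar>c1\<bar> + ?E * \<bar>c2\<bar>"
      using e12 by (intro add_mono mult_right_mono) auto
    also have "\<dots> = ?E * (\<bar>c1\<bar> + \<bar>c2\<bar>)" by (simp only: distrib_left)
    also have "\<dots> \<le> ?E * B" using c E by (intro mult_left_mono)
    also have "\<dots> = B * (2 * C) * \<delta> + B * (2 * e) * (K * \<delta>)" by (simp add: algebra_simps)
    also have "\<dots> \<le> (K * \<bar>A\<bar> / 2) * \<delta> + (\<bar>A\<bar> / 2) * (K * \<delta>)"
      using KB eB \<delta> K by (intro add_mono mult_right_mono) auto
    also have "\<dots> = (K * \<delta>) * \<bar>A\<bar>" by (simp add: algebra_simps)
    finally have "\<bar>A\<bar> * \<bar>e1 * c1 - e2 * c2\<bar> \<le> \<bar>A\<bar> * ((K * \<delta>) * \<bar>A\<bar>)"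
      by (intro mult_left_mono) auto
    then show ?thesis by (simp add: abs_mult power2_eq_square mult_ac)
  qed
  show ?thesis
  proof (rule exI[of _ "min \<epsilon>a \<epsilon>b"], rule conjI, goal_cases)
    case 1
    show "min \<epsilon>a \<epsilon>b > 0" using \<epsilon>a(1) \<epsilon>b(1) by simp
  next
    case 2
    show ?case
    proof (intro allI impI)
      fix \<epsilon> assume "0 < \<epsilon> \<and> \<epsilon> < min \<epsilon>a \<epsilon>b"
      then have \<epsilon>: "\<epsilon> > 0" "\<epsilon> < \<epsilon>a" "\<epsilon> < \<epsilon>b" by auto
      define P Q S R U V :: "real \<times> real \<times> real \<times> real \<times> real \<times> real \<Rightarrow> real"
        where "P = fst" and "Q = (\<lambda>x. fst (snd x))" and "S = (\<lambda>x. fst (snd (snd x)))"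
          and "R = (\<lambda>x. fst (snd (snd (snd x))))" and "U = (\<lambda>x. fst (snd (snd (snd (snd x)))))"
          and "V = (\<lambda>x. snd (snd (snd (snd (snd x)))))"
      have proj: "continuous_on UNIV P" "continuous_on UNIV Q" "continuous_on UNIV S"
        "continuous_on UNIV R" "continuous_on UNIV U" "continuous_on UNIV V"
        unfolding P_def Q_def S_def R_def U_def V_def by (intro continuous_intros)+
      have [simp]: "P (p, q, s, r, u, v) = p" "Q (p, q, s, r, u, v) = q" "S (p, q, s, r, u, v) = s"
        "R (p, q, s, r, u, v) = r" "U (p, q, s, r, u, v) = u" "V (p, q, s, r, u, v) = v" for p q s r u v
        by (simp_all add: P_def Q_def S_def R_def U_def V_def)
      define wa where "wa = (\<lambda>x. a.W \<epsilon> (P x) (S x) (U x + V x - \<tau> - S x))"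
      define wb where "wb = (\<lambda>x. b.W \<epsilon> (Q x) (R x) (V x - U x - \<sigma> - R x))"
      define ra where "ra = (\<lambda>x. a.R (P x) (\<tau> + S x))"
      define rb where "rb = (\<lambda>x. b.R (Q x) (\<sigma> + R x))"
      have cont: "continuous_on UNIV wa" "continuous_on UNIV wb" "continuous_on UNIV ra" "continuous_on UNIV rb"
        unfolding wa_def wb_def ra_def rb_def
        by (intro a.W_continuous b.W_continuous a.R_continuous b.R_continuous \<epsilon>(1) continuous_intros proj)+
      define dx where "dx = (\<lambda>x. fst (ra x) - fst (rb x))"
      define dy where "dy = (\<lambda>x. snd (ra x) + snd (rb x))"
      define za where "za = (\<lambda>x. snd (snd (wa x)))"
      define zb where "zb = (\<lambda>x. snd (snd (wb x)))"
      have cont': "continuous_on UNIV dx" "continuous_on UNIV dy" "continuous_on UNIV za"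
        "continuous_on UNIV zb"
        unfolding dx_def dy_def za_def zb_def by (intro continuous_intros cont)+
      \<comment> \<open>The difference of the lags is positive for negative \<open>u\<close> and
        negative for positive \<open>u\<close>, up to the terms in \<open>\<bar>Z\<bar>\<close>; the
        leading minus orients it. At \<open>\<bar>U x\<bar> = \<delta>\<close> the subtracted
        multiple of \<open>U x\<close> cancels precisely the terms
        \<open>2 * L * \<bar>Z\<bar>\<close> of \<open>end_near\<close>.\<close>
      define F5 where "F5 = (\<lambda>x. - ((fst (wa x) - za x) / \<epsilon> - (fst (wb x) - zb x) / \<epsilon>
          - 2 * L * (U x / \<delta>) * (\<bar>za x\<bar> + \<bar>zb x\<bar>)))"
      \<comment> \<open>The bound \<open>\<delta> / 4\<close> on \<open>v\<close> ensures that at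
        \<open>\<bar>u\<bar> = \<delta>\<close> the times \<open>u + v\<close> and
        \<open>v - u\<close> lie on opposite sides of 0, each at distance at least
        \<open>3 / 4 * \<delta>\<close>.\<close>
      have "\<exists>p q s r u v. \<bar>p\<bar> \<le> \<delta> \<and> \<bar>q\<bar> \<le> \<delta> \<and> \<bar>s\<bar> \<le> K * \<delta> \<and> \<bar>r\<bar> \<le> K * \<delta> \<and> \<bar>u\<bar> \<le> \<delta> \<and> \<bar>v\<bar> \<le> \<delta> / 4 \<and>
        za (p, q, s, r, u, v) = 0 \<and> zb (p, q, s, r, u, v) = 0 \<and>
        (\<lambda>x. A * (dx x * gr - dy x * fr)) (p, q, s, r, u, v) = 0 \<and>
        (\<lambda>x. A * (dy x * fa - dx x * ga)) (p, q, s, r, u, v) = 0 \<and>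
        F5 (p, q, s, r, u, v) = 0 \<and>
        (\<lambda>x. fst (snd (wa x)) + fst (snd (wb x))) (p, q, s, r, u, v) = 0"
      proof (rule poincare_miranda_6)
        show "continuous_on UNIV F5"
          unfolding F5_def by (intro continuous_intros cont cont' proj) (use \<epsilon> \<delta> in auto)
        fix p q s r u v :: real
        let ?x = "(p, q, s, r, u, v)"
        assume bd: "\<bar>p\<bar> \<le> \<delta>" "\<bar>q\<bar> \<le> \<delta>" "\<bar>s\<bar> \<le> K * \<delta>" "\<bar>r\<bar> \<le> K * \<delta>" "\<bar>u\<bar> \<le> \<delta>" "\<bar>v\<bar> \<le> \<delta> / 4"
        have t: "\<bar>u + v\<bar> \<le> 2 * \<delta>" "\<bar>v - u\<bar> \<le> 2 * \<delta>" using bd by linarith+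
        have W: "wa ?x = a.W \<epsilon> p s (u + v - \<tau> - s)" "wb ?x = b.W \<epsilon> q r (v - u - \<sigma> - r)"
          by (simp_all add: wa_def wb_def)
        have ea: "\<bar>za ?x - p\<bar> \<le> \<delta> / 2"
            "\<bar>fst (snd (wa ?x)) - g (0, 0, 0) * (u + v)\<bar> \<le> g (0, 0, 0) * \<delta> / 8"
            "3 / 4 * \<delta> \<le> u + v \<Longrightarrow> (fst (wa ?x) - za ?x) / \<epsilon> \<le> 2 * L * \<bar>za ?x\<bar>"
            "u + v \<le> - 3 / 4 * \<delta> \<Longrightarrow> (fst (wa ?x) - za ?x) / \<epsilon> \<ge> - 2 * L * \<bar>za ?x\<bar>"
          using \<epsilon>a(2)[rule_format, of \<epsilon> p s "u + v"] \<epsilon> bd t unfolding za_def W a.end_near_def by blast+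
        have eb: "\<bar>zb ?x - q\<bar> \<le> \<delta> / 2"
            "\<bar>fst (snd (wb ?x)) - g (0, 0, 0) * (v - u)\<bar> \<le> g (0, 0, 0) * \<delta> / 8"
            "3 / 4 * \<delta> \<le> v - u \<Longrightarrow> (fst (wb ?x) - zb ?x) / \<epsilon> \<le> 2 * L * \<bar>zb ?x\<bar>"
            "v - u \<le> - 3 / 4 * \<delta> \<Longrightarrow> (fst (wb ?x) - zb ?x) / \<epsilon> \<ge> - 2 * L * \<bar>zb ?x\<bar>"
          using \<epsilon>b(2)[rule_format, of \<epsilon> q r "v - u"] \<epsilon> bd t
          unfolding zb_def W b.end_near_def prod.case minus_zero by blast+
        define e1 where "e1 = dx ?x - s * fa - r * fr"
        define e2 where "e2 = dy ?x - s * ga - r * gr"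
        have e12: "\<bar>e1\<bar> \<le> 2 * C * \<delta> + 2 * e * (K * \<delta>)" "\<bar>e2\<bar> \<le> 2 * C * \<delta> + 2 * e * (K * \<delta>)"
        proof -
          have Cbd: "Ca * \<bar>p\<bar> \<le> Ca * \<delta>" "Cb * \<bar>q\<bar> \<le> Cb * \<delta>" "e * \<bar>s\<bar> \<le> e * (K * \<delta>)" "e * \<bar>r\<bar> \<le> e * (K * \<delta>)"
            using bd Ca Cb e by (auto intro!: mult_left_mono)
          have "Ca * \<delta> > 0" "Cb * \<delta> > 0" using Ca Cb \<delta> by simp_all
          moreover have sum: "\<bar>x\<bar> \<le> k \<Longrightarrow> \<bar>y\<bar> \<le> l \<Longrightarrow> \<bar>x - y\<bar> \<le> k + l \<and> \<bar>x + y\<bar> \<le> k + l" for x y k l :: real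
            by linarith
          have eq: "e1 = (fst (a.R p (\<tau> + s)) - xa \<tau> - s * fa) - (fst (b.R q (\<sigma> + r)) - xa \<tau> + r * fr)"
            "e2 = (snd (a.R p (\<tau> + s)) - ya \<tau> - s * ga) + (snd (b.R q (\<sigma> + r)) + ya \<tau> - r * gr)"
            by (simp_all add: e1_def e2_def dx_def dy_def ra_def rb_def)
          have sr: "\<bar>s\<bar> \<le> da" "\<bar>r\<bar> \<le> db" using bd K\<delta> by linarith+
          have "\<bar>e1\<bar> \<le> (Ca * \<bar>p\<bar> + e * \<bar>s\<bar>) + (Cb * \<bar>q\<bar> + e * \<bar>r\<bar>)"
            "\<bar>e2\<bar> \<le> (Ca * \<bar>p\<bar> + e * \<bar>s\<bar>) + (Cb * \<bar>q\<bar> + e * \<bar>r\<bar>)"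
            unfolding eq using sum da(2)[OF sr(1), of p] db(2)[OF sr(2), of q] by blast+
          moreover have "2 * C * \<delta> + 2 * e * (K * \<delta>) = 2 * (Ca * \<delta>) + 2 * (Cb * \<delta>) + 2 * (e * (K * \<delta>))"
            by (simp add: C_def algebra_simps)
          ultimately show "\<bar>e1\<bar> \<le> 2 * C * \<delta> + 2 * e * (K * \<delta>)" "\<bar>e2\<bar> \<le> 2 * C * \<delta> + 2 * e * (K * \<delta>)"
            using Cbd by linarith+
        qed
        \<comment> \<open>Cramer's rule eliminates \<open>r\<close> and leaves \<open>A * s\<close>
          plus errors; the further factor \<open>A\<close> makes the coefficient of \<open>s\<close>
          positive whatever the sign of \<open>A\<close>.\<close>
        have s3: "\<bar>A * (dx ?x * gr - dy ?x * fr) - s * A\<^sup>2\<bar> \<le> (K * \<delta>) * A\<^sup>2"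
        proof -
          have "A * (dx ?x * gr - dy ?x * fr) - s * A\<^sup>2 = A * (e1 * gr - e2 * fr)"
            by (simp add: e1_def e2_def A_def power2_eq_square algebra_simps)
          then show ?thesis using start_sign[OF e12, of gr fr] by (simp add: B_def)
        qed
        have s4: "\<bar>A * (dy ?x * fa - dx ?x * ga) - r * A\<^sup>2\<bar> \<le> (K * \<delta>) * A\<^sup>2"
        proof -
          have "A * (dy ?x * fa - dx ?x * ga) - r * A\<^sup>2 = A * (e2 * fa - e1 * ga)"
            by (simp add: e1_def e2_def A_def power2_eq_square algebra_simps)
          then show ?thesis using start_sign[OF e12(2,1), of fa ga] by (simp add: B_def)
        qed
        have G: "g (0, 0, 0) * \<delta> > 0" using a.g0 \<delta> by simp
        have c1: "p = \<delta> \<Longrightarrow> za ?x \<ge> 0" "p = - \<delta> \<Longrightarrow> za ?x \<le> 0" using ea(1) \<delta> by linarith+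
        have c2: "q = \<delta> \<Longrightarrow> zb ?x \<ge> 0" "q = - \<delta> \<Longrightarrow> zb ?x \<le> 0" using eb(1) \<delta> by linarith+
        have c3: "s = K * \<delta> \<Longrightarrow> A * (dx ?x * gr - dy ?x * fr) \<ge> 0"
          "s = - (K * \<delta>) \<Longrightarrow> A * (dx ?x * gr - dy ?x * fr) \<le> 0"
          using s3 by (simp_all add: abs_le_iff)
        have c4: "r = K * \<delta> \<Longrightarrow> A * (dy ?x * fa - dx ?x * ga) \<ge> 0"
          "r = - (K * \<delta>) \<Longrightarrow> A * (dy ?x * fa - dx ?x * ga) \<le> 0"
          using s4 by (simp_all add: abs_le_iff)
        have c5: "F5 ?x \<ge> 0" if "u = \<delta>"
        proof -
          have h: "3 / 4 * \<delta> \<le> u + v" "v - u \<le> - 3 / 4 * \<delta>" using that bd(6) by linarith+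
          have "U ?x / \<delta> = 1" using that \<delta> by simp
          then show ?thesis
            using ea(3)[OF h(1)] eb(4)[OF h(2)] unfolding F5_def by (simp only: mult_1_right distrib_left)
        qed
        have c5': "F5 ?x \<le> 0" if "u = - \<delta>"
        proof -
          have h: "u + v \<le> - 3 / 4 * \<delta>" "3 / 4 * \<delta> \<le> v - u" using that bd(6) by linarith+
          have "U ?x / \<delta> = - 1" using that \<delta> by simp
          then show ?thesis
            using ea(4)[OF h(1)] eb(3)[OF h(2)] unfolding F5_def by (simp only: mult_minus1_right distrib_left)
        qed
        \<comment> \<open>The two ordinates add up to \<open>2 * G0 * v\<close> with an error of at
          most \<open>G0 * \<delta> / 4\<close>, where \<open>G0\<close> is
          \<open>g (0, 0, 0)\<close>; the faces \<open>\<bar>v\<bar> = \<delta> / 4\<close> give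
          twice that amount.\<close>
        have c6: "v = \<delta> / 4 \<Longrightarrow> fst (snd (wa ?x)) + fst (snd (wb ?x)) \<ge> 0"
          "v = - (\<delta> / 4) \<Longrightarrow> fst (snd (wa ?x)) + fst (snd (wb ?x)) \<le> 0"
        proof -
          have sum: "g (0, 0, 0) * (u + v) + g (0, 0, 0) * (v - u) = 2 * (g (0, 0, 0) * v)"
            by (simp add: algebra_simps)
          show "fst (snd (wa ?x)) + fst (snd (wb ?x)) \<ge> 0" if "v = \<delta> / 4"
          proof -
            have "g (0, 0, 0) * v = g (0, 0, 0) * \<delta> / 4" using that by simp
            then show ?thesis using ea(2) eb(2) G sum unfolding abs_le_iff by linarith
          qed
          show "fst (snd (wa ?x)) + fst (snd (wb ?x)) \<le> 0" if "v = - (\<delta> / 4)"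
          proof -
            have "g (0, 0, 0) * v = - (g (0, 0, 0) * \<delta> / 4)" using that by simp
            then show ?thesis using ea(2) eb(2) G sum unfolding abs_le_iff by linarith
          qed
        qed
        show "(p = \<delta> \<longrightarrow> za ?x \<ge> 0) \<and> (p = - \<delta> \<longrightarrow> za ?x \<le> 0) \<and>
            (q = \<delta> \<longrightarrow> zb ?x \<ge> 0) \<and> (q = - \<delta> \<longrightarrow> zb ?x \<le> 0) \<and>
            (s = K * \<delta> \<longrightarrow> A * (dx ?x * gr - dy ?x * fr) \<ge> 0) \<and>
            (s = - (K * \<delta>) \<longrightarrow> A * (dx ?x * gr - dy ?x * fr) \<le> 0) \<and>
            (r = K * \<delta> \<longrightarrow> A * (dy ?x * fa - dx ?x * ga) \<ge> 0) \<and>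
            (r = - (K * \<delta>) \<longrightarrow> A * (dy ?x * fa - dx ?x * ga) \<le> 0) \<and>
            (u = \<delta> \<longrightarrow> F5 ?x \<ge> 0) \<and> (u = - \<delta> \<longrightarrow> F5 ?x \<le> 0) \<and>
            (v = \<delta> / 4 \<longrightarrow> fst (snd (wa ?x)) + fst (snd (wb ?x)) \<ge> 0) \<and>
            (v = - (\<delta> / 4) \<longrightarrow> fst (snd (wa ?x)) + fst (snd (wb ?x)) \<le> 0)"
          by (intro conjI impI c1 c2 c3 c4 c5 c5' c6)
      qed (use \<delta> K in \<open>auto intro!: continuous_intros cont cont'\<close>)
      then obtain p q s r u v where bd: "\<bar>p\<bar> \<le> \<delta>" "\<bar>q\<bar> \<le> \<delta>" "\<bar>s\<bar> \<le> K * \<delta>" "\<bar>r\<bar> \<le> K * \<delta>"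
          "\<bar>u\<bar> \<le> \<delta>" "\<bar>v\<bar> \<le> \<delta> / 4"
        and 1: "za (p, q, s, r, u, v) = 0" and 2: "zb (p, q, s, r, u, v) = 0"
        and 3: "A * (dx (p, q, s, r, u, v) * gr - dy (p, q, s, r, u, v) * fr) = 0"
        and 4: "A * (dy (p, q, s, r, u, v) * fa - dx (p, q, s, r, u, v) * ga) = 0"
        and 5: "F5 (p, q, s, r, u, v) = 0"
        and 6: "fst (snd (wa (p, q, s, r, u, v))) + fst (snd (wb (p, q, s, r, u, v))) = 0"
        by (elim exE conjE)
      let ?x = "(p, q, s, r, u, v)"
      have e3: "dx ?x * gr = dy ?x * fr" and e4: "dy ?x * fa = dx ?x * ga" using 3 4 A by auto
      have "dx ?x * A = fa * (dx ?x * gr) - fr * (dx ?x * ga)" by (simp add: A_def algebra_simps)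
      also have "\<dots> = 0" unfolding e3 e4[symmetric] by (simp add: algebra_simps)
      finally have dx0: "dx ?x = 0" using A by simp
      have "dy ?x * A = gr * (dy ?x * fa) - ga * (dy ?x * fr)" by (simp add: A_def algebra_simps)
      also have "\<dots> = 0" unfolding e3[symmetric] e4 by (simp add: algebra_simps)
      finally have dy0: "dy ?x = 0" using A by simp
      have X: "fst (wa ?x) = fst (wb ?x)"
        using 5 \<epsilon>(1) by (simp add: F5_def 1 2)
      show "\<exists>p q s r t t'. \<bar>p\<bar> \<le> \<mu> \<and> \<bar>q\<bar> \<le> \<mu> \<and> \<bar>s\<bar> \<le> \<mu> \<and> \<bar>r\<bar> \<le> \<mu> \<and> \<bar>t\<bar> \<le> \<mu> \<and> \<bar>t'\<bar> \<le> \<mu> \<and>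
        fst (a.R p (\<tau> + s)) = fst (b.R q (\<sigma> + r)) \<and> snd (a.R p (\<tau> + s)) = - snd (b.R q (\<sigma> + r)) \<and>
        a.Z \<epsilon> p s (t - \<tau> - s) = 0 \<and> b.Z \<epsilon> q r (t' - \<sigma> - r) = 0 \<and>
        a.X \<epsilon> p s (t - \<tau> - s) = b.X \<epsilon> q r (t' - \<sigma> - r) \<and>
        a.Y \<epsilon> p s (t - \<tau> - s) = - b.Y \<epsilon> q r (t' - \<sigma> - r)"
      proof (rule exI[of _ p], rule exI[of _ q], rule exI[of _ s], rule exI[of _ r],
          rule exI[of _ "u + v"], rule exI[of _ "v - u"], intro conjI)
        show "\<bar>p\<bar> \<le> \<mu>" "\<bar>q\<bar> \<le> \<mu>" "\<bar>s\<bar> \<le> \<mu>" "\<bar>r\<bar> \<le> \<mu>" "\<bar>u + v\<bar> \<le> \<mu>" "\<bar>v - u\<bar> \<le> \<mu>"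
          using bd K\<delta>(3) \<delta>le(5) \<delta> by linarith+
        show "fst (a.R p (\<tau> + s)) = fst (b.R q (\<sigma> + r))" "snd (a.R p (\<tau> + s)) = - snd (b.R q (\<sigma> + r))"
          using dx0 dy0 by (simp_all add: dx_def dy_def ra_def rb_def)
        show "a.Z \<epsilon> p s (u + v - \<tau> - s) = 0" using 1 by (simp add: za_def wa_def)
        show "b.Z \<epsilon> q r (v - u - \<sigma> - r) = 0" using 2 by (simp add: zb_def wb_def)
        show "a.X \<epsilon> p s (u + v - \<tau> - s) = b.X \<epsilon> q r (v - u - \<sigma> - r)"
          using X by (simp add: wa_def wb_def)
        show "a.Y \<epsilon> p s (u + v - \<tau> - s) = - b.Y \<epsilon> q r (v - u - \<sigma> - r)"
          using 6 by (simp add: wa_def wb_def)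
      qed
    qed
  qed
qed

text \<open>Where the continued \<open>z\<close> of either half is nonpositive, the forward half and
  the reflected backward half solve the true system. Uniqueness identifies both with one orbit
  through the common start point, and the common end point makes it return after
  \<open>T + T'\<close>.\<close>

lemma periodic_orbit:
  assumes \<epsilon>: "\<epsilon> > 0" and \<kappa>: "\<kappa> > 0" "3 * \<kappa> \<le> T" "3 * \<kappa> \<le> T'"
    and start: "fst (a.R p (\<tau> + s)) = fst (b.R q (\<sigma> + r))" "snd (a.R p (\<tau> + s)) = - snd (b.R q (\<sigma> + r))"
    and finish: "a.Z \<epsilon> p s T = 0" "b.Z \<epsilon> q r T' = 0" "a.X \<epsilon> p s T = b.X \<epsilon> q r T'"
      "a.Y \<epsilon> p s T = - b.Y \<epsilon> q r T'"
    and za: "\<And>\<theta>. 0 \<le> \<theta> \<Longrightarrow> \<theta> \<le> T \<Longrightarrow> a.Z \<epsilon> p s \<theta> \<le> 0"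
    and zb: "\<And>\<theta>. 0 \<le> \<theta> \<Longrightarrow> \<theta> \<le> T' \<Longrightarrow> b.Z \<epsilon> q r \<theta> \<le> 0"
    and za': "\<And>\<theta>. 0 < \<theta> \<Longrightarrow> \<theta> \<le> T - \<kappa> \<Longrightarrow> a.Z \<epsilon> p s \<theta> < 0"
    and zb': "\<And>\<theta>. 0 < \<theta> \<Longrightarrow> \<theta> \<le> T' - \<kappa> \<Longrightarrow> b.Z \<epsilon> q r \<theta> < 0"
  shows "\<exists>w. is_solution f g \<epsilon> w \<and> is_min_period w (T + T')"
proof -
  let ?H = "cycle_field f g \<epsilon>"
  note lip = lipschitz_cycle_field[OF a.lipf a.lipg \<epsilon>]
  define w where "w = flow ?H (fst (a.R p (\<tau> + s)), snd (a.R p (\<tau> + s)), 0)"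
  have w0: "w 0 = (fst (a.R p (\<tau> + s)), snd (a.R p (\<tau> + s)), 0)"
    unfolding w_def by (rule flow_0[OF lip])
  have dw: "(w has_vector_derivative ?H (w t)) (at t)" for t
    unfolding w_def by (rule flow_deriv[OF lip])
  have wa: "w \<theta> = a.W \<epsilon> p s \<theta>" if \<theta>: "0 \<le> \<theta>" "\<theta> \<le> T" for \<theta>
  proof -
    have "(a.W \<epsilon> p s has_vector_derivative ?H (a.W \<epsilon> p s t)) (at t)" if "0 \<le> t" "t \<le> \<theta>" for t
    proof -
      have "a.full_field \<epsilon> (a.W \<epsilon> p s t) = ?H (a.W \<epsilon> p s t)"
        using za[of t] that \<theta> by (simp add: a.full_field_def cycle_field_def)
      then show ?thesis using a.W_deriv[OF \<epsilon>, of p s t] by simp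
    qed
    then show ?thesis
      using ode_unique[OF lip \<theta>(1) dw, of "a.W \<epsilon> p s"] w0 a.W_0[OF \<epsilon>] by simp
  qed
  define wb where "wb = (\<lambda>t. (b.X \<epsilon> q r (- t), - b.Y \<epsilon> q r (- t), - b.Z \<epsilon> q r (- t)))"
  have wb: "w (- \<theta>) = wb (- \<theta>)" if \<theta>: "0 \<le> \<theta>" "\<theta> \<le> T'" for \<theta>
  proof -
    have refl: "((\<lambda>t. u (- t)) has_vector_derivative - d) (at t)"
      if "(u has_real_derivative d) (at (- t))" for u d t
      using has_vector_derivative_reflect[of u d 0 t] that
      by (simp add: has_real_derivative_iff_has_vector_derivative)
    have "(wb has_vector_derivative ?H (wb t)) (at t)" if t: "- \<theta> \<le> t" "t \<le> 0" for t
    proof -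
      let ?w = "b.W \<epsilon> q r (- t)"
      have "(wb has_vector_derivative (- (case ?w of (x, y, z) \<Rightarrow> - f (x, - y, - z)),
          - (- (case ?w of (x, y, z) \<Rightarrow> g (x, - y, - z))), - (- ((fst ?w - snd (snd ?w)) / \<epsilon>)))) (at t)"
        unfolding wb_def
        by (intro has_vector_derivative_Pair has_vector_derivative_minus refl
            b.X_deriv[OF \<epsilon>] b.Y_deriv[OF \<epsilon>] b.Z_deriv[OF \<epsilon>])
      moreover have "b.Z \<epsilon> q r (- t) \<le> 0" using zb[of "- t"] t \<theta> by simp
      ultimately show ?thesis
        by (simp add: cycle_field_def wb_def case_prod_beta)
    qed
    moreover have "w 0 = wb 0" using w0 start by (simp add: wb_def b.W_0[OF \<epsilon>])
    ultimately show ?thesis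
      using ode_unique[OF lip _ dw, of "- \<theta>" 0 wb] \<theta> by simp
  qed
  have T: "T > 0" "T' > 0" using \<kappa> by linarith+
  have "w T = w (- T')"
    using wa[of T] wb[of T'] T finish by (simp add: wb_def prod_eq_iff)
  have per: "w (t + (T + T')) = w t" for t
  proof (rule ode_unique_global[OF lip, where c = "- T'" and u = "\<lambda>t. w (t + (T + T'))" and v = w])
    show "((\<lambda>t. w (t + (T + T'))) has_vector_derivative ?H (w (t + (T + T')))) (at t)" for t
      by (rule has_vector_derivative_shift[OF dw])
  qed (use dw \<open>w T = w (- T')\<close> in simp_all)
  have "is_min_period w (T + T')"
  proof (rule min_period_by_sign[where w = w and z = "\<lambda>w. snd (snd w)" and \<kappa> = \<kappa>, OF \<kappa> per])
    show "snd (snd (w t)) < 0" if "0 < t" "t \<le> T - \<kappa>" for t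
      using wa[of t] za'[of t] that \<kappa> by simp
    show "snd (snd (w (- t))) > 0" if "0 < t" "t \<le> T' - \<kappa>" for t
      using wb[of t] zb'[of t] that \<kappa> by (simp add: wb_def)
  qed (simp add: w0)
  moreover have "is_solution f g \<epsilon> w"
    using dw by (simp add: is_solution_def cycle_field_def)
  ultimately show ?thesis by blast
qed

lemma near_periodic_orbit:
  assumes \<mu>: "\<mu> > 0"
  shows "\<exists>\<epsilon>0>0. \<forall>\<epsilon>. 0 < \<epsilon> \<and> \<epsilon> < \<epsilon>0 \<longrightarrow>
      (\<exists>w T. is_solution f g \<epsilon> w \<and> is_min_period w T \<and> \<bar>T - (- \<tau> - \<sigma>)\<bar> \<le> \<mu>)"
proof -
  \<comment> \<open>The end times differ from \<open>- \<tau>\<close> and \<open>- \<sigma>\<close>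
    by at most \<open>2 * \<nu> \<le> 2 * \<kappa>\<close>; the factor 6 leaves the
    \<open>3 * \<kappa>\<close> required for minimality of the period.\<close>
  define \<kappa> where "\<kappa> = min (- \<tau> / 6) (- \<sigma> / 6)"
  have \<kappa>: "\<kappa> > 0" "6 * \<kappa> \<le> - \<tau>" "6 * \<kappa> \<le> - \<sigma>" using a.\<tau> b.\<tau> by (auto simp: \<kappa>_def)
  let ?signs = "\<lambda>X Y Z \<tau> \<epsilon> p s T. (\<forall>\<theta>. 0 < \<theta> \<and> \<theta> \<le> T - \<kappa> \<longrightarrow> Z \<epsilon> p s \<theta> < 0) \<and>
        (Y \<epsilon> p s T \<le> 0 \<or> X \<epsilon> p s T > 0 \<longrightarrow> (\<forall>\<theta>. 0 \<le> \<theta> \<and> \<theta> \<le> T \<longrightarrow> Z \<epsilon> p s \<theta> \<le> 0)) \<and>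
        (Y \<epsilon> p s T < 0 \<longrightarrow> X \<epsilon> p s T > 0)"
  obtain \<delta>a \<epsilon>a where a: "\<delta>a > 0" "\<epsilon>a > 0" "\<forall>\<epsilon> p s T. 0 < \<epsilon> \<and> \<epsilon> < \<epsilon>a \<and> \<bar>p\<bar> \<le> \<delta>a \<and> \<bar>s\<bar> \<le> \<delta>a \<and>
      \<bar>T + \<tau> + s\<bar> \<le> \<delta>a \<and> a.Z \<epsilon> p s T = 0 \<longrightarrow> ?signs a.X a.Y a.Z \<tau> \<epsilon> p s T"
    using a.end_signs[OF \<kappa>(1)] by (elim exE conjE) (rule that)
  obtain \<delta>b \<epsilon>b where b: "\<delta>b > 0" "\<epsilon>b > 0" "\<forall>\<epsilon> p s T. 0 < \<epsilon> \<and> \<epsilon> < \<epsilon>b \<and> \<bar>p\<bar> \<le> \<delta>b \<and> \<bar>s\<bar> \<le> \<delta>b \<and>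
      \<bar>T + \<sigma> + s\<bar> \<le> \<delta>b \<and> b.Z \<epsilon> p s T = 0 \<longrightarrow> ?signs b.X b.Y b.Z \<sigma> \<epsilon> p s T"
    using b.end_signs[OF \<kappa>(1)] by (elim exE conjE) (rule that)
  \<comment> \<open>The total period carries four errors \<open>t\<close>, \<open>s\<close>,
    \<open>t'\<close>, \<open>r\<close>, whence \<open>\<mu> / 4\<close>.\<close>
  define \<nu> where "\<nu> = Min {\<delta>a, \<delta>b, \<kappa>, \<mu> / 4}"
  have \<nu>: "\<nu> > 0" unfolding \<nu>_def by (subst Min_gr_iff) (use a(1) b(1) \<kappa>(1) \<mu> in auto)
  have \<nu>le: "\<nu> \<le> \<delta>a" "\<nu> \<le> \<delta>b" "\<nu> \<le> \<kappa>" "\<nu> \<le> \<mu> / 4"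
    unfolding \<nu>_def by (rule Min_le; simp)+
  obtain \<epsilon>m where m: "\<epsilon>m > 0" "\<forall>\<epsilon>. 0 < \<epsilon> \<and> \<epsilon> < \<epsilon>m \<longrightarrow> (\<exists>p q s r t t'. \<bar>p\<bar> \<le> \<nu> \<and> \<bar>q\<bar> \<le> \<nu> \<and> \<bar>s\<bar> \<le> \<nu> \<and> \<bar>r\<bar> \<le> \<nu> \<and>
      \<bar>t\<bar> \<le> \<nu> \<and> \<bar>t'\<bar> \<le> \<nu> \<and>
      fst (a.R p (\<tau> + s)) = fst (b.R q (\<sigma> + r)) \<and> snd (a.R p (\<tau> + s)) = - snd (b.R q (\<sigma> + r)) \<and>
      a.Z \<epsilon> p s (t - \<tau> - s) = 0 \<and> b.Z \<epsilon> q r (t' - \<sigma> - r) = 0 \<and>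
      a.X \<epsilon> p s (t - \<tau> - s) = b.X \<epsilon> q r (t' - \<sigma> - r) \<and>
      a.Y \<epsilon> p s (t - \<tau> - s) = - b.Y \<epsilon> q r (t' - \<sigma> - r))"
    using matching[OF \<nu>] by (rule exE) (elim conjE, rule that)
  define \<epsilon>0 where "\<epsilon>0 = min \<epsilon>m (min \<epsilon>a \<epsilon>b)"
  have \<epsilon>0: "\<epsilon>0 > 0" using a b m by (simp add: \<epsilon>0_def)
  show ?thesis
  proof (rule exI[of _ \<epsilon>0], rule conjI[OF \<epsilon>0], intro allI impI)
    fix \<epsilon> assume "0 < \<epsilon> \<and> \<epsilon> < \<epsilon>0"
    then have \<epsilon>: "0 < \<epsilon>" "\<epsilon> < \<epsilon>m" "\<epsilon> < \<epsilon>a" "\<epsilon> < \<epsilon>b" by (auto simp: \<epsilon>0_def)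
    obtain p q s r t t' where bd: "\<bar>p\<bar> \<le> \<nu>" "\<bar>q\<bar> \<le> \<nu>" "\<bar>s\<bar> \<le> \<nu>" "\<bar>r\<bar> \<le> \<nu>" "\<bar>t\<bar> \<le> \<nu>" "\<bar>t'\<bar> \<le> \<nu>"
      and start: "fst (a.R p (\<tau> + s)) = fst (b.R q (\<sigma> + r))" "snd (a.R p (\<tau> + s)) = - snd (b.R q (\<sigma> + r))"
      and finish: "a.Z \<epsilon> p s (t - \<tau> - s) = 0" "b.Z \<epsilon> q r (t' - \<sigma> - r) = 0"
      "a.X \<epsilon> p s (t - \<tau> - s) = b.X \<epsilon> q r (t' - \<sigma> - r)"
      "a.Y \<epsilon> p s (t - \<tau> - s) = - b.Y \<epsilon> q r (t' - \<sigma> - r)"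
      using m(2)[THEN spec, THEN mp, OF conjI[OF \<epsilon>(1,2)]] by (elim exE conjE)
    define T T' where "T = t - \<tau> - s" and "T' = t' - \<sigma> - r"
    note fin = finish[folded T_def T'_def]
    have sa: "?signs a.X a.Y a.Z \<tau> \<epsilon> p s T"
    proof (rule a(3)[THEN spec, THEN spec, THEN spec, THEN spec, THEN mp], intro conjI)
      show "\<bar>p\<bar> \<le> \<delta>a" "\<bar>s\<bar> \<le> \<delta>a" "\<bar>T + \<tau> + s\<bar> \<le> \<delta>a"
        using bd \<nu>le by (simp_all add: T_def)
    qed (fact \<epsilon> fin)+
    have sb: "?signs b.X b.Y b.Z \<sigma> \<epsilon> q r T'"
    proof (rule b(3)[THEN spec, THEN spec, THEN spec, THEN spec, THEN mp], intro conjI)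
      show "\<bar>q\<bar> \<le> \<delta>b" "\<bar>r\<bar> \<le> \<delta>b" "\<bar>T' + \<sigma> + r\<bar> \<le> \<delta>b"
        using bd \<nu>le by (simp_all add: T'_def)
    qed (fact \<epsilon> fin)+
    \<comment> \<open>The end ordinates are opposite. If they vanish, each half is settled by its
      own ordinate; otherwise the half that ends with negative ordinate has \<open>X > 0\<close>,
      and this shared abscissa settles the half that ends beyond the fold line.\<close>
    have nonpos: "(\<forall>\<theta>. 0 \<le> \<theta> \<and> \<theta> \<le> T \<longrightarrow> a.Z \<epsilon> p s \<theta> \<le> 0) \<and> (\<forall>\<theta>. 0 \<le> \<theta> \<and> \<theta> \<le> T' \<longrightarrow> b.Z \<epsilon> q r \<theta> \<le> 0)"
    proof -
      consider "a.Y \<epsilon> p s T < 0" | "a.Y \<epsilon> p s T = 0" | "a.Y \<epsilon> p s T > 0" by linarith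
      then show ?thesis
      proof cases
        case 1
        then have "a.X \<epsilon> p s T > 0" using sa by blast
        then show ?thesis using sa sb fin(3) by simp
      next
        case 2
        then show ?thesis using sa sb fin(4) by simp
      next
        case 3
        then have "b.Y \<epsilon> q r T' < 0" using fin(4) by simp
        then have "b.X \<epsilon> q r T' > 0" using sb by blast
        then show ?thesis using sa sb fin(3) by simp
      qed
    qed
    have "3 * \<kappa> \<le> T" "3 * \<kappa> \<le> T'"
      using bd \<nu>le \<kappa> unfolding T_def T'_def abs_le_iff by linarith+
    then have "\<exists>w. is_solution f g \<epsilon> w \<and> is_min_period w (T + T')"
      by (rule periodic_orbit[OF \<epsilon>(1) \<kappa>(1) _ _ start fin]) (use nonpos sa sb in simp_all)
    moreover have "\<bar>T + T' - (- \<tau> - \<sigma>)\<bar> \<le> \<mu>"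
      using bd \<nu>le unfolding T_def T'_def abs_le_iff by (intro conjI) linarith+
    ultimately show "\<exists>w T. is_solution f g \<epsilon> w \<and> is_min_period w T \<and> \<bar>T - (- \<tau> - \<sigma>)\<bar> \<le> \<mu>"
      by blast
  qed
qed

end

text \<open>The threshold and the orbit supplied for a tolerance \<mu> may change with \<mu>. At
  each \<epsilon> a \<open>T\<close> is taken whose distance from \<open>c\<close> is within
  \<epsilon> of the infimum over all admissible ones; this single choice is good for every
  tolerance.\<close>

lemma convergent_choice:
  fixes P :: "real \<Rightarrow> 'a \<Rightarrow> real \<Rightarrow> bool"
  assumes "\<And>\<mu>. \<mu> > 0 \<Longrightarrow> \<exists>\<epsilon>0>0. \<forall>\<epsilon>. 0 < \<epsilon> \<and> \<epsilon> < \<epsilon>0 \<longrightarrow> (\<exists>w T. P \<epsilon> w T \<and> \<bar>T - c\<bar> \<le> \<mu>)"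
  shows "\<exists>\<epsilon>0>0. \<exists>w T. (\<forall>\<epsilon>. 0 < \<epsilon> \<and> \<epsilon> < \<epsilon>0 \<longrightarrow> P \<epsilon> (w \<epsilon>) (T \<epsilon>)) \<and> (T \<longlongrightarrow> c) (at_right 0)"
proof -
  define D where "D = (\<lambda>\<epsilon>. {\<bar>T - c\<bar> | w T. P \<epsilon> w T})"
  have D: "\<bar>T - c\<bar> \<in> D \<epsilon>" if "P \<epsilon> w T" for \<epsilon> w T
    using that unfolding D_def by blast
  have bdd: "bdd_below (D \<epsilon>)" for \<epsilon> by (rule bdd_belowI[of _ 0]) (auto simp: D_def)
  have "\<exists>\<epsilon>0>0. \<forall>\<epsilon>. 0 < \<epsilon> \<and> \<epsilon> < \<epsilon>0 \<longrightarrow> (\<exists>w T. P \<epsilon> w T \<and> \<bar>T - c\<bar> \<le> 1)"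
    by (rule assms) simp
  then obtain \<epsilon>1 where \<epsilon>1: "\<epsilon>1 > 0"
    "\<forall>\<epsilon>. 0 < \<epsilon> \<and> \<epsilon> < \<epsilon>1 \<longrightarrow> (\<exists>w T. P \<epsilon> w T \<and> \<bar>T - c\<bar> \<le> 1)"
    by (elim exE conjE)
  have ne: "D \<epsilon> \<noteq> {}" if "0 < \<epsilon>" "\<epsilon> < \<epsilon>1" for \<epsilon>
    using \<epsilon>1(2) that D by blast
  have "\<exists>w T. P \<epsilon> w T \<and> \<bar>T - c\<bar> < Inf (D \<epsilon>) + \<epsilon>" if "0 < \<epsilon>" "\<epsilon> < \<epsilon>1" for \<epsilon>
  proof -
    have "Inf (D \<epsilon>) < Inf (D \<epsilon>) + \<epsilon>" using that by simp
    then have "\<exists>d\<in>D \<epsilon>. d < Inf (D \<epsilon>) + \<epsilon>"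
      by (rule cInf_lessD[OF ne[OF that]])
    then show ?thesis unfolding D_def by blast
  qed
  then have "\<forall>\<epsilon>. \<exists>wT. 0 < \<epsilon> \<and> \<epsilon> < \<epsilon>1 \<longrightarrow> P \<epsilon> (fst wT) (snd wT) \<and> \<bar>snd wT - c\<bar> < Inf (D \<epsilon>) + \<epsilon>"
    by auto
  then obtain wT where wT: "\<And>\<epsilon>. 0 < \<epsilon> \<Longrightarrow> \<epsilon> < \<epsilon>1 \<Longrightarrow>
      P \<epsilon> (fst (wT \<epsilon>)) (snd (wT \<epsilon>)) \<and> \<bar>snd (wT \<epsilon>) - c\<bar> < Inf (D \<epsilon>) + \<epsilon>"
    by metis
  have "((\<lambda>\<epsilon>. snd (wT \<epsilon>)) \<longlongrightarrow> c) (at_right 0)"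
    unfolding tendsto_iff
  proof (intro allI impI)
    fix e :: real assume e: "e > 0"
    have "\<exists>\<epsilon>0>0. \<forall>\<epsilon>. 0 < \<epsilon> \<and> \<epsilon> < \<epsilon>0 \<longrightarrow> (\<exists>w T. P \<epsilon> w T \<and> \<bar>T - c\<bar> \<le> e / 2)"
      by (rule assms) (use e in simp)
    then obtain \<epsilon>2 where \<epsilon>2: "\<epsilon>2 > 0"
      "\<forall>\<epsilon>. 0 < \<epsilon> \<and> \<epsilon> < \<epsilon>2 \<longrightarrow> (\<exists>w T. P \<epsilon> w T \<and> \<bar>T - c\<bar> \<le> e / 2)"
      by (elim exE conjE)
    have "\<bar>snd (wT \<epsilon>) - c\<bar> < e" if \<epsilon>: "0 < \<epsilon>" "\<epsilon> < min \<epsilon>1 (min \<epsilon>2 (e / 2))" for \<epsilon>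
    proof -
      have "\<exists>w T. P \<epsilon> w T \<and> \<bar>T - c\<bar> \<le> e / 2" using \<epsilon>2(2) \<epsilon> by simp
      then obtain w T where wT': "P \<epsilon> w T" "\<bar>T - c\<bar> \<le> e / 2" by blast
      have "Inf (D \<epsilon>) \<le> e / 2"
        using cInf_lower[OF D[OF wT'(1)] bdd] wT'(2) by linarith
      then show ?thesis using wT[of \<epsilon>] \<epsilon> by simp
    qed
    moreover have "min \<epsilon>1 (min \<epsilon>2 (e / 2)) > 0" using \<epsilon>1 \<epsilon>2 e by simp
    ultimately show "\<forall>\<^sub>F \<epsilon> in at_right 0. dist (snd (wT \<epsilon>)) c < e"
      unfolding eventually_at_right_field dist_real_def by blast
  qed
  then show ?thesis
    using wT \<epsilon>1(1) by (intro exI[of _ \<epsilon>1] conjI exI[of _ "\<lambda>\<epsilon>. fst (wT \<epsilon>)"] exI[of _ "\<lambda>\<epsilon>. snd (wT \<epsilon>)"]) auto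
qed

theorem theorem1:
  fixes f g :: "real \<times> real \<times> real \<Rightarrow> real"
    and M L :: real
    and xa ya xr yr :: "real \<Rightarrow> real"
    and Ta Tr \<tau> \<sigma> xs ys :: real
  assumes bounded: "\<forall>p. \<bar>f p\<bar> < M \<and> \<bar>g p\<bar> < M"
    and lipf: "lipschitz_on L UNIV f"
    and lipg: "lipschitz_on L UNIV g"
    and f0: "f (0, 0, 0) = 0"
    and g0: "g (0, 0, 0) > 0"
    and fy: "\<forall>y. y \<noteq> 0 \<longrightarrow> y * f (0, y, 0) < 0"
    and wa: "\<forall>t. (xa has_real_derivative f (xa t, ya t, xa t)) (at t)
              \<and> (ya has_real_derivative g (xa t, ya t, xa t)) (at t)"
    and wa0: "xa 0 = 0" "ya 0 = 0"
    and wr: "\<forall>t. (xr has_real_derivative f (xr t, yr t, - xr t)) (at t)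
              \<and> (yr has_real_derivative g (xr t, yr t, - xr t)) (at t)"
    and wr0: "xr 0 = 0" "yr 0 = 0"
    and T: "Ta < 0" "0 < Tr"
    and xa_neg: "\<forall>t. Ta < t \<and> t < 0 \<longrightarrow> xa t < 0"
    and xr_neg: "\<forall>t. 0 < t \<and> t < Tr \<longrightarrow> xr t < 0"
    and ts: "Ta < \<tau>" "\<tau> < 0" "0 < \<sigma>" "\<sigma> < Tr"
    and meet: "xa \<tau> = xs" "xr \<sigma> = xs" "ya \<tau> = ys" "yr \<sigma> = ys"
    and A: "f (xs, ys, xs) * g (xs, ys, - xs) - f (xs, ys, - xs) * g (xs, ys, xs) \<noteq> 0"
  shows "\<exists>\<epsilon>0 > 0. \<exists>w :: real \<Rightarrow> real \<Rightarrow> real \<times> real \<times> real. \<exists>Tmin :: real \<Rightarrow> real.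
           (\<forall>\<epsilon>. 0 < \<epsilon> \<and> \<epsilon> < \<epsilon>0 \<longrightarrow>
               is_solution f g \<epsilon> (w \<epsilon>) \<and> is_min_period (w \<epsilon>) (Tmin \<epsilon>))
           \<and> (Tmin \<longlongrightarrow> \<sigma> - \<tau>) (at_right 0)"
proof -
  define f' where "f' = (\<lambda>(x, y, z). - f (x, - y, - z))"
  define g' where "g' = (\<lambda>(x, y, z). g (x, - y, - z))"
  define xb where "xb = (\<lambda>t. xr (- t))"
  define yb where "yb = (\<lambda>t. - yr (- t))"
  \<comment> \<open>The reflection is an isometry, so the second instance has the same Lipschitz
    constant \<open>L\<close>.\<close>
  have dist: "dist (x, - y, - z) (x', - y', - z') = dist (x, y, z) (x', y', z')"
    for x y z x' y' z' :: real
    by (simp add: dist_Pair_Pair dist_minus)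
  have lipf': "L-lipschitz_on UNIV f'"
  proof (rule lipschitz_onI)
    fix v w :: "real \<times> real \<times> real"
    obtain x y z where v: "v = (x, y, z)" by (cases v)
    obtain x' y' z' where w: "w = (x', y', z')" by (cases w)
    show "dist (f' v) (f' w) \<le> L * dist v w"
      using lipschitz_onD[OF lipf, of "(x, - y, - z)" "(x', - y', - z')"]
      unfolding dist by (simp add: f'_def v w dist_minus)
  qed (rule lipschitz_on_nonneg[OF lipf])
  have lipg': "L-lipschitz_on UNIV g'"
  proof (rule lipschitz_onI)
    fix v w :: "real \<times> real \<times> real"
    obtain x y z where v: "v = (x, y, z)" by (cases v)
    obtain x' y' z' where w: "w = (x', y', z')" by (cases w)
    show "dist (g' v) (g' w) \<le> L * dist v w"
      using lipschitz_onD[OF lipg, of "(x, - y, - z)" "(x', - y', - z')"]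
      unfolding dist by (simp add: g'_def v w)
  qed (rule lipschitz_on_nonneg[OF lipg])
  have reflect: "((\<lambda>t. u (- t)) has_real_derivative - d) (at t)"
    if "(u has_real_derivative d) (at (- t))" for u d t
    using has_vector_derivative_reflect[of u d 0 t] that
    by (simp add: has_real_derivative_iff_has_vector_derivative)
  have "singular_cycle f g M L Ta \<tau> xa ya (- Tr) (- \<sigma>) xb yb"
    unfolding singular_cycle_def singular_cycle_axioms_def f'_def[symmetric] g'_def[symmetric]
  proof (intro conjI)
    show "slow_passage f g M L Ta \<tau> xa ya"
    proof
      show "\<bar>f p\<bar> < M" "\<bar>g p\<bar> < M" for p using bounded by blast+
    qed (use lipf lipg f0 g0 fy wa wa0 ts xa_neg in simp_all)
    show "slow_passage f' g' M L (- Tr) (- \<sigma>) xb yb"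
    proof
      show "\<bar>f' p\<bar> < M" "\<bar>g' p\<bar> < M" for p
        using bounded by (simp_all add: f'_def g'_def case_prod_beta)
      show "y * f' (0, y, 0) < 0" if "y \<noteq> 0" for y
        using fy[rule_format, of "- y"] that by (simp add: f'_def)
      show "(xb has_real_derivative f' (xb t, yb t, xb t)) (at t)" for t
        unfolding xb_def using reflect[of xr _ t] wr by (simp add: f'_def yb_def)
      show "(yb has_real_derivative g' (xb t, yb t, xb t)) (at t)" for t
        using DERIV_minus[OF reflect[of yr _ t, OF conjunct2[OF wr[rule_format]]]]
        by (simp add: g'_def yb_def xb_def)
      show "xb t < 0" if "- Tr < t" "t < 0" for t
        using xr_neg that by (simp add: xb_def)
    qed (use lipf' lipg' f0 g0 wr0 ts in \<open>simp_all add: f'_def g'_def xb_def yb_def\<close>)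
  qed (use meet A in \<open>simp_all add: xb_def yb_def\<close>)
  then interpret singular_cycle f g M L Ta \<tau> xa ya "- Tr" "- \<sigma>" xb yb .
  have "- \<tau> - - \<sigma> = \<sigma> - \<tau>" by simp
  from near_periodic_orbit[unfolded this]
  show ?thesis
    by (intro convergent_choice) (simp only: conj_assoc)
qed

end
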